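(* The $\mathrm{GL}$-algebra $D=\mathrm{Div}(\mathbf V)$ (the infinite-variable divided power algebra over $k$) is $\mathrm{GL}$-coherent, i.e. every finitely generated submodule of a finitely presented $D$-module is also finitely presented.
   Context: $k$ is an algebraically closed field of characteristic $p>0$. $\mathbf V$ is the $k$-vector space with basis $\{x_i\}_{i\ge 1}$ and $\mathrm{GL}$ is the group of automorphisms of $\mathbf V$ fixing all but finitely many $x_i$. A polynomial representation of $\mathrm{GL}$ is a subquotient of a (possibly infinite) direct sum of tensor powers $\mathbf V^{\otimes d}$. A $\mathrm{GL}$-algebra is a commutative $k$-algebra with an action of $\mathrm{GL}$ by algebra automorphisms making it a polynomial representation. $D=\mathrm{Div}(\mathbf V)$ is the commutative $k$-algebra generated by $x_i^{[t]}$ ($i,t\ge 1$) with relations $x_i^{[t]}x_i^{[s]}=\binom{t+s}{s}x_i^{[t+s]}$, graded by $\deg x_i^{[t]}=t$, with its natural $\mathrm{GL}$-action $g\cdot x_i^{[t]}=(gx_i)^{[t]}$, where $(\sum_j c_jx_j)^{[t]}=\sum_{\sum t_j=t}\prod_j c_j^{t_j}x_j^{[t_j]}$ (with $x_j^{[0]}=1$). For a $\mathrm{GL}$-algebra $A$, an $A$-module means a $\mathrm{GL}$-equivariant one: a polynomial representation $M$ with an $A$-module structure satisfying $g(am)=g(a)g(m)$; submodules are $\mathrm{GL}$-stable. It is finitely generated if it is generated as an ordinary $A$-module by the $\mathrm{GL}$-orbits of finitely many elements, and finitely presented if there is an exact sequence $A\otimes_k W\to A\otimes_k U\to M\to 0$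 of $A$-modules with $W,U$ finite-length polynomial representations. *)

theory Defs
  imports
    "HOL-Library.Poly_Mapping"
    "HOL-Library.Set_Algebras"
    "HOL-Algebra.Algebra"
    "HOL-Algebra.Algebraic_Closure_Type"
begin

section \<open>The space \<open>V\<close> and the group \<open>GL\<close>\<close>

text \<open>Free vector spaces are finitely supported functions. The index set \<open>{1, 2, \<dots>}\<close> of the basis
  of \<open>V\<close> is renumbered as \<open>nat\<close>.\<close>

type_synonym 'k vec = "nat \<Rightarrow>\<^sub>0 'k"

abbreviation basis_elt :: "'b \<Rightarrow> 'b \<Rightarrow>\<^sub>0 'k::field"
  where "basis_elt b \<equiv> Poly_Mapping.single b 1"

definition pm_scale :: "'k::field \<Rightarrow> ('b \<Rightarrow>\<^sub>0 'k) \<Rightarrow> ('b \<Rightarrow>\<^sub>0 'k)"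
  where "pm_scale c f = Poly_Mapping.map ((*) c) f"

definition lin_extend :: "('b \<Rightarrow> 'c \<Rightarrow>\<^sub>0 'k) \<Rightarrow> ('b \<Rightarrow>\<^sub>0 'k::field) \<Rightarrow> ('c \<Rightarrow>\<^sub>0 'k)"
  where "lin_extend h f = (\<Sum>b\<in>Poly_Mapping.keys f. pm_scale (Poly_Mapping.lookup f b) (h b))"

lemma lookup_pm_scale [simp]:
  "Poly_Mapping.lookup (pm_scale c f) b = c * Poly_Mapping.lookup f b"
  by (simp add: pm_scale_def Poly_Mapping.map.rep_eq when_def)

lemma vector_space_pm_scale: "vector_space pm_scale"
  by unfold_locales (auto intro!: poly_mapping_eqI simp: Poly_Mapping.lookup_add algebra_simps)

definition GL :: "('k::field vec \<Rightarrow> 'k vec) set" where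
  "GL = {g. Vector_Spaces.linear pm_scale pm_scale g \<and> bij g \<and>
            finite {i. g (basis_elt i) \<noteq> basis_elt i}}"


section \<open>The divided power algebra\<close>

text \<open>Polynomials over the generators: the variable \<open>(i, n)\<close> is the generator
  \<open>x\<^sub>i\<^bsup>[n+1]\<^esup>\<close>, so that there is no variable for \<open>x\<^sub>i\<^bsup>[0]\<^esup> = 1\<close>.\<close>

type_synonym 'k dp_poly = "(nat \<times> nat \<Rightarrow>\<^sub>0 nat) \<Rightarrow>\<^sub>0 'k"

definition dp_gen :: "nat \<Rightarrow> nat \<Rightarrow> 'k::field dp_poly" where
  "dp_gen i t = (if t = 0 then 1 else Poly_Mapping.single (Poly_Mapping.single (i, t - 1) 1) 1)"

definition dp_relators :: "'k::field dp_poly set" where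
  "dp_relators = {dp_gen i t * dp_gen i s - of_nat ((t + s) choose s) * dp_gen i (t + s) |i t s.
                    1 \<le> t \<and> 1 \<le> s}"

definition dp_ideal :: "'k::field dp_poly set" where
  "dp_ideal = Modules.module.span (*) dp_relators"

definition dp_eval ::
  "('k::field \<Rightarrow> 'b::comm_ring_1) \<Rightarrow> (nat \<times> nat \<Rightarrow> 'b) \<Rightarrow> 'k dp_poly \<Rightarrow> 'b" where
  "dp_eval \<iota> f p = (\<Sum>m\<in>Poly_Mapping.keys p. \<iota> (Poly_Mapping.lookup p m) *
                      (\<Prod>v\<in>Poly_Mapping.keys m. f v ^ Poly_Mapping.lookup m v))"

lemma module_mult: "Modules.module ((*) :: 'a::comm_ring_1 \<Rightarrow> 'a \<Rightarrow> 'a)"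
  by unfold_locales (auto simp: algebra_simps)

lemma dp_ideal_0: "0 \<in> dp_ideal"
  and dp_ideal_add: "p \<in> dp_ideal \<Longrightarrow> q \<in> dp_ideal \<Longrightarrow> p + q \<in> dp_ideal"
  and dp_ideal_diff: "p \<in> dp_ideal \<Longrightarrow> q \<in> dp_ideal \<Longrightarrow> p - q \<in> dp_ideal"
  and dp_ideal_neg: "p \<in> dp_ideal \<Longrightarrow> - p \<in> dp_ideal"
  and dp_ideal_mult: "p \<in> dp_ideal \<Longrightarrow> q * p \<in> dp_ideal"
  and dp_ideal_relator: "r \<in> dp_relators \<Longrightarrow> r \<in> dp_ideal"
  unfolding dp_ideal_def
  by (rule module.span_zero[OF module_mult] module.span_add[OF module_mult]
      module.span_diff[OF module_mult] module.span_neg[OF module_mult]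
      module.span_scale[OF module_mult] module.span_base[OF module_mult]; assumption)+

locale dp_evaluation =
  fixes \<iota> :: "'k::field \<Rightarrow> 'b::comm_ring_1"
  assumes hom_0: "\<iota> 0 = 0" and hom_1: "\<iota> 1 = 1"
    and hom_add: "\<iota> (a + b) = \<iota> a + \<iota> b" and hom_mult: "\<iota> (a * b) = \<iota> a * \<iota> b"
begin

lemma eval_superset:
  assumes "finite S" "Poly_Mapping.keys p \<subseteq> S"
  shows "dp_eval \<iota> f p = (\<Sum>m\<in>S. \<iota> (Poly_Mapping.lookup p m) *
                      (\<Prod>v\<in>Poly_Mapping.keys m. f v ^ Poly_Mapping.lookup m v))"
  unfolding dp_eval_def
  by (rule sum.mono_neutral_left) (use assms in \<open>auto simp: in_keys_iff hom_0\<close>)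

lemma eval_0: "dp_eval \<iota> f 0 = 0"
  by (simp add: dp_eval_def)

lemma eval_add: "dp_eval \<iota> f (p + q) = dp_eval \<iota> f p + dp_eval \<iota> f q"
proof -
  let ?S = "Poly_Mapping.keys p \<union> Poly_Mapping.keys q"
  have fin: "finite ?S" by simp
  have "Poly_Mapping.keys (p + q) \<subseteq> ?S" by (rule Poly_Mapping.keys_add)
  from eval_superset[OF fin this] eval_superset[OF fin, of p] eval_superset[OF fin, of q]
  show ?thesis
    by (simp add: Poly_Mapping.lookup_add hom_add distrib_right sum.distrib)
qed

lemma eval_diff: "dp_eval \<iota> f (p - q) = dp_eval \<iota> f p - dp_eval \<iota> f q"
  using eval_add[of f "p - q" q] by simp

lemma eval_sum: "dp_eval \<iota> f (sum h S) = (\<Sum>s\<in>S. dp_eval \<iota> f (h s))"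
  by (induction S rule: infinite_finite_induct) (auto simp: eval_0 eval_add)

lemma eval_single: "dp_eval \<iota> f (Poly_Mapping.single m c) =
    \<iota> c * (\<Prod>v\<in>Poly_Mapping.keys m. f v ^ Poly_Mapping.lookup m v)"
  by (cases "c = 0") (auto simp: dp_eval_def hom_0)

lemma eval_1: "dp_eval \<iota> f 1 = 1"
  using eval_single[of f 0 1] by (simp add: hom_1)

lemma monomial_add:
  fixes m n :: "nat \<times> nat \<Rightarrow>\<^sub>0 nat" and f :: "nat \<times> nat \<Rightarrow> 'b"
  shows "(\<Prod>v\<in>Poly_Mapping.keys (m + n). f v ^ Poly_Mapping.lookup (m + n) v) =
         (\<Prod>v\<in>Poly_Mapping.keys m. f v ^ Poly_Mapping.lookup m v) *
         (\<Prod>v\<in>Poly_Mapping.keys n. f v ^ Poly_Mapping.lookup n v)"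
proof -
  let ?S = "Poly_Mapping.keys m \<union> Poly_Mapping.keys n"
  have *: "(\<Prod>v\<in>Poly_Mapping.keys r. f v ^ Poly_Mapping.lookup r v) =
           (\<Prod>v\<in>?S. f v ^ Poly_Mapping.lookup r v)" if "Poly_Mapping.keys r \<subseteq> ?S" for r
    by (rule prod.mono_neutral_left) (use that in \<open>auto simp: in_keys_iff\<close>)
  show ?thesis
    using *[of m] *[of n] *[OF Poly_Mapping.keys_add]
    by (simp add: Poly_Mapping.lookup_add power_add prod.distrib)
qed

lemma poly_mapping_decompose:
  fixes p :: "'c \<Rightarrow>\<^sub>0 'd::comm_monoid_add"
  shows "p = (\<Sum>m\<in>Poly_Mapping.keys p. Poly_Mapping.single m (Poly_Mapping.lookup p m))"
  by (rule poly_mapping_eqI)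
     (auto simp: Poly_Mapping.lookup_sum Poly_Mapping.lookup_single when_def in_keys_iff)

lemma eval_mult: "dp_eval \<iota> f (p * q) = dp_eval \<iota> f p * dp_eval \<iota> f q"
proof -
  let ?s = "\<lambda>r m. Poly_Mapping.single m (Poly_Mapping.lookup r m)"
  have "p * q = (\<Sum>m\<in>Poly_Mapping.keys p. ?s p m) * (\<Sum>n\<in>Poly_Mapping.keys q. ?s q n)"
    using poly_mapping_decompose[of p] poly_mapping_decompose[of q] by simp
  also have "\<dots> = (\<Sum>m\<in>Poly_Mapping.keys p. \<Sum>n\<in>Poly_Mapping.keys q. ?s p m * ?s q n)"
    by (rule sum_product)
  finally have "dp_eval \<iota> f (p * q) =
      (\<Sum>m\<in>Poly_Mapping.keys p. \<Sum>n\<in>Poly_Mapping.keys q. dp_eval \<iota> f (?s p m * ?s q n))"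
    by (simp add: eval_sum)
  also have "\<dots> = (\<Sum>m\<in>Poly_Mapping.keys p. \<Sum>n\<in>Poly_Mapping.keys q.
                     dp_eval \<iota> f (?s p m) * dp_eval \<iota> f (?s q n))"
    by (simp add: Poly_Mapping.mult_single eval_single hom_mult monomial_add mult_ac)
  also have "\<dots> = dp_eval \<iota> f (\<Sum>m\<in>Poly_Mapping.keys p. ?s p m) *
                  dp_eval \<iota> f (\<Sum>n\<in>Poly_Mapping.keys q. ?s q n)"
    by (simp add: eval_sum sum_product)
  finally show ?thesis
    using poly_mapping_decompose[of p] poly_mapping_decompose[of q] by simp
qed

lemma eval_of_nat: "dp_eval \<iota> f (of_nat n) = of_nat n"
  by (induction n) (auto simp: eval_0 eval_1 eval_add)

lemma eval_gen: "dp_eval \<iota> f (dp_gen i t) = (if t = 0 then 1 else f (i, t - 1))"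
  by (auto simp: dp_gen_def eval_1 eval_single hom_1)

lemma eval_ideal:
  assumes "\<And>r. r \<in> dp_relators \<Longrightarrow> dp_eval \<iota> f r = 0" and "p \<in> dp_ideal"
  shows "dp_eval \<iota> f p = 0"
proof -
  have "dp_ideal \<subseteq> {p. dp_eval \<iota> f p = 0}"
    unfolding dp_ideal_def
    by (rule module.span_minimal[OF module_mult])
       (auto simp: module.subspace_def[OF module_mult] eval_0 eval_add eval_mult assms(1))
  with assms(2) show ?thesis by blast
qed

end

lemma one_notin_dp_ideal: "(1 :: 'k::field dp_poly) \<notin> dp_ideal"
proof
  assume *: "(1 :: 'k dp_poly) \<in> dp_ideal"
  interpret dp_evaluation "\<lambda>c::'k. c" by unfold_locales auto
  have "dp_eval (\<lambda>c::'k. c) (\<lambda>_. 0) 1 = 0"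
    by (rule eval_ideal[OF _ *])
       (auto simp: dp_relators_def eval_diff eval_mult eval_gen eval_of_nat)
  then show False by (simp add: eval_1)
qed

quotient_type (overloaded) 'k divpow = "'k::field dp_poly" / "\<lambda>p q. p - q \<in> dp_ideal"
proof (rule equivpI)
  show "reflp (\<lambda>p q :: 'k dp_poly. p - q \<in> dp_ideal)"
    by (simp add: reflp_def dp_ideal_0)
  show "symp (\<lambda>p q :: 'k dp_poly. p - q \<in> dp_ideal)"
    using dp_ideal_neg by (fastforce simp: symp_def)
  show "transp (\<lambda>p q :: 'k dp_poly. p - q \<in> dp_ideal)"
  proof (rule transpI)
    fix p q r :: "'k dp_poly"
    assume "p - q \<in> dp_ideal" "q - r \<in> dp_ideal"
    from dp_ideal_add[OF this] show "p - r \<in> dp_ideal" by simp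
  qed
qed

instantiation divpow :: (field) comm_ring_1
begin

lift_definition zero_divpow :: "'a divpow" is 0 .
lift_definition one_divpow :: "'a divpow" is 1 .

lift_definition plus_divpow :: "'a divpow \<Rightarrow> 'a divpow \<Rightarrow> 'a divpow" is "(+)"
  using dp_ideal_add by (metis add_diff_add)

lift_definition minus_divpow :: "'a divpow \<Rightarrow> 'a divpow \<Rightarrow> 'a divpow" is "(-)"
proof -
  fix p p' q q' :: "'a dp_poly"
  assume "p - p' \<in> dp_ideal" "q - q' \<in> dp_ideal"
  from dp_ideal_diff[OF this] show "p - q - (p' - q') \<in> dp_ideal"
    by (simp add: algebra_simps)
qed

lift_definition uminus_divpow :: "'a divpow \<Rightarrow> 'a divpow" is uminus
  using dp_ideal_neg by fastforce

lift_definition times_divpow :: "'a divpow \<Rightarrow> 'a divpow \<Rightarrow> 'a divpow" is "(*)"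
proof -
  fix p p' q q' :: "'a dp_poly"
  assume "p - p' \<in> dp_ideal" "q - q' \<in> dp_ideal"
  then have "q * (p - p') + p' * (q - q') \<in> dp_ideal"
    by (intro dp_ideal_add dp_ideal_mult)
  then show "p * q - p' * q' \<in> dp_ideal"
    by (simp add: algebra_simps)
qed

instance
proof
  show "(0 :: 'a divpow) \<noteq> 1"
    by transfer (use one_notin_dp_ideal dp_ideal_neg in fastforce)
qed (transfer; simp add: algebra_simps dp_ideal_0)+

end

lift_definition dp_const :: "'k::field \<Rightarrow> 'k divpow" is "\<lambda>c. Poly_Mapping.single 0 c" .

text \<open>\<open>dp_x i t\<close> is \<open>x\<^sub>i\<^bsup>[t]\<^esup>\<close>, with \<open>x\<^sub>i\<^bsup>[0]\<^esup> = 1\<close>.\<close>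

lift_definition dp_x :: "nat \<Rightarrow> nat \<Rightarrow> 'k::field divpow" is dp_gen .

lemma dp_const_hom: "dp_evaluation (dp_const :: 'k::field \<Rightarrow> 'k divpow)"
  by unfold_locales
     (transfer; simp add: Poly_Mapping.single_add Poly_Mapping.mult_single dp_ideal_0)+

lemma dp_x_0 [simp]: "dp_x i 0 = 1"
  by transfer (simp add: dp_gen_def dp_ideal_0)

lemma of_nat_divpow: "(of_nat n :: 'k::field divpow) = abs_divpow (of_nat n)"
  by (induction n) (auto simp: zero_divpow.abs_eq one_divpow.abs_eq plus_divpow.abs_eq)

lemma dp_x_mult:
  "dp_x i t * dp_x i s = of_nat ((t + s) choose s) * (dp_x i (t + s) :: 'k::field divpow)"
proof (cases "t = 0 \<or> s = 0")
  case False
  then have "(dp_gen i t * dp_gen i s - of_nat ((t + s) choose s) * dp_gen i (t + s) :: 'k dp_poly)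
               \<in> dp_relators"
    unfolding dp_relators_def by fastforce
  then show ?thesis
    by (simp only: of_nat_divpow dp_x.abs_eq times_divpow.abs_eq divpow.abs_eq_iff dp_ideal_relator)
qed auto

text \<open>The divided power \<open>v\<^bsup>[t]\<^esup>\<close> of a vector \<open>v = \<Sum>\<^sub>j c\<^sub>j x\<^sub>j\<close>. The exponents \<open>t\<^sub>j\<close> may be
  taken to vanish off the support of \<open>v\<close>: the other summands are \<open>0\<close>.\<close>

definition dp_pow :: "'k::field vec \<Rightarrow> nat \<Rightarrow> 'k divpow" where
  "dp_pow v t =
     (\<Sum>a | (\<forall>j. j \<notin> Poly_Mapping.keys v \<longrightarrow> a j = 0) \<and> (\<Sum>j\<in>Poly_Mapping.keys v. a j) = t.
        \<Prod>j\<in>Poly_Mapping.keys v. dp_const (Poly_Mapping.lookup v j ^ a j) * dp_x j (a j))"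

lemma choose_add_symmetric: "(t + s) choose t = (t + s) choose s"
  by (metis add_diff_cancel_left' binomial_symmetric le_add1)

lemma convolution_divided_powers:
  fixes u w :: "nat \<Rightarrow> 'b::comm_ring_1"
  assumes u: "\<And>t s. u t * u s = of_nat ((t + s) choose t) * u (t + s)"
    and w: "\<And>t s. w t * w s = of_nat ((t + s) choose t) * w (t + s)"
  defines "h \<equiv> \<lambda>t. \<Sum>n\<le>t. u n * w (t - n)"
  shows "h t * h s = of_nat ((t + s) choose t) * h (t + s)"
proof -
  let ?T = "\<lambda>a n. of_nat (n choose a) * of_nat ((t + s - n) choose (t - a)) * (u n * w (t + s - n)) :: 'b"
  have "h t * h s = (\<Sum>a\<le>t. \<Sum>b\<le>s. (u a * w (t - a)) * (u b * w (s - b)))"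
    by (simp add: h_def sum_product)
  also have "\<dots> = (\<Sum>a\<le>t. \<Sum>b\<le>s. ?T a (a + b))"
  proof (intro sum.cong refl)
    fix a b assume ab: "a \<in> {..t}" "b \<in> {..s}"
    define a' b' where "a' = t - a" and "b' = s - b"
    have eq: "t + s - (a + b) = a' + b'" "t - a = a'" "s - b = b'"
      using ab by (auto simp: a'_def b'_def)
    have "(u a * w a') * (u b * w b') = (u a * u b) * (w a' * w b')"
      by (simp only: mult_ac)
    also have "\<dots> = (of_nat ((a + b) choose a) * u (a + b)) *
                    (of_nat ((a' + b') choose a') * w (a' + b'))"
      by (simp only: u[of a b] w[of a' b'])
    also have "\<dots> = of_nat ((a + b) choose a) * of_nat ((a' + b') choose a') *
                    (u (a + b) * w (a' + b'))"
      by (simp only: mult_ac)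
    finally show "(u a * w (t - a)) * (u b * w (s - b)) = ?T a (a + b)"
      by (simp only: eq)
  qed
  also have "\<dots> = (\<Sum>a\<le>t. \<Sum>n\<le>t + s. ?T a n)"
  proof (rule sum.cong[OF refl])
    fix a assume a: "a \<in> {..t}"
    have "(\<Sum>b\<le>s. ?T a (a + b)) = (\<Sum>n\<in>(+) a ` {..s}. ?T a n)"
      by (subst sum.reindex) auto
    also have "\<dots> = (\<Sum>n\<le>t + s. ?T a n)"
    proof (rule sum.mono_neutral_left)
      show "\<forall>n\<in>{..t + s} - (+) a ` {..s}. ?T a n = 0"
      proof
        fix n assume n: "n \<in> {..t + s} - (+) a ` {..s}"
        have "n < a \<or> n > a + s"
        proof (rule ccontr)
          assume "\<not> ?thesis"
          then have "n = a + (n - a)" "n - a \<le> s" by auto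
          with n show False by blast
        qed
        then show "?T a n = 0"
          using a n by (auto simp: binomial_eq_0)
      qed
    qed (use a in auto)
    finally show "(\<Sum>b\<le>s. ?T a (a + b)) = (\<Sum>n\<le>t + s. ?T a n)" .
  qed
  also have "\<dots> = (\<Sum>n\<le>t + s. \<Sum>a\<le>t. ?T a n)"
    by (rule sum.swap)
  also have "\<dots> = (\<Sum>n\<le>t + s. of_nat ((t + s) choose t) * (u n * w (t + s - n)))"
  proof (rule sum.cong[OF refl])
    fix n assume n: "n \<in> {..t + s}"
    have "(\<Sum>a\<le>t. ?T a n) =
          of_nat (\<Sum>a\<le>t. (n choose a) * ((t + s - n) choose (t - a))) * (u n * w (t + s - n))"
      by (simp add: sum_distrib_right)
    also have "(\<Sum>a\<le>t. (n choose a) * ((t + s - n) choose (t - a))) = (t + s) choose t"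
      using n by (subst vandermonde) simp
    finally show "(\<Sum>a\<le>t. ?T a n) = of_nat ((t + s) choose t) * (u n * w (t + s - n))" .
  qed
  finally show ?thesis
    by (simp add: h_def sum_distrib_left)
qed

lemma finite_exponents:
  assumes "finite S"
  shows "finite {a :: nat \<Rightarrow> nat. (\<forall>j. j \<notin> S \<longrightarrow> a j = 0) \<and> sum a S = t}"
proof (rule finite_subset)
  show "{a :: nat \<Rightarrow> nat. (\<forall>j. j \<notin> S \<longrightarrow> a j = 0) \<and> sum a S = t} \<subseteq>
        {a. \<forall>j. (j \<in> S \<longrightarrow> a j \<in> {..t}) \<and> (j \<notin> S \<longrightarrow> a j = 0)}"
    using member_le_sum[OF _ _ assms] by auto
  show "finite {a :: nat \<Rightarrow> nat. \<forall>j. (j \<in> S \<longrightarrow> a j \<in> {..t}) \<and> (j \<notin> S \<longrightarrow> a j = 0)}"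
    by (rule finite_set_of_finite_funs) (use assms in auto)
qed

lemma sum_exponents_insert:
  fixes e :: "nat \<Rightarrow> nat \<Rightarrow> 'b::comm_ring_1"
  assumes S: "finite S" and i: "i \<notin> S"
  shows "(\<Sum>a | (\<forall>j. j \<notin> insert i S \<longrightarrow> a j = 0) \<and> sum a (insert i S) = t.
            \<Prod>j\<in>insert i S. e j (a j)) =
         (\<Sum>n\<le>t. e i n * (\<Sum>a | (\<forall>j. j \<notin> S \<longrightarrow> a j = 0) \<and> sum a S = t - n. \<Prod>j\<in>S. e j (a j)))"
proof -
  let ?A = "\<lambda>S t. {a :: nat \<Rightarrow> nat. (\<forall>j. j \<notin> S \<longrightarrow> a j = 0) \<and> sum a S = t}"
  have upd: "sum (a(i := n)) S = sum a S" "(\<Prod>j\<in>S. e j ((a(i := n)) j)) = (\<Prod>j\<in>S. e j (a j))"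
    for a n using i by (auto intro!: sum.cong prod.cong)
  have "(\<Sum>n\<le>t. e i n * (\<Sum>a\<in>?A S (t - n). \<Prod>j\<in>S. e j (a j))) =
        (\<Sum>(n, a)\<in>(SIGMA n:{..t}. ?A S (t - n)). e i n * (\<Prod>j\<in>S. e j (a j)))"
    using S by (subst sum.Sigma[symmetric]) (simp_all add: finite_exponents sum_distrib_left)
  also have "\<dots> = (\<Sum>a\<in>?A (insert i S) t. \<Prod>j\<in>insert i S. e j (a j))"
  proof (rule sum.reindex_bij_witness
          [where i = "\<lambda>a. (a i, a(i := 0))" and j = "\<lambda>(n, a). a(i := n)"])
    fix x assume x: "x \<in> (SIGMA n:{..t}. ?A S (t - n))"
    then obtain n a where [simp]: "x = (n, a)" and a: "n \<le> t" "\<forall>j. j \<notin> S \<longrightarrow> a j = 0" "sum a S = t - n"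
      by blast
    have "a i = 0" using a i by blast
    then show "((case x of (n, a) \<Rightarrow> a(i := n)) i, (case x of (n, a) \<Rightarrow> a(i := n))(i := 0)) = x"
      by auto
    show "(case x of (n, a) \<Rightarrow> a(i := n)) \<in> ?A (insert i S) t"
      using a S i upd(1)[of a n] by simp
    show "(\<Prod>j\<in>insert i S. e j ((case x of (n, a) \<Rightarrow> a(i := n)) j)) =
          (case x of (n, a) \<Rightarrow> e i n * (\<Prod>j\<in>S. e j (a j)))"
      using S i upd(2)[of a n] by simp
  next
    fix a assume a: "a \<in> ?A (insert i S) t"
    show "(case (a i, a(i := 0)) of (n, a) \<Rightarrow> a(i := n)) = a" by simp
    show "(a i, a(i := 0)) \<in> (SIGMA n:{..t}. ?A S (t - n))"
      using a S i upd(1)[of a 0] by auto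
  qed
  finally show ?thesis by simp
qed

lemma dp_pow_mult: "dp_pow v t * dp_pow v s = of_nat ((t + s) choose s) * dp_pow v (t + s)"
  for v :: "'k::field vec"
proof -
  interpret dp_evaluation "dp_const :: 'k \<Rightarrow> _" by (rule dp_const_hom)
  define e where "e = (\<lambda>j n. dp_const (Poly_Mapping.lookup v j ^ n) * dp_x j n)"
  define E where "E = (\<lambda>S t. \<Sum>a | (\<forall>j. j \<notin> S \<longrightarrow> a j = 0) \<and> sum a S = t. \<Prod>j\<in>S. e j (a j))"
  have "E S t * E S s = of_nat ((t + s) choose t) * E S (t + s)" if "finite S" for S t s
    using that
  proof (induction S arbitrary: t s rule: finite_induct)
    case empty
    have "{a :: nat \<Rightarrow> nat. (\<forall>j. j \<notin> {} \<longrightarrow> a j = 0) \<and> sum a {} = t} =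
          (if t = 0 then {\<lambda>_. 0} else {})" for t
      by auto
    then have "E {} t = (if t = 0 then 1 else 0)" for t
      by (simp only: E_def) simp
    then show ?case by simp
  next
    case (insert i S)
    have e: "e i t * e i s = of_nat ((t + s) choose t) * e i (t + s)" for t s
    proof -
      have "e i t * e i s = dp_const (Poly_Mapping.lookup v i ^ (t + s)) * (dp_x i t * dp_x i s)"
        by (simp add: e_def power_add hom_mult mult_ac)
      also have "dp_x i t * dp_x i s = of_nat ((t + s) choose t) * (dp_x i (t + s) :: 'k divpow)"
        by (simp only: dp_x_mult choose_add_symmetric)
      finally show ?thesis
        by (simp only: e_def mult.left_commute)
    qed
    have "E (insert i S) t = (\<Sum>n\<le>t. e i n * E S (t - n))" for t
      unfolding E_def by (rule sum_exponents_insert[OF insert.hyps])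
    then show ?case
      by (simp only: convolution_divided_powers[of "e i" "E S", OF e insert.IH])
  qed
  from this[OF finite_keys, of v t s] show ?thesis
    by (simp only: E_def e_def dp_pow_def choose_add_symmetric[of t s])
qed

lemma dp_pow_0: "dp_pow v 0 = (1 :: 'k::field divpow)"
proof -
  interpret dp_evaluation "dp_const :: 'k \<Rightarrow> _" by (rule dp_const_hom)
  have "{a :: nat \<Rightarrow> nat. (\<forall>j. j \<notin> Poly_Mapping.keys v \<longrightarrow> a j = 0) \<and>
          (\<Sum>j\<in>Poly_Mapping.keys v. a j) = 0} = {\<lambda>_. 0}" by (auto simp: fun_eq_iff)
  then show ?thesis by (simp add: dp_pow_def hom_1)
qed

text \<open>The algebra endomorphism \<open>x\<^sub>i\<^bsup>[t]\<^esup> \<mapsto> (g x\<^sub>i)\<^bsup>[t]\<^esup>\<close>.\<close>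

lift_definition dp_act :: "('k::field vec \<Rightarrow> 'k vec) \<Rightarrow> 'k divpow \<Rightarrow> 'k divpow"
  is "\<lambda>g. dp_eval dp_const (\<lambda>(i, n). dp_pow (g (basis_elt i)) (Suc n))"
proof -
  fix g :: "'k vec \<Rightarrow> 'k vec" and p q :: "'k dp_poly"
  interpret dp_evaluation "dp_const :: 'k \<Rightarrow> _" by (rule dp_const_hom)
  let ?f = "\<lambda>(i, n). dp_pow (g (basis_elt i)) (Suc n)"
  have gen: "dp_eval dp_const ?f (dp_gen i t) = dp_pow (g (basis_elt i)) t" for i t
    by (simp add: eval_gen dp_pow_0)
  have "dp_eval dp_const ?f r = 0" if r: "r \<in> dp_relators" for r
  proof -
    from r obtain i t s where
      "r = dp_gen i t * dp_gen i s - of_nat ((t + s) choose s) * dp_gen i (t + s)"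
      unfolding dp_relators_def by blast
    then show ?thesis
      by (simp only: eval_diff eval_mult eval_of_nat gen dp_pow_mult diff_self)
  qed
  moreover assume "p - q \<in> dp_ideal"
  ultimately have "dp_eval dp_const ?f (p - q) = 0" by (rule eval_ideal)
  then show "dp_eval dp_const ?f p = dp_eval dp_const ?f q" by (simp add: eval_diff)
qed

lemma dp_act_x: "dp_act g (dp_x i t) = dp_pow (g (basis_elt i)) t"
  and dp_act_const: "dp_act g (dp_const c) = dp_const c"
  and dp_act_add: "dp_act g (a + b) = dp_act g a + dp_act g b"
  and dp_act_mult: "dp_act g (a * b) = dp_act g a * dp_act g b"
  for g :: "'k::field vec \<Rightarrow> 'k vec"
proof -
  interpret dp_evaluation "dp_const :: 'k \<Rightarrow> _" by (rule dp_const_hom)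
  show "dp_act g (dp_x i t) = dp_pow (g (basis_elt i)) t"
    by transfer (simp add: eval_gen dp_pow_0)
  show "dp_act g (dp_const c) = dp_const c"
    by (simp add: dp_act.abs_eq dp_const.abs_eq eval_single)
  show "dp_act g (a + b) = dp_act g a + dp_act g b" by transfer (rule eval_add)
  show "dp_act g (a * b) = dp_act g a * dp_act g b" by transfer (rule eval_mult)
qed


section \<open>Modules with a \<open>GL\<close>-action\<close>

text \<open>The fields \<open>mult\<close> and \<open>one\<close> that \<^typ>\<open>('a, 'm) module\<close> inherits are never used.\<close>

record (overloaded) ('a, 'k, 'm) gl_module = "('a, 'm) module" +
  gl_act :: "('k::zero vec \<Rightarrow> 'k vec) \<Rightarrow> 'm \<Rightarrow> 'm"

text \<open>\<open>ract\<close> is the action of \<open>GL\<close> on the ring of scalars: \<^const>\<open>dp_act\<close> for modules over the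
  divided power algebra, and trivial for representations over \<open>k\<close>.\<close>

definition is_gl_module ::
  "(('k::field vec \<Rightarrow> 'k vec) \<Rightarrow> 'a \<Rightarrow> 'a) \<Rightarrow> ('a::comm_ring_1, 'k, 'm) gl_module \<Rightarrow> bool" where
  "is_gl_module ract M \<longleftrightarrow>
     Module.module ring_of_type_algebra M \<and>
     (\<forall>g\<in>GL. \<forall>x\<in>carrier M. gl_act M g x \<in> carrier M) \<and>
     (\<forall>x\<in>carrier M. gl_act M id x = x) \<and>
     (\<forall>g\<in>GL. \<forall>h\<in>GL. \<forall>x\<in>carrier M. gl_act M (g \<circ> h) x = gl_act M g (gl_act M h x)) \<and>
     (\<forall>g\<in>GL. \<forall>x\<in>carrier M. \<forall>y\<in>carrier M.
        gl_act M g (x \<oplus>\<^bsub>M\<^esub> y) = gl_act M g x \<oplus>\<^bsub>M\<^esub> gl_act M g y) \<and>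
     (\<forall>g\<in>GL. \<forall>a. \<forall>x\<in>carrier M. gl_act M g (a \<odot>\<^bsub>M\<^esub> x) = ract g a \<odot>\<^bsub>M\<^esub> gl_act M g x)"

definition gl_submodule :: "'m set \<Rightarrow> ('a::comm_ring_1, 'k::field, 'm) gl_module \<Rightarrow> bool" where
  "gl_submodule N M \<longleftrightarrow>
     submodule N ring_of_type_algebra M \<and> (\<forall>g\<in>GL. \<forall>x\<in>N. gl_act M g x \<in> N)"

definition gl_hom ::
  "('a, 'k::field, 'm) gl_module \<Rightarrow> ('a, 'k, 'n) gl_module \<Rightarrow> ('m \<Rightarrow> 'n) set" where
  "gl_hom M N = {f. f \<in> carrier M \<rightarrow> carrier N \<and>
     (\<forall>x\<in>carrier M. \<forall>y\<in>carrier M. f (x \<oplus>\<^bsub>M\<^esub> y) = f x \<oplus>\<^bsub>N\<^esub> f y) \<and>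
     (\<forall>a. \<forall>x\<in>carrier M. f (a \<odot>\<^bsub>M\<^esub> x) = a \<odot>\<^bsub>N\<^esub> f x) \<and>
     (\<forall>g\<in>GL. \<forall>x\<in>carrier M. f (gl_act M g x) = gl_act N g (f x))}"


section \<open>Polynomial representations\<close>

fun tensor_vecs :: "'k::field vec list \<Rightarrow> (nat list \<Rightarrow>\<^sub>0 'k)" where
  "tensor_vecs [] = basis_elt []"
| "tensor_vecs (v # vs) =
     lin_extend (\<lambda>j. lin_extend (\<lambda>js. basis_elt (j # js)) (tensor_vecs vs)) v"

text \<open>\<open>\<Oplus>\<^sub>i\<^sub>\<in>\<^sub>I V\<^bsup>\<otimes>d i\<^esup>\<close>: the pair \<open>(i, [j\<^sub>1, \<dots>, j\<^sub>d])\<close> is the basis vector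
  \<open>x\<^bsub>j\<^sub>1\<^esub> \<otimes> \<dots> \<otimes> x\<^bsub>j\<^sub>d\<^esub>\<close> of the \<open>i\<close>-th summand, and \<open>g\<close> maps it to
  \<open>g x\<^bsub>j\<^sub>1\<^esub> \<otimes> \<dots> \<otimes> g x\<^bsub>j\<^sub>d\<^esub>\<close> in the same summand.\<close>

definition tensor_powers ::
  "'i set \<Rightarrow> ('i \<Rightarrow> nat) \<Rightarrow> ('k::field, 'k, ('i \<times> nat list) \<Rightarrow>\<^sub>0 'k) gl_module" where
  "tensor_powers I d =
     \<lparr>carrier = {f. \<forall>(i, js)\<in>Poly_Mapping.keys f. i \<in> I \<and> length js = d i},
      monoid.mult = undefined, one = undefined, ring.zero = 0, add = (+),
      module.smult = pm_scale,
      gl_act = (\<lambda>g. lin_extend (\<lambda>(i, js).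
        lin_extend (\<lambda>ls. basis_elt (i, ls)) (tensor_vecs (map (\<lambda>j. g (basis_elt j)) js))))\<rparr>"

text \<open>\<open>U\<close> is (isomorphic to) a subquotient \<open>S / S'\<close>. Summands indexed by subsets of
  \<open>'m \<times> nat\<close>, where \<open>'m\<close> is the type of vectors of \<open>U\<close>, are no restriction: each \<open>u \<in> U\<close> lifts to
  some \<open>s\<^sub>u \<in> S\<close> in finitely many summands, and \<open>U\<close> is a quotient of the (external) direct sum
  over \<open>u\<close> of the subrepresentations generated by the \<open>s\<^sub>u\<close>.\<close>

definition polynomial_rep :: "('k::field, 'k, 'm) gl_module \<Rightarrow> bool" where
  "polynomial_rep U \<longleftrightarrow>
     is_gl_module (\<lambda>g c. c) U \<and>
     (\<exists>(I :: ('m \<times> nat) set) d S S'. \<exists>f \<in> gl_hom ((tensor_powers I d)\<lparr>carrier := S\<rparr>) U.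
        gl_submodule S (tensor_powers I d) \<and> gl_submodule S' (tensor_powers I d) \<and> S' \<subseteq> S \<and>
        f ` S = carrier U \<and> {s \<in> S. f s = \<zero>\<^bsub>U\<^esub>} = S')"

text \<open>Existence of a composition series.\<close>

definition finite_length :: "('k::field, 'k, 'm) gl_module \<Rightarrow> bool" where
  "finite_length U \<longleftrightarrow>
     (\<exists>n C. C 0 = {\<zero>\<^bsub>U\<^esub>} \<and> C n = carrier U \<and> (\<forall>i\<le>n. gl_submodule (C i) U) \<and>
        (\<forall>i<n. C i \<subset> C (Suc i) \<and> \<not> (\<exists>N. gl_submodule N U \<and> C i \<subset> N \<and> N \<subset> C (Suc i))))"


section \<open>Modules over the divided power algebra\<close>

definition restrict_scalars ::
  "('k::field divpow, 'k, 'm) gl_module \<Rightarrow> ('k, 'k, 'm) gl_module" where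
  "restrict_scalars M =
     \<lparr>carrier = carrier M, monoid.mult = monoid.mult M, one = one M, ring.zero = ring.zero M,
      add = add M, module.smult = (\<lambda>c. module.smult M (dp_const c)), gl_act = gl_act M\<rparr>"

definition div_module :: "('k::field divpow, 'k, 'm) gl_module \<Rightarrow> bool" where
  "div_module M \<longleftrightarrow> is_gl_module dp_act M \<and> polynomial_rep (restrict_scalars M)"

definition finitely_generated :: "('k::field divpow, 'k, 'm) gl_module \<Rightarrow> bool" where
  "finitely_generated M \<longleftrightarrow>
     (\<exists>F. finite F \<and> F \<subseteq> carrier M \<and>
        (\<lambda>N. submodule N ring_of_type_algebra M) hull (\<Union>g\<in>GL. gl_act M g ` F) = carrier M)"

text \<open>\<open>D \<otimes>\<^sub>k U\<close> is the free space on \<open>D \<times> U\<close> modulo the bilinearity relations; its elements are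
  cosets, added elementwise. Ring elements and group elements act on pairs by
  \<open>a (b, u) = (a b, u)\<close> and \<open>g (b, u) = (g b, g u)\<close>.\<close>

definition tensor_rels ::
  "('k::field, 'k, 'u) gl_module \<Rightarrow> (('k divpow \<times> 'u) \<Rightarrow>\<^sub>0 'k) set" where
  "tensor_rels U = Modules.module.span pm_scale
     ({basis_elt (a + b, u) - basis_elt (a, u) - basis_elt (b, u) |a b u. u \<in> carrier U} \<union>
      {basis_elt (a, u \<oplus>\<^bsub>U\<^esub> v) - basis_elt (a, u) - basis_elt (a, v) |a u v.
         u \<in> carrier U \<and> v \<in> carrier U} \<union>
      {basis_elt (dp_const c * a, u) - pm_scale c (basis_elt (a, u)) |c a u. u \<in> carrier U} \<union>
      {basis_elt (a, c \<odot>\<^bsub>U\<^esub> u) - pm_scale c (basis_elt (a, u)) |c a u. u \<in> carrier U})"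

definition div_tensor ::
  "('k::field, 'k, 'u) gl_module \<Rightarrow>
     ('k divpow, 'k, (('k divpow \<times> 'u) \<Rightarrow>\<^sub>0 'k) set) gl_module" where
  "div_tensor U =
     \<lparr>carrier = {z +o tensor_rels U |z. Poly_Mapping.keys z \<subseteq> UNIV \<times> carrier U},
      monoid.mult = undefined, one = undefined, ring.zero = tensor_rels U, add = (+),
      module.smult = (\<lambda>a Z. lin_extend (\<lambda>(b, u). basis_elt (a * b, u)) ` Z + tensor_rels U),
      gl_act = (\<lambda>g Z. lin_extend (\<lambda>(b, u). basis_elt (dp_act g b, gl_act U g u)) ` Z
                        + tensor_rels U)\<rparr>"

text \<open>Representations of finite length are generated by finitely many vectors, each of which lifts
  to finitely many tensor powers. So they have countable dimension, and each of them is isomorphic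
  to one whose underlying set consists of elements of \<^typ>\<open>'k vec\<close>.\<close>

definition finitely_presented :: "('k::field divpow, 'k, 'm) gl_module \<Rightarrow> bool" where
  "finitely_presented M \<longleftrightarrow>
     (\<exists>(W :: ('k, 'k, 'k vec) gl_module) (U :: ('k, 'k, 'k vec) gl_module).
        polynomial_rep W \<and> finite_length W \<and> polynomial_rep U \<and> finite_length U \<and>
        (\<exists>\<phi> \<in> gl_hom (div_tensor W) (div_tensor U). \<exists>\<psi> \<in> gl_hom (div_tensor U) M.
           \<phi> ` carrier (div_tensor W) = {y \<in> carrier (div_tensor U). \<psi> y = \<zero>\<^bsub>M\<^esub>} \<and>
           \<psi> ` carrier (div_tensor U) = carrier M))"

end

theory Submission
  imports Defs "HOL-Library.Multiset_Order" "HOL-Library.Product_Lexorder" "HOL-Library.Sublist"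
    "HOL-Combinatorics.Permutations"
begin

text \<open>For a power \<open>q\<close> of the characteristic let \<open>D\<^sub>q\<close> be the span of the monomials of \<open>D\<close> all of whose
  exponents are \<open>< q\<close>. By Lucas' theorem \<open>D\<^sub>q\<close> is a \<open>GL\<close>-stable subalgebra, \<open>D\<close> is the union of the
  \<open>D\<^sub>q\<close>, and \<open>D\<close> is free over \<open>D\<^sub>q\<close> on the monomials whose exponents are divisible by \<open>q\<close>; let
  \<open>\<pi>\<^sub>e\<close> be the \<open>D\<^sub>q\<close>-linear coordinate projections. A submodule generated by elements with
  coefficients in \<open>D\<^sub>q\<close> is stable under all \<open>\<pi>\<^sub>e\<close>.

  Conversely, in \<open>D \<otimes> T\<close> with \<open>T\<close> a finite sum of tensor powers of \<open>V\<close>, every submodule that is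
  stable under all \<open>\<pi>\<^sub>e\<close> is finitely generated, already under the symmetric group: order the monomials
  by their largest variables first; a monomial with exponents \<open>< q\<close> is a word over a finite alphabet,
  and if one such word is a subword of another then a permutation of the variables followed by
  multiplication by a monomial turns the first into the second with coefficient \<open>1\<close>. So Higman's
  lemma provides a finite Groebner basis.

  Now let \<open>N\<close> be a finitely generated submodule of \<open>M = coker (D \<otimes> W \<rightarrow> D \<otimes> U)\<close>. Both \<open>U\<close>
  and the subrepresentation of \<open>D \<otimes> U\<close> generated by lifts of generators of \<open>N\<close> are covered by
  subrepresentations of tensor powers, because \<open>D\<close> embeds into the tensor algebra. For \<open>q\<close> large, the
  relations among these lifts form a \<open>\<pi>\<^sub>e\<close>-stable submodule, since the relations defining \<open>M\<close> do.\<close>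

text \<open>The difficulty is that \<open>D\<close> is not noetherian even up to \<open>GL\<close>:
  the coefficient of \<open>x_1^[p^r]\<close> vanishes in every product of two elements of positive
  degree, so the augmentation ideal needs generators in infinitely many degrees. Finiteness must
  come from the shape of the submodule, and stability under all \<open>\<pi>_e\<close> is a shape
  that works. Not every submodule has it; \<open>q\<close> is chosen after the module and the
  generators of the submodule. The zero divisors of \<open>D\<close> also spoil the usual
  divisibility of monomials, since \<open>x^[s] x^[t]\<close> may be 0. Two multiplications are
  safe: by a monomial in fresh variables, and by \<open>x^[qe]\<close> on a monomial with exponents
  below \<open>q\<close>; both have structure constant 1. Hence exponents below \<open>q\<close> are
  compared by equality, as letters of an alphabet. Finally, a presentation needs covers
  \<open>D \<otimes> U\<close> with \<open>U\<close> a representation of finite length, not just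
  finitely many orbits. So generators are replaced by the representation they generate; its
  coefficients stay in \<open>D_q\<close> because \<open>D_q\<close> is stable under
  \<open>GL\<close>.\<close>

abbreviation lookup where "lookup \<equiv> Poly_Mapping.lookup"

abbreviation keys where "keys \<equiv> Poly_Mapping.keys"

text \<open>Dual numbers, with \<open>eps^2 = 0\<close>. Since \<open>dp_eval\<close> produces only
  ring homomorphisms, a derivation of the quotient ring is obtained as the \<open>eps\<close>-part
  of a homomorphism into dual numbers; compatibility with the relators is then a case of
  \<open>eval_ideal\<close>.\<close>

datatype 'a dual = Dual (dual_re: 'a) (dual_eps: 'a)

instantiation dual :: (comm_ring_1) comm_ring_1
begin

definition "0 = Dual 0 0"
definition "1 = Dual 1 0"
definition "x + y = Dual (dual_re x + dual_re y) (dual_eps x + dual_eps y)"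
definition "x - y = Dual (dual_re x - dual_re y) (dual_eps x - dual_eps y)"
definition "- x = Dual (- dual_re x) (- dual_eps x)"
definition "x * y = Dual (dual_re x * dual_re y) (dual_re x * dual_eps y + dual_eps x * dual_re y)"

instance
  by standard (auto simp: zero_dual_def one_dual_def plus_dual_def minus_dual_def uminus_dual_def
      times_dual_def algebra_simps)

end

lemmas dual_defs = zero_dual_def one_dual_def plus_dual_def minus_dual_def uminus_dual_def times_dual_def

lemma of_nat_dual: "of_nat n = Dual (of_nat n) 0"
  by (induction n) (auto simp: dual_defs)

interpretation dp_const: dp_evaluation "dp_const :: 'k::field \<Rightarrow> 'k divpow"
  by (rule dp_const_hom)


lemma dp_const_of_nat: "dp_const (of_nat n) = of_nat n"
  by (induction n) (auto simp: dp_const.hom_0 dp_const.hom_1 dp_const.hom_add)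

text \<open>One generator is peeled off a monomial at a time, by induction on its total exponent as
  a polynomial in the generators.\<close>

lemma divpow_induct [case_names const add mult]:
  fixes a :: "'k::field divpow"
  assumes const: "\<And>c. P (dp_const c)" and add: "\<And>a b. P a \<Longrightarrow> P b \<Longrightarrow> P (a + b)"
    and mult: "\<And>i t a. P a \<Longrightarrow> P (dp_x i t * a)"
  shows "P a"
proof -
  have mono: "P (abs_divpow (Poly_Mapping.single m c))" for m :: "nat \<times> nat \<Rightarrow>\<^sub>0 nat" and c
  proof (induction "\<Sum>v\<in>keys m. lookup m v" arbitrary: m rule: less_induct)
    case less
    show ?case
    proof (cases "m = 0")
      case True
      then show ?thesis using const[of c] by (simp add: dp_const.abs_eq)
    next
      case False
      then obtain v where v: "v \<in> keys m" by (metis all_not_in_conv keys_eq_empty)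
      define m' where "m' = m - Poly_Mapping.single v 1"
      have m: "m = Poly_Mapping.single v 1 + m'"
        unfolding m'_def
        by (rule poly_mapping_eqI)
           (use v in \<open>auto simp: lookup_add lookup_minus lookup_single when_def in_keys_iff\<close>)
      have sub: "keys m' \<subseteq> keys m"
        unfolding m by (auto simp: in_keys_iff lookup_add)
      have "(\<Sum>v\<in>keys m'. lookup m' v) = (\<Sum>v\<in>keys m. lookup m' v)"
        by (rule sum.mono_neutral_left) (use sub in \<open>auto simp: in_keys_iff\<close>)
      also have "\<dots> < (\<Sum>w\<in>keys m. lookup m w)"
        by (rule sum_strict_mono_ex1)
           (use v in \<open>auto simp: m'_def lookup_minus lookup_single when_def in_keys_iff\<close>)
      finally have P: "P (abs_divpow (Poly_Mapping.single m' c))" using less by blast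
      obtain i n where vin: "v = (i, n)" by force
      have "Poly_Mapping.single m c = dp_gen i (Suc n) * Poly_Mapping.single m' c"
        by (simp add: dp_gen_def mult_single m vin)
      then have "abs_divpow (Poly_Mapping.single m c) = dp_x i (Suc n) * abs_divpow (Poly_Mapping.single m' c)"
        by (simp add: dp_x.abs_eq times_divpow.abs_eq)
      with mult[OF P] show ?thesis by simp
    qed
  qed
  have P0: "P 0" using const[of 0] by (simp add: dp_const.hom_0)
  have sums: "P (abs_divpow (\<Sum>m\<in>S. Poly_Mapping.single m (f m)))" for S :: "(nat \<times> nat \<Rightarrow>\<^sub>0 nat) set" and f
    by (induction S rule: infinite_finite_induct)
       (use P0 in \<open>auto simp: zero_divpow.abs_eq plus_divpow.abs_eq[symmetric] intro!: add mono\<close>)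
  obtain p where "a = abs_divpow p"
    by (rule that[OF Quotient3_abs_rep[OF Quotient3_divpow, symmetric]])
  then show ?thesis
    using sums[of "\<lambda>m. lookup p m" "keys p"]
    by (simp flip: dp_const.poly_mapping_decompose)
qed


section \<open>Derivations and the monomial basis\<close>

text \<open>The augmentation, that is, the constant term. Every other coefficient is the constant
  term of an iterated derivative.\<close>

lift_definition dp_aug :: "'k::field divpow \<Rightarrow> 'k" is "dp_eval (\<lambda>c. c) (\<lambda>_. 0)"
proof -
  fix p q :: "'k dp_poly" assume *: "p - q \<in> dp_ideal"
  interpret dp_evaluation "\<lambda>c::'k. c" by unfold_locales auto
  have "dp_eval (\<lambda>c::'k. c) (\<lambda>_. 0) (p - q) = 0"
    by (rule eval_ideal[OF _ *])
       (auto simp: dp_relators_def eval_diff eval_mult eval_gen eval_of_nat)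
  then show "dp_eval (\<lambda>c. c) (\<lambda>_. 0) p = dp_eval (\<lambda>c. c) (\<lambda>_. 0) q" by (simp add: eval_diff)
qed

lemma dp_aug_const: "dp_aug (dp_const c) = c"
  and dp_aug_x: "dp_aug (dp_x i t :: 'k divpow) = (if t = 0 then 1 else 0)"
  and dp_aug_add: "dp_aug (a + b) = dp_aug a + dp_aug b"
  and dp_aug_mult: "dp_aug (a * b) = dp_aug a * dp_aug b"
  for c :: "'k::field" and a b :: "'k divpow"
proof -
  interpret dp_evaluation "\<lambda>c::'k. c" by unfold_locales auto
  show "dp_aug (dp_const c) = c" by transfer (simp add: eval_single)
  show "dp_aug (dp_x i t :: 'k divpow) = (if t = 0 then 1 else 0)" by transfer (simp add: eval_gen)
  show "dp_aug (a + b) = dp_aug a + dp_aug b" by transfer (rule eval_add)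
  show "dp_aug (a * b) = dp_aug a * dp_aug b" by transfer (rule eval_mult)
qed

lemma dual_const_hom: "dp_evaluation (\<lambda>c. Dual (dp_const c) 0 :: 'k::field divpow dual)"
  by unfold_locales
     (auto simp: dual_defs dp_const.hom_0 dp_const.hom_1 dp_const.hom_add dp_const.hom_mult)

text \<open>\<open>a \<mapsto> a + \<epsilon> \<partial>\<^sub>j a\<close>, where \<open>\<partial>\<^sub>j\<close> is the derivation with \<open>\<partial>\<^sub>j x\<^sub>j\<^bsup>[t]\<^esup> = x\<^sub>j\<^bsup>[t-1]\<^esup>\<close>.\<close>

lift_definition dp_taylor :: "nat \<Rightarrow> 'k::field divpow \<Rightarrow> 'k divpow dual"
  is "\<lambda>j. dp_eval (\<lambda>c. Dual (dp_const c) 0) (\<lambda>(i, n). Dual (dp_x i (Suc n)) (if i = j then dp_x i n else 0))"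
proof -
  fix j and p q :: "'k dp_poly" assume *: "p - q \<in> dp_ideal"
  interpret dp_evaluation "\<lambda>c. Dual (dp_const c) 0 :: 'k::field divpow dual" by (rule dual_const_hom)
  let ?f = "\<lambda>(i, n). Dual (dp_x i (Suc n)) (if i = j then dp_x i n else 0) :: 'k divpow dual"
  have "dp_eval (\<lambda>c. Dual (dp_const c) 0) ?f r = 0" if r: "r \<in> dp_relators" for r
  proof -
    from r obtain i t s where
      r: "r = dp_gen i t * dp_gen i s - of_nat ((t + s) choose s) * dp_gen i (t + s)" "1 \<le> t" "1 \<le> s"
      unfolding dp_relators_def by blast
    obtain t' s' where ts: "t = Suc t'" "s = Suc s'" using r(2,3) by (metis Suc_le_D One_nat_def)
    show ?thesis
      \<comment> \<open>The \<open>eps\<close>-part of the relation for \<open>i = j\<close> is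
        Pascal's rule for the binomials of \<open>(t - 1, s)\<close>, \<open>(t, s - 1)\<close> and
        \<open>(t, s)\<close>.\<close>
      using dp_x_mult[of i t s, where 'k='k] dp_x_mult[of i t' s, where 'k='k] dp_x_mult[of i t s', where 'k='k]
      unfolding r(1) eval_diff eval_mult eval_of_nat eval_gen ts
      by (auto simp: dual_defs of_nat_dual algebra_simps)
  qed
  from eval_ideal[OF this *]
  show "dp_eval (\<lambda>c. Dual (dp_const c) 0) ?f p = dp_eval (\<lambda>c. Dual (dp_const c) 0) ?f q"
    by (simp add: eval_diff)
qed

lemma dp_taylor_const: "dp_taylor j (dp_const c) = Dual (dp_const c) 0"
  and dp_taylor_x: "dp_taylor j (dp_x i t :: 'k divpow) = Dual (dp_x i t) (if i = j \<and> t > 0 then dp_x i (t - 1) else 0)"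
  and dp_taylor_add: "dp_taylor j (a + b) = dp_taylor j a + dp_taylor j b"
  and dp_taylor_mult: "dp_taylor j (a * b) = dp_taylor j a * dp_taylor j b"
  for c :: "'k::field" and a b :: "'k divpow"
proof -
  interpret dp_evaluation "\<lambda>c. Dual (dp_const c) 0 :: 'k::field divpow dual" by (rule dual_const_hom)
  show "dp_taylor j (dp_const c) = Dual (dp_const c) 0"
  proof -
    have "dp_taylor j (abs_divpow (Poly_Mapping.single 0 c)) = Dual (dp_const c) 0"
      by (subst dp_taylor.abs_eq) (simp add: eval_single)
    then show ?thesis by (simp only: dp_const.abs_eq[symmetric])
  qed
  show "dp_taylor j (dp_x i t :: 'k divpow) = Dual (dp_x i t) (if i = j \<and> t > 0 then dp_x i (t - 1) else 0)"
  proof -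
    have "dp_taylor j (abs_divpow (dp_gen i t)) =
        (Dual (dp_x i t) (if i = j \<and> t > 0 then dp_x i (t - 1) else 0) :: 'k divpow dual)"
      by (subst dp_taylor.abs_eq) (auto simp: eval_gen dual_defs)
    then show ?thesis by (simp only: dp_x.abs_eq[symmetric])
  qed
  obtain p q where "a = abs_divpow p" "b = abs_divpow q"
    by (rule that[OF Quotient3_abs_rep[OF Quotient3_divpow, symmetric] Quotient3_abs_rep[OF Quotient3_divpow, symmetric]])
  then show "dp_taylor j (a + b) = dp_taylor j a + dp_taylor j b"
    and "dp_taylor j (a * b) = dp_taylor j a * dp_taylor j b"
    by (simp_all only: plus_divpow.abs_eq times_divpow.abs_eq dp_taylor.abs_eq eval_add eval_mult)
qed

lemma dual_re_dp_taylor: "dual_re (dp_taylor j a) = a"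
  by (induction a rule: divpow_induct)
     (auto simp: dp_taylor_const dp_taylor_x dp_taylor_add dp_taylor_mult dual_defs)

definition dp_der :: "nat \<Rightarrow> 'k::field divpow \<Rightarrow> 'k divpow" where
  "dp_der j a = dual_eps (dp_taylor j a)"

lemma dp_der_const [simp]: "dp_der j (dp_const c) = 0"
  by (simp add: dp_der_def dp_taylor_const)

lemma dp_der_x: "dp_der j (dp_x i t) = (if i = j \<and> t > 0 then dp_x i (t - 1) else 0)"
  by (simp add: dp_der_def dp_taylor_x)

lemma dp_der_add: "dp_der j (a + b) = dp_der j a + dp_der j b"
  by (simp add: dp_der_def dp_taylor_add dual_defs)

lemma dp_der_mult: "dp_der j (a * b) = a * dp_der j b + dp_der j a * b"
  by (simp add: dp_der_def dp_taylor_mult dual_defs dual_re_dp_taylor)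

lemma dp_der_0 [simp]: "dp_der j 0 = 0"
  using dp_der_const[of j 0] by (simp add: dp_const.hom_0)

lemma dp_der_1 [simp]: "dp_der j 1 = 0"
  using dp_der_const[of j 1] by (simp add: dp_const.hom_1)

lemma dp_der_sum: "dp_der j (sum f A) = (\<Sum>x\<in>A. dp_der j (f x))"
  by (induction A rule: infinite_finite_induct) (auto simp: dp_der_add)

lemma dp_der_prod_0: "(\<And>x. x \<in> A \<Longrightarrow> dp_der j (f x) = 0) \<Longrightarrow> dp_der j (prod f A) = 0"
  by (induction A rule: infinite_finite_induct) (auto simp: dp_der_mult)

section \<open>Divided power monomials and their structure constants\<close>

definition dp_mono :: "nat multiset \<Rightarrow> 'k::field divpow" where
  "dp_mono A = (\<Prod>i\<in>set_mset A. dp_x i (count A i))"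

lemma dp_mono_superset:
  "finite S \<Longrightarrow> set_mset A \<subseteq> S \<Longrightarrow> dp_mono A = (\<Prod>i\<in>S. dp_x i (count A i))"
  unfolding dp_mono_def by (rule prod.mono_neutral_left) (auto simp: not_in_iff)

lemma dp_mono_empty [simp]: "dp_mono {#} = 1"
  by (simp add: dp_mono_def)

lemma dp_mono_single: "dp_mono (replicate_mset t i) = dp_x i t"
  by (simp add: dp_mono_def)

lemma dp_aug_mono: "dp_aug (dp_mono A :: 'k::field divpow) = (if A = {#} then 1 else 0)"
proof (cases "A = {#}")
  case False
  then obtain i where i: "i \<in># A" by blast
  then have "dp_mono A = dp_x i (count A i) * (\<Prod>j\<in>set_mset A - {i}. dp_x j (count A j) :: 'k divpow)"
    by (simp add: dp_mono_def prod.remove)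
  moreover have "dp_aug (dp_x i (count A i) :: 'k divpow) = 0"
    using i by (auto simp: dp_aug_x count_eq_zero_iff)
  ultimately show ?thesis using False by (simp add: dp_aug_mult)
qed (use dp_aug_const[of 1] in \<open>simp add: dp_const.hom_1\<close>)

text \<open>Unlike an ordinary partial derivative, this one lowers an exponent without producing an
  integer factor, so nothing is lost in characteristic \<open>p\<close>.\<close>

lemma dp_der_mono:
  "dp_der j (dp_mono A :: 'k::field divpow) = (if j \<in># A then dp_mono (A - {#j#}) else 0)"
proof (cases "j \<in># A")
  case True
  let ?R = "\<Prod>i\<in>set_mset A - {j}. dp_x i (count A i) :: 'k divpow"
  have 1: "dp_mono A = dp_x j (count A j) * ?R"
    using True by (simp add: dp_mono_def prod.remove)
  have R: "dp_der j ?R = 0" by (rule dp_der_prod_0) (auto simp: dp_der_x)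
  have "dp_mono (A - {#j#}) = (\<Prod>i\<in>set_mset A. dp_x i (count (A - {#j#}) i) :: 'k divpow)"
    by (rule dp_mono_superset) (auto dest: in_diffD)
  also have "\<dots> = dp_x j (count A j - 1) * (\<Prod>i\<in>set_mset A - {j}. dp_x i (count (A - {#j#}) i))"
    using True by (simp add: prod.remove)
  also have "(\<Prod>i\<in>set_mset A - {j}. dp_x i (count (A - {#j#}) i)) = ?R"
    by (rule prod.cong) auto
  finally show ?thesis using True R unfolding 1 by (simp add: dp_der_mult dp_der_x)
next
  case False
  then show ?thesis unfolding dp_mono_def by (auto intro!: dp_der_prod_0 simp: dp_der_x)
qed

definition mbinom :: "nat multiset \<Rightarrow> nat multiset \<Rightarrow> nat" where
  "mbinom A B = (\<Prod>i\<in>set_mset (A + B). (count A i + count B i) choose count A i)"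

lemma dp_mono_mult: "dp_mono A * dp_mono B = (of_nat (mbinom A B) * dp_mono (A + B) :: 'k::field divpow)"
proof -
  let ?S = "set_mset (A + B)"
  have "dp_mono A * dp_mono B = (\<Prod>i\<in>?S. dp_x i (count A i) * dp_x i (count B i) :: 'k divpow)"
    by (subst (1 2) dp_mono_superset[of ?S]) (auto simp: prod.distrib)
  also have "\<dots> = (\<Prod>i\<in>?S. of_nat ((count A i + count B i) choose count A i) * dp_x i (count (A + B) i))"
    by (simp add: dp_x_mult choose_add_symmetric[symmetric])
  also have "\<dots> = of_nat (mbinom A B) * dp_mono (A + B)"
    by (simp add: mbinom_def dp_mono_def prod.distrib)
  finally show ?thesis .
qed

text \<open>The spanning half of the basis theorem: multiplication by \<open>x_i^[t]\<close> sends a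
  monomial to a scalar multiple of a monomial.\<close>

lemma divpow_mono_induct [case_names add mono]:
  fixes a :: "'k::field divpow"
  assumes add: "\<And>a b. P a \<Longrightarrow> P b \<Longrightarrow> P (a + b)" and mono: "\<And>c A. P (dp_const c * dp_mono A)"
  shows "P a"
proof -
  have P0: "P 0" using mono[of 0 "{#}"] by (simp add: dp_const.hom_0)
  have sums: "P (\<Sum>A\<in>S. dp_const (c A) * dp_mono A)" if "finite S" for S and c :: "_ \<Rightarrow> 'k"
    using that by (induction S) (auto intro!: P0 add mono)
  have "\<exists>S c. finite S \<and> a = (\<Sum>A\<in>S. dp_const (c A) * dp_mono A)"
  proof (induction a rule: divpow_induct)
    case (const c)
    show ?case by (rule exI[of _ "{{#}}"], rule exI[of _ "\<lambda>_. c"]) simp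
  next
    case (add a b)
    from add obtain S c S' c' where S: "finite S" "finite S'"
      "a = (\<Sum>A\<in>S. dp_const (c A) * dp_mono A)" "b = (\<Sum>A\<in>S'. dp_const (c' A) * dp_mono A)"
      by blast
    have a: "a = (\<Sum>A\<in>S \<union> S'. dp_const (if A \<in> S then c A else 0) * dp_mono A)"
      unfolding S(3) using S(1,2) by (intro sum.mono_neutral_cong_left) (auto simp: dp_const.hom_0)
    have b: "b = (\<Sum>A\<in>S \<union> S'. dp_const (if A \<in> S' then c' A else 0) * dp_mono A)"
      unfolding S(4) using S(1,2) by (intro sum.mono_neutral_cong_left) (auto simp: dp_const.hom_0)
    show ?case
      by (rule exI[of _ "S \<union> S'"], rule exI[of _ "\<lambda>A. (if A \<in> S then c A else 0) + (if A \<in> S' then c' A else 0)"])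
         (use S in \<open>auto simp: a b dp_const.hom_add distrib_right sum.distrib\<close>)
  next
    case (mult i t a)
    then obtain S c where S: "finite S" "a = (\<Sum>A\<in>S. dp_const (c A) * dp_mono A)" by blast
    let ?R = "replicate_mset t i"
    have inj: "inj_on ((+) ?R) S" by simp
    have "dp_x i t * a = (\<Sum>A\<in>S. dp_const (c A * of_nat (mbinom ?R A)) * dp_mono (?R + A))"
      unfolding S(2) sum_distrib_left
    proof (rule sum.cong[OF refl])
      fix A
      have "dp_x i t * (dp_const (c A) * dp_mono A) = dp_const (c A) * (dp_mono ?R * dp_mono A)"
        by (simp add: dp_mono_single mult_ac)
      also have "\<dots> = dp_const (c A * of_nat (mbinom ?R A)) * dp_mono (?R + A)"
        by (simp add: dp_mono_mult dp_const.hom_mult dp_const_of_nat mult.assoc)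
      finally show "dp_x i t * (dp_const (c A) * dp_mono A) = dp_const (c A * of_nat (mbinom ?R A)) * dp_mono (?R + A)" .
    qed
    also have "\<dots> = (\<Sum>A\<in>(+) ?R ` S. dp_const (c (A - ?R) * of_nat (mbinom ?R (A - ?R))) * dp_mono A)"
      by (subst sum.reindex[OF inj]) simp
    finally show ?case
      by (intro exI[of _ "(+) ?R ` S"] exI[of _ "\<lambda>A. c (A - ?R) * of_nat (mbinom ?R (A - ?R))"] conjI)
         (use S(1) in auto)
  qed
  then show ?thesis using sums by blast
qed

section \<open>Coefficients with respect to the monomial basis\<close>

fun dp_word_coef :: "nat list \<Rightarrow> 'k::field divpow \<Rightarrow> 'k" where
  "dp_word_coef [] a = dp_aug a"
| "dp_word_coef (k # ks) a = dp_word_coef ks (dp_der k a)"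

lemma dp_word_coef_add: "dp_word_coef ks (a + b) = dp_word_coef ks a + dp_word_coef ks b"
  by (induction ks arbitrary: a b) (auto simp: dp_aug_add dp_der_add)

lemma dp_word_coef_0: "dp_word_coef ks 0 = 0"
  by (induction ks) (simp_all add: dp_aug_const[of 0, unfolded dp_const.hom_0])

lemma dp_word_coef_const_mult: "dp_word_coef ks (dp_const c * a) = c * dp_word_coef ks a"
  by (induction ks arbitrary: a) (auto simp: dp_aug_mult dp_aug_const dp_der_mult)

text \<open>Differentiating along a word removes its letters one by one, and the augmentation then
  detects whether nothing is left. This is the linear independence of the monomials. Words are used
  because matrices act on them as tensor indices later.\<close>

lemma dp_word_coef_mono: "dp_word_coef ks (dp_mono A) = (if mset ks = A then 1 else 0)"
  by (induction ks arbitrary: A)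
     (auto simp: dp_aug_mono dp_der_mono dp_word_coef_0)

text \<open>The sorted word is an arbitrary choice; \<open>dp_word_coef_eq\<close> shows on
  monomials that every word with content \<open>A\<close> gives the same value.\<close>

definition dp_coef :: "'k::field divpow \<Rightarrow> nat multiset \<Rightarrow> 'k" where
  "dp_coef a A = dp_word_coef (sorted_list_of_multiset A) a"

lemma dp_coef_add: "dp_coef (a + b) A = dp_coef a A + dp_coef b A"
  by (simp add: dp_coef_def dp_word_coef_add)

lemma dp_coef_0 [simp]: "dp_coef 0 A = 0"
  by (simp add: dp_coef_def dp_word_coef_0)

lemma dp_coef_const_mult: "dp_coef (dp_const c * a) A = c * dp_coef a A"
  by (simp add: dp_coef_def dp_word_coef_const_mult)

lemma dp_coef_mono: "dp_coef (dp_mono A) B = (if A = B then 1 else 0)"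
  by (auto simp: dp_coef_def dp_word_coef_mono)

lemma dp_coef_uminus: "dp_coef (- a) A = - dp_coef a A"
  using dp_coef_add[of a "- a" A] by (simp add: add_eq_0_iff)

lemma dp_coef_diff: "dp_coef (a - b) A = dp_coef a A - dp_coef b A"
  using dp_coef_add[of a "- b" A] by (simp add: dp_coef_uminus)

lemma dp_coef_sum: "dp_coef (sum f S) A = (\<Sum>x\<in>S. dp_coef (f x) A)"
  by (induction S rule: infinite_finite_induct) (auto simp: dp_coef_add)

lemma dp_word_coef_eq: "dp_word_coef ks a = dp_coef a (mset ks)"
  by (induction a rule: divpow_mono_induct)
     (auto simp: dp_word_coef_add dp_coef_add dp_coef_const_mult dp_word_coef_const_mult
        dp_coef_mono dp_word_coef_mono)


lemma finite_dp_coef: "finite {A. dp_coef a A \<noteq> 0}"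
proof (induction a rule: divpow_mono_induct)
  case (add a b)
  have "{A. dp_coef (a + b) A \<noteq> 0} \<subseteq> {A. dp_coef a A \<noteq> 0} \<union> {A. dp_coef b A \<noteq> 0}"
    by (auto simp: dp_coef_add)
  then show ?case using add finite_subset by blast
next
  case (mono c A)
  have "{B. dp_coef (dp_const c * dp_mono A) B \<noteq> 0} \<subseteq> {A}"
    by (auto simp: dp_coef_const_mult dp_coef_mono split: if_splits)
  then show ?case using finite_subset by blast
qed

lemma dp_expand_superset:
  assumes "finite S" "{A. dp_coef a A \<noteq> 0} \<subseteq> S"
  shows "a = (\<Sum>A\<in>S. dp_const (dp_coef a A) * dp_mono A)"
  using assms
proof (induction a arbitrary: S rule: divpow_mono_induct)
  case (add a b S)
  let ?S = "S \<union> {A. dp_coef a A \<noteq> 0} \<union> {A. dp_coef b A \<noteq> 0}"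
  have fin: "finite ?S" using add.prems by (simp add: finite_dp_coef)
  have a: "a = (\<Sum>A\<in>?S. dp_const (dp_coef a A) * dp_mono A)" by (rule add.IH(1)[OF fin]) auto
  have b: "b = (\<Sum>A\<in>?S. dp_const (dp_coef b A) * dp_mono A)" by (rule add.IH(2)[OF fin]) auto
  have "a + b = (\<Sum>A\<in>?S. dp_const (dp_coef a A) * dp_mono A) + (\<Sum>A\<in>?S. dp_const (dp_coef b A) * dp_mono A)"
    by (rule arg_cong2[where f="(+)", OF a b])
  also have "\<dots> = (\<Sum>A\<in>?S. dp_const (dp_coef (a + b) A) * dp_mono A)"
    by (simp add: dp_coef_add dp_const.hom_add distrib_right sum.distrib)
  also have "\<dots> = (\<Sum>A\<in>S. dp_const (dp_coef (a + b) A) * dp_mono A)"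
  proof (rule sum.mono_neutral_right[OF fin])
    have "dp_coef (a + b) A = 0" if "A \<notin> S" for A using add.prems(2) that by blast
    then show "\<forall>A\<in>?S - S. dp_const (dp_coef (a + b) A) * dp_mono A = 0"
      by (simp add: dp_const.hom_0)
  qed auto
  finally show ?case .
next
  case (mono c A S)
  show ?case
  proof (cases "c = 0")
    case True
    then show ?thesis by (simp add: dp_const.hom_0)
  next
    case False
    then have "A \<in> S" using mono by (auto simp: dp_coef_const_mult dp_coef_mono)
    have "(\<Sum>B\<in>S. dp_const (dp_coef (dp_const c * dp_mono A) B) * dp_mono B) =
       (\<Sum>B\<in>{A}. dp_const (dp_coef (dp_const c * dp_mono A) B) * dp_mono B)"
      by (rule sum.mono_neutral_right)
         (use mono \<open>A \<in> S\<close> in \<open>auto simp: dp_const.hom_0 dp_coef_const_mult dp_coef_mono\<close>)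
    then show ?thesis by (simp add: dp_coef_const_mult dp_coef_mono)
  qed
qed

lemma dp_expand: "a = (\<Sum>A | dp_coef a A \<noteq> 0. dp_const (dp_coef a A) * dp_mono A)"
  by (rule dp_expand_superset[OF finite_dp_coef order_refl])

lemma dp_coef_eqI: "(\<And>A. dp_coef a A = dp_coef b A) \<Longrightarrow> a = b"
  using dp_expand[of a] dp_expand[of b] by simp


lemma dp_coef_of_nat_mult: "dp_coef (of_nat n * a) A = of_nat n * dp_coef a A"
  by (metis dp_coef_const_mult dp_const_of_nat)

lemma dp_coef_mono_mult:
  "dp_coef (dp_mono U * a) B = (if U \<subseteq># B then of_nat (mbinom U (B - U)) * dp_coef a (B - U) else 0)"
proof (induction a rule: divpow_mono_induct)
  case (add a b)
  then show ?case by (simp add: dp_coef_add distrib_left)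
next
  case (mono c A)
  have *: "dp_mono U * (dp_const c * dp_mono A) = dp_const c * (of_nat (mbinom U A) * dp_mono (U + A))"
    by (simp add: dp_mono_mult[symmetric] mult_ac)
  show ?case unfolding * dp_coef_const_mult dp_coef_of_nat_mult dp_coef_mono
    by (cases "U \<subseteq># B") (auto simp: subset_mset.add_diff_inverse)
qed

section \<open>Frobenius truncations\<close>

definition low :: "nat \<Rightarrow> nat multiset \<Rightarrow> bool" where
  "low q A \<longleftrightarrow> (\<forall>i. count A i < q)"

lemma low_subset: "low q B \<Longrightarrow> A \<subseteq># B \<Longrightarrow> low q A"
  unfolding low_def subseteq_mset_def using le_less_trans by blast

lemma low_decompose:
  assumes "q > 0"
  obtains e A' where "A = repeat_mset q e + A'" "low q A'"
proof -
  define e where "e = Abs_multiset (\<lambda>i. count A i div q)"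
  have "finite {i. 0 < count A i div q}"
    by (rule finite_subset[of _ "set_mset A"]) (auto simp: not_in_iff intro: ccontr)
  then have e: "count e i = count A i div q" for i
    unfolding e_def by (subst count_Abs_multiset) auto
  have "repeat_mset q e \<subseteq># A" by (auto simp: subseteq_mset_def e)
  then have "A = repeat_mset q e + (A - repeat_mset q e)" by simp
  moreover have "low q (A - repeat_mset q e)"
    using assms by (auto simp: low_def e minus_mult_div_eq_mod)
  ultimately show ?thesis by (rule that)
qed

lemma low_decompose_unique:
  assumes "repeat_mset q e + A = repeat_mset q e' + A'" "low q A" "low q A'"
  shows "e = e'" "A = A'"
proof -
  have "count e i = count e' i" for i
  proof -
    have "q * count e i + count A i = q * count e' i + count A' i"
      using arg_cong[OF assms(1), of "\<lambda>M. count M i"] by simp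
    moreover have "count A i < q" "count A' i < q" using assms by (auto simp: low_def)
    ultimately have "(q * count e i + count A i) div q = (q * count e' i + count A' i) div q" by simp
    then show ?thesis using \<open>count A i < q\<close> \<open>count A' i < q\<close> by simp
  qed
  then show "e = e'" by (rule multiset_eqI)
  then show "A = A'" using assms(1) by simp
qed

locale frobenius_power =
  fixes q r :: nat and ty :: "'k::field itself"
  assumes char: "CHAR('k) > 0" and q: "q = CHAR('k) ^ r"
begin

lemma q_pos: "q > 0"
  using char q by simp

text \<open>In \<open>k[X]\<close>, \<open>(1 + X)\<^bsup>qs + t\<^esup> = (1 + X\<^bsup>q\<^esup>)\<^bsup>s\<^esup> (1 + X)\<^bsup>t\<^esup>\<close>.\<close>

lemma binomial_frobenius:
  assumes "c < q"
  shows "(of_nat ((q * s + t) choose c) :: 'k) = of_nat (t choose c)"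
proof -
  have pr: "Factorial_Ring.prime CHAR('k)" using char by (rule prime_CHAR_semidom)
  have ch: "CHAR('k poly) = CHAR('k)" by simp
  let ?X = "[:0, 1 :: 'k:]"
  have bin: "coeff ((1 + ?X) ^ n) c = of_nat (n choose c)" for n
  proof (cases "c \<le> n")
    case True
    then show ?thesis
      using coeff_linear_poly_power[of c n "1 :: 'k" 1] by (simp add: one_pCons)
  next
    case False
    then have "degree ((1 + ?X) ^ n) < c"
      using degree_power_le[of "1 + ?X" n] by (simp add: one_pCons)
    with False show ?thesis by (simp add: coeff_eq_0 binomial_eq_0)
  qed
  have "(1 + ?X) ^ (q * s + t) = ((1 + ?X) ^ q) ^ s * (1 + ?X) ^ t"
    by (simp add: power_add power_mult)
  also have "(1 + ?X) ^ q = 1 + ?X ^ q"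
    using freshmans_dream'[of q r 1 ?X] pr ch q by simp
  \<comment> \<open>The geometric sum exhibits \<open>(1 + X^q)^s - 1\<close> as a multiple of
    \<open>X^q\<close>, which cannot touch the coefficient at \<open>c < q\<close>.\<close>
  also have "(1 + ?X ^ q) ^ s * (1 + ?X) ^ t = (1 + ?X) ^ t + ?X ^ q * ((\<Sum>i<s. (1 + ?X ^ q) ^ i) * (1 + ?X) ^ t)"
    using power_diff_1_eq[of "1 + ?X ^ q" s] by (simp add: algebra_simps)
  finally have "coeff ((1 + ?X) ^ (q * s + t)) c =
      coeff ((1 + ?X) ^ t + monom 1 q * ((\<Sum>i<s. (1 + ?X ^ q) ^ i) * (1 + ?X) ^ t)) c"
    by (simp add: monom_altdef)
  then show ?thesis
    using assms by (simp only: bin coeff_add coeff_monom_mult if_True add_0_right)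
qed

lemma mbinom_low_repeat:
  assumes "low q C" "C + A = A0 + repeat_mset q e"
  shows "of_nat (mbinom C A) = (of_nat (\<Prod>i\<in>set_mset (C + A). count A0 i choose count C i) :: 'k)"
  unfolding mbinom_def of_nat_prod
proof (rule prod.cong[OF refl])
  fix i
  have "count C i + count A i = q * count e i + count A0 i"
    using arg_cong[OF assms(2), of "\<lambda>M. count M i"] by simp
  then show "of_nat ((count C i + count A i) choose count C i) = (of_nat (count A0 i choose count C i) :: 'k)"
    using binomial_frobenius[of "count C i" "count e i" "count A0 i"] assms(1)
    by (simp add: low_def)
qed

text \<open>Against a monomial with exponents below \<open>q\<close>, multiples of \<open>q\<close>
  in the other factor are invisible. This is the core of the \<open>D_q\<close>-linearity of the
  projections.\<close>

lemma mbinom_repeat_add: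
  assumes "low q C"
  shows "of_nat (mbinom C (A + repeat_mset q e)) = (of_nat (mbinom C A) :: 'k)"
proof -
  have "mbinom C A = (\<Prod>i\<in>set_mset (C + (A + repeat_mset q e)). (count C i + count A i) choose count C i)"
    unfolding mbinom_def by (rule prod.mono_neutral_left) (auto simp: not_in_iff)
  then show ?thesis
    using mbinom_low_repeat[OF assms, of "A + repeat_mset q e" "C + A" e] by (simp add: add.assoc)
qed

text \<open>The upper entries of the binomials may be replaced by those of \<open>A0\<close>;
  wherever \<open>C\<close> exceeds \<open>A0\<close> the resulting binomial is 0.\<close>

lemma mbinom_eq_0:
  assumes "low q C" "C + A = A0 + repeat_mset q e" "\<not> C \<subseteq># A0"
  shows "of_nat (mbinom C A) = (0 :: 'k)"
proof -
  obtain i where i: "count A0 i < count C i"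
    using assms(3) by (auto simp: subseteq_mset_def not_le)
  then have "i \<in># C" by (metis count_eq_zero_iff less_nat_zero_code)
  then have "(\<Prod>i\<in>set_mset (C + A). count A0 i choose count C i) = 0"
    using i by (intro prod_zero bexI[of _ i]) (auto simp: binomial_eq_0)
  then show ?thesis
    unfolding mbinom_low_repeat[OF assms(1,2)] by (simp only: of_nat_0)
qed

text \<open>Let \<open>A0\<close> be the remainder of \<open>C + A\<close> modulo \<open>q\<close>.
  If it contained \<open>C\<close>, uniqueness of division applied to \<open>A\<close> would give
  \<open>A0 = C + A\<close>, which is not low. So products that overflow \<open>q\<close> vanish,
  and \<open>D_q\<close> is closed under multiplication.\<close>

lemma mbinom_not_low:
  assumes "low q C" "low q A" "\<not> low q (C + A)"
  shows "of_nat (mbinom C A) = (0 :: 'k)"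
proof -
  obtain A0 e where *: "C + A = repeat_mset q e + A0" "low q A0"
    by (rule low_decompose[OF q_pos])
  have "\<not> C \<subseteq># A0"
  proof
    assume "C \<subseteq># A0"
    then obtain B where B: "A0 = C + B" by (metis subset_mset.le_iff_add)
    then have A: "repeat_mset q e + B = repeat_mset q {#} + A"
      using *(1) by (simp add: add.assoc[symmetric] add.commute)
    have "low q B" using *(2) B low_subset by auto
    from low_decompose_unique[OF A this assms(2)] B * assms(3) show False by simp
  qed
  with mbinom_eq_0[OF assms(1), of A A0 e] * show ?thesis by (simp add: add.commute)
qed

text \<open>Behind the freeness of \<open>D\<close> over \<open>D_q\<close>: the product of
  \<open>x^[qe]\<close> and a low monomial is a monomial with coefficient exactly 1.\<close>

lemma mbinom_repeat:
  assumes "low q A"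
  shows "of_nat (mbinom (repeat_mset q e) A) = (1 :: 'k)"
  unfolding mbinom_def of_nat_prod
proof (rule prod.neutral, rule ballI)
  fix i
  have "(q * count e i + count A i) choose (q * count e i) = (q * count e i + count A i) choose count A i"
    by (rule choose_add_symmetric)
  then show "of_nat ((count (repeat_mset q e) i + count A i) choose count (repeat_mset q e) i) = (1 :: 'k)"
    using binomial_frobenius[of "count A i" "count e i" "count A i"] assms by (simp add: low_def)
qed

end

lemma mbinom_disjoint:
  assumes "set_mset A \<inter> set_mset B = {}"
  shows "mbinom A B = 1"
  unfolding mbinom_def
proof (rule prod.neutral, rule ballI)
  fix i
  have "count A i = 0 \<or> count B i = 0" using assms by (auto simp: count_eq_zero_iff)
  then show "(count A i + count B i) choose count A i = 1" by auto
qed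

lemma dp_coef_sum_mono:
  assumes "finite S"
  shows "dp_coef (\<Sum>A\<in>S. dp_const (c A) * dp_mono A) B = (if B \<in> S then c B else 0)"
  using assms by (simp add: dp_coef_sum dp_coef_const_mult dp_coef_mono if_distrib sum.If_cases cong: if_cong)

section \<open>The truncated subalgebra \<open>D_q\<close>\<close>

definition dp_low :: "nat \<Rightarrow> 'k::field divpow set" where
  "dp_low q = {a. \<forall>A. dp_coef a A \<noteq> 0 \<longrightarrow> low q A}"

lemma dp_low_add: "a \<in> dp_low q \<Longrightarrow> b \<in> dp_low q \<Longrightarrow> a + b \<in> dp_low q"
  unfolding dp_low_def by (auto simp: dp_coef_add) (metis add_0)

lemma dp_low_0: "0 \<in> dp_low q"
  by (simp add: dp_low_def)

lemma dp_low_sum: "(\<And>x. x \<in> S \<Longrightarrow> f x \<in> dp_low q) \<Longrightarrow> sum f S \<in> dp_low q"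
  by (induction S rule: infinite_finite_induct) (auto intro: dp_low_add dp_low_0)

lemma dp_low_mono: "low q A \<Longrightarrow> dp_mono A \<in> dp_low q"
  by (simp add: dp_low_def dp_coef_mono)

lemma dp_low_const_mult: "a \<in> dp_low q \<Longrightarrow> dp_const c * a \<in> dp_low q"
  by (auto simp: dp_low_def dp_coef_const_mult)

lemma dp_low_const: "q > 0 \<Longrightarrow> dp_const c \<in> dp_low q"
  using dp_low_const_mult[OF dp_low_mono[of q "{#}"], of c] by (simp add: low_def)

lemma dp_low_x: "t < q \<Longrightarrow> dp_x i t \<in> dp_low q"
  unfolding dp_mono_single[symmetric] by (rule dp_low_mono) (auto simp: low_def)

lemma dp_low_induct [consumes 1, case_names zero add mono]:
  assumes "a \<in> dp_low q" and zero: "P 0" and add: "\<And>a b. P a \<Longrightarrow> P b \<Longrightarrow> P (a + b)"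
    and mono: "\<And>c A. low q A \<Longrightarrow> P (dp_const c * dp_mono A)"
  shows "P a"
proof -
  have "P (\<Sum>A\<in>S. dp_const (dp_coef a A) * dp_mono A)" if "finite S" "S \<subseteq> {A. dp_coef a A \<noteq> 0}" for S
    using that by (induction S) (use assms(1) in \<open>auto intro!: zero add mono simp: dp_low_def\<close>)
  from this[OF finite_dp_coef order_refl] show ?thesis by (simp flip: dp_expand)
qed

context frobenius_power
begin

lemma dp_low_mult:
  assumes "a \<in> dp_low q" "b \<in> dp_low q"
  shows "a * b \<in> (dp_low q :: 'k divpow set)"
  using assms(1)
proof (induction a rule: dp_low_induct)
  case (mono c A)
  show ?case using assms(2)
  proof (induction b rule: dp_low_induct)
    case (mono d B)
    have *: "dp_const c * dp_mono A * (dp_const d * dp_mono B) =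
        dp_const (c * d * of_nat (mbinom A B)) * dp_mono (A + B)"
      using dp_mono_mult[of A B, where 'k='k]
      by (simp add: dp_const.hom_mult dp_const_of_nat mult_ac)
    show ?case
    proof (cases "low q (A + B)")
      case True
      then show ?thesis unfolding * by (intro dp_low_const_mult dp_low_mono)
    next
      case False
      then show ?thesis unfolding *
        using mbinom_not_low[of A B] mono \<open>low q A\<close> by (simp add: dp_const.hom_0 dp_low_0)
    qed
  qed (auto simp: distrib_left intro: dp_low_add dp_low_0)
qed (auto simp: distrib_right intro: dp_low_add dp_low_0)

lemma dp_low_prod: "(\<And>x. x \<in> S \<Longrightarrow> f x \<in> dp_low q) \<Longrightarrow> prod f S \<in> (dp_low q :: 'k divpow set)"
  using dp_low_const[OF q_pos, of 1]
  by (induction S rule: infinite_finite_induct) (auto intro: dp_low_mult simp: dp_const.hom_1)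

lemma dp_low_pow:
  assumes "t < q"
  shows "dp_pow v t \<in> (dp_low q :: 'k divpow set)"
  unfolding dp_pow_def
proof (intro dp_low_sum dp_low_prod dp_low_const_mult dp_low_x)
  fix a j
  assume a: "a \<in> {a. (\<forall>j. j \<notin> keys v \<longrightarrow> a j = 0) \<and> (\<Sum>j\<in>keys v. a j) = t}"
    and j: "j \<in> keys v"
  have "a j \<le> (\<Sum>j\<in>keys v. a j)" by (rule member_le_sum) (use j in auto)
  with a assms show "a j < q" by auto
qed

text \<open>A factor \<open>x_i^[t]\<close> becomes \<open>(g x_i)^[t]\<close>, whose expansion only
  has exponents up to \<open>t < q\<close>; the product of such factors stays in
  \<open>D_q\<close>.\<close>

lemma dp_low_act:
  assumes "a \<in> dp_low q"
  shows "dp_act g a \<in> (dp_low q :: 'k divpow set)"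
  using assms
proof (induction a rule: dp_low_induct)
  case zero
  show ?case using dp_act_const[of g "0 :: 'k"] by (simp add: dp_const.hom_0 dp_low_0)
next
  case (mono c A)
  have 1: "dp_act g 1 = (1 :: 'k divpow)" using dp_act_const[of g "1 :: 'k"] by (simp add: dp_const.hom_1)
  have "dp_act g (prod f S) = (\<Prod>x\<in>S. dp_act g (f x))" for f and S :: "nat set"
    by (induction S rule: infinite_finite_induct) (auto simp: dp_act_mult 1)
  then show ?case
    using mono unfolding dp_act_mult dp_act_const dp_mono_def
    by (intro dp_low_const_mult) (auto intro!: dp_low_prod dp_low_pow simp: dp_act_x low_def)
qed (auto simp: dp_act_add intro: dp_low_add)

end

section \<open>The coordinate projections from \<open>D\<close> to \<open>D_q\<close>\<close>

definition dp_proj :: "nat \<Rightarrow> nat multiset \<Rightarrow> 'k::field divpow \<Rightarrow> 'k divpow" where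
  "dp_proj q e a = (\<Sum>A | low q A \<and> dp_coef a (repeat_mset q e + A) \<noteq> 0.
      dp_const (dp_coef a (repeat_mset q e + A)) * dp_mono A)"

lemma dp_coef_proj: "dp_coef (dp_proj q e a) A = (if low q A then dp_coef a (repeat_mset q e + A) else 0)"
proof -
  have "finite ((+) (repeat_mset q e) -` {A. dp_coef a A \<noteq> 0})"
    by (rule finite_vimageI[OF finite_dp_coef]) simp
  then have "finite {A. low q A \<and> dp_coef a (repeat_mset q e + A) \<noteq> 0}"
    by (rule rev_finite_subset) auto
  then show ?thesis unfolding dp_proj_def by (subst dp_coef_sum_mono) auto
qed

lemma dp_proj_add: "dp_proj q e (a + b) = dp_proj q e a + dp_proj q e b"
  by (rule dp_coef_eqI) (simp add: dp_coef_proj dp_coef_add)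

lemma dp_proj_0 [simp]: "dp_proj q e 0 = 0"
  by (rule dp_coef_eqI) (simp add: dp_coef_proj)

lemma dp_proj_const_mult: "dp_proj q e (dp_const c * a) = dp_const c * dp_proj q e a"
  by (rule dp_coef_eqI) (simp add: dp_coef_proj dp_coef_const_mult)

lemma dp_proj_low: "dp_proj q e a \<in> dp_low q"
  by (simp add: dp_low_def dp_coef_proj)

text \<open>Coefficients at \<open>A0\<close> are compared after reduction to
  \<open>c = x^[C]\<close>. If \<open>A0 = C + A\<close>, shifting by \<open>qe\<close> does not
  change the structure constant. If \<open>C\<close> does not fit into \<open>A0\<close>, the
  constant is 0. If \<open>A\<close> is low but \<open>C + A\<close> is not, the left side is cut
  off by the projection and the right side is killed by \<open>mbinom_not_low\<close>.\<close>

lemma (in frobenius_power) dp_proj_mult: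
  assumes "c \<in> dp_low q"
  shows "dp_proj q e (c * a) = c * dp_proj q e (a :: 'k divpow)"
  using assms
proof (induction c rule: dp_low_induct)
  case (mono d C)
  have "dp_proj q e (dp_mono C * a) = dp_mono C * dp_proj q e a"
  proof (rule dp_coef_eqI)
    fix A0
    let ?E = "repeat_mset q e"
    show "dp_coef (dp_proj q e (dp_mono C * a)) A0 = dp_coef (dp_mono C * dp_proj q e a) A0"
    proof (cases "C \<subseteq># A0")
      case True
      then obtain A where A0: "A0 = C + A" by (auto simp: subset_mset.le_iff_add)
      have eq: "?E + (C + A) = C + (A + ?E)" by (simp add: add_ac)
      show ?thesis
      proof (cases "low q A")
        case True
        then show ?thesis
          using mbinom_repeat_add[OF mono, of A e] mbinom_not_low[OF mono, of A]
            low_subset[of q A0 A] eq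
          by (cases "low q (C + A)") (simp_all add: A0 dp_coef_proj dp_coef_mono_mult add.commute[of ?E A])
      next
        case False
        then have "\<not> low q A0" using low_subset[of q A0 A] A0 by auto
        with False show ?thesis by (simp add: A0 dp_coef_proj dp_coef_mono_mult)
      qed
    next
      case False
      have "of_nat (mbinom C (?E + A0 - C)) = (0 :: 'k)" if "C \<subseteq># ?E + A0"
        using that False by (intro mbinom_eq_0[OF mono, of _ A0 e]) (auto simp: add.commute)
      with False show ?thesis by (simp add: dp_coef_proj dp_coef_mono_mult)
    qed
  qed
  then show ?case by (simp add: mult.assoc dp_proj_const_mult)
qed (auto simp: distrib_right dp_proj_add)

section \<open>The action of \<open>GL\<close> in coordinates\<close>

interpretation pm: vector_space "pm_scale :: 'k::field \<Rightarrow> ('b \<Rightarrow>\<^sub>0 'k) \<Rightarrow> _"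
  by (rule vector_space_pm_scale)

lemma pm_expand: "x = (\<Sum>b\<in>keys x. pm_scale (lookup x b) (basis_elt b))"
  by (rule poly_mapping_eqI) (simp add: lookup_sum lookup_single when_def in_keys_iff if_distrib cong: if_cong)

lemma lin_extend_superset:
  assumes "finite S" "keys f \<subseteq> S"
  shows "lin_extend h f = (\<Sum>b\<in>S. pm_scale (lookup f b) (h b))"
  unfolding lin_extend_def
  by (rule sum.mono_neutral_left) (use assms in \<open>auto simp: in_keys_iff\<close>)

lemma lin_extend_add: "lin_extend h (x + y) = lin_extend h x + lin_extend h y"
proof -
  let ?S = "keys x \<union> keys y"
  have "finite ?S" by simp
  then show ?thesis
    using keys_add[of x y] by (simp add: lin_extend_superset[of ?S] lookup_add pm.scale_left_distrib sum.distrib)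
qed

lemma lin_extend_scale: "lin_extend h (pm_scale c x) = pm_scale c (lin_extend h x)"
proof -
  have "keys (pm_scale c x) \<subseteq> keys x"
    by (auto simp: in_keys_iff)
  then show ?thesis
    by (simp add: lin_extend_superset[of "keys x"] pm.scale_sum_right)
qed

lemma linear_lin_extend: "Vector_Spaces.linear pm_scale pm_scale (lin_extend h)"
  by unfold_locales (auto simp: lin_extend_add lin_extend_scale)

lemma lookup_lin_extend:
  "lookup (lin_extend h f) c =
     (\<Sum>b\<in>keys f. lookup f b * lookup (h b) c)"
  by (simp add: lin_extend_def lookup_sum)

lemma lin_extend_basis [simp]: "lin_extend h (basis_elt b) = h b"
  by (simp add: lin_extend_def)

lemma GL_compose: "g \<in> GL \<Longrightarrow> h \<in> GL \<Longrightarrow> g \<circ> h \<in> GL"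
proof -
  assume g: "g \<in> GL" and h: "h \<in> GL"
  have "{i. (g \<circ> h) (basis_elt i) \<noteq> basis_elt i} \<subseteq>
      {i. h (basis_elt i) \<noteq> basis_elt i} \<union> {i. g (basis_elt i) \<noteq> basis_elt i}" by auto
  then have "finite {i. (g \<circ> h) (basis_elt i) \<noteq> basis_elt i}"
    using g h finite_subset unfolding GL_def by blast
  then show ?thesis
    using g h unfolding GL_def by (auto intro: Vector_Spaces.linear_compose bij_comp)
qed

lemma GL_id: "id \<in> GL"
  unfolding GL_def by (auto simp: pm.linear_id)

text \<open>Support of a row of the matrix of \<open>g\<close>, finite because \<open>g\<close>
  fixes almost all basis vectors. Rows occur because the coefficient at \<open>k\<close> of an image
  depends on the entries in row \<open>k\<close>.\<close>

definition row :: "('k::field vec \<Rightarrow> 'k vec) \<Rightarrow> nat \<Rightarrow> nat set" where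
  "row g k = {j. lookup (g (basis_elt j)) k \<noteq> 0}"

lemma finite_row: "g \<in> GL \<Longrightarrow> finite (row g k)"
proof -
  assume g: "g \<in> GL"
  have "row g k \<subseteq> {j. g (basis_elt j) \<noteq> basis_elt j} \<union> {k}"
    by (auto simp: row_def lookup_single when_def split: if_splits)
  then show ?thesis using g finite_subset unfolding GL_def by blast
qed

text \<open>Entry in row \<open>ks\<close> and column \<open>js\<close> of the matrix of
  \<open>g\<close> on a tensor power. The value 0 for words of different length lets all degrees be
  treated at once.\<close>

fun mat_coef :: "('k::field vec \<Rightarrow> 'k vec) \<Rightarrow> nat list \<Rightarrow> nat list \<Rightarrow> 'k" where
  "mat_coef g [] [] = 1"
| "mat_coef g (k # ks) (j # js) = lookup (g (basis_elt j)) k * mat_coef g ks js"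
| "mat_coef g ks js = 0"

lemma mat_coef_length: "mat_coef g ks js \<noteq> 0 \<Longrightarrow> length ks = length js"
  by (induction g ks js rule: mat_coef.induct) auto

lemma mat_coef_append:
  "length ks = length hs \<Longrightarrow> mat_coef g (ks @ ls) (hs @ js) = mat_coef g ks hs * mat_coef g ls js"
  by (induction g ks hs rule: mat_coef.induct) auto

definition rows :: "('k::field vec \<Rightarrow> 'k vec) \<Rightarrow> nat list \<Rightarrow> nat list set" where
  "rows g ks = {js. mat_coef g ks js \<noteq> 0}"

lemma rows_Nil: "rows g [] = {[]}"
proof -
  have "mat_coef g [] js = 0" if "js \<noteq> []" for js
    using that by (cases js) auto
  then show ?thesis by (auto simp: rows_def)
qed

lemma rows_Cons: "rows g (k # ks) = (\<lambda>(j, js). j # js) ` (row g k \<times> rows g ks)"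
proof -
  have "js \<in> rows g (k # ks) \<longleftrightarrow> js \<in> (\<lambda>(j, js). j # js) ` (row g k \<times> rows g ks)" for js
    by (cases js) (auto simp: rows_def row_def)
  then show ?thesis by blast
qed

lemma finite_rows: "g \<in> GL \<Longrightarrow> finite (rows g ks)"
  by (induction ks) (auto simp: rows_Nil rows_Cons finite_row)

lemma sum_rows_Cons:
  "(\<Sum>js\<in>rows g (k # ks). F js) = (\<Sum>j\<in>row g k. \<Sum>js\<in>rows g ks. F (j # js))"
  by (subst sum.cartesian_product) (auto simp: rows_Cons inj_on_def sum.reindex intro!: sum.cong)

lemma sum_rows_superset:
  fixes g :: "'k::field vec \<Rightarrow> 'k vec" and F :: "nat list \<Rightarrow> 'b::comm_monoid_add"
  assumes "g \<in> GL" "finite J" "\<And>js. js \<in> rows g ks - J \<Longrightarrow> F js = 0" "\<And>js. js \<in> J - rows g ks \<Longrightarrow> F js = 0"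
  shows "(\<Sum>js\<in>rows g ks. F js) = (\<Sum>js\<in>J. F js)"
proof -
  have "(\<Sum>js\<in>rows g ks. F js) = (\<Sum>js\<in>rows g ks \<union> J. F js)"
    using assms(2,4) finite_rows[OF assms(1), of ks] by (intro sum.mono_neutral_left) auto
  also have "\<dots> = (\<Sum>js\<in>J. F js)"
    using assms(2,3) finite_rows[OF assms(1), of ks] by (intro sum.mono_neutral_right) auto
  finally show ?thesis .
qed

lemma mat_coef_id: "mat_coef id ks js = (if ks = js then 1 else 0)"
  by (induction "id :: 'k::field vec \<Rightarrow> 'k vec" ks js rule: mat_coef.induct) (auto simp: lookup_single when_def)

lemma GL_lookup:
  assumes "g \<in> GL"
  shows "lookup (g v) k = (\<Sum>m\<in>row g k. lookup (g (basis_elt m)) k * lookup v m)"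
proof -
  interpret g: Vector_Spaces.linear pm_scale pm_scale g using assms by (simp add: GL_def)
  have "g v = (\<Sum>m\<in>keys v. pm_scale (lookup v m) (g (basis_elt m)))"
    by (subst pm_expand[of v]) (simp only: g.sum g.scale)
  then have "lookup (g v) k =
      (\<Sum>m\<in>keys v. lookup (g (basis_elt m)) k * lookup v m)"
    by (simp add: lookup_sum mult.commute)
  also have "\<dots> = (\<Sum>m\<in>keys v \<union> row g k. lookup (g (basis_elt m)) k * lookup v m)"
    by (rule sum.mono_neutral_left) (auto simp: in_keys_iff finite_row[OF assms])
  also have "\<dots> = (\<Sum>m\<in>row g k. lookup (g (basis_elt m)) k * lookup v m)"
    by (rule sum.mono_neutral_right) (auto simp: row_def finite_row[OF assms, unfolded row_def])
  finally show ?thesis .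
qed

lemma mat_coef_compose:
  assumes "g \<in> GL"
  shows "mat_coef (g \<circ> h) ks js = (\<Sum>ms\<in>rows g ks. mat_coef g ks ms * mat_coef h ms js)"
proof (induction ks arbitrary: js)
  case Nil
  then show ?case by (cases js) (auto simp: rows_Nil)
next
  case (Cons k ks)
  show ?case
  proof (cases js)
    case Nil
    then show ?thesis by (simp add: sum_rows_Cons)
  next
    case (Cons j js')
    have "mat_coef (g \<circ> h) (k # ks) js =
        (\<Sum>m\<in>row g k. lookup (g (basis_elt m)) k * lookup (h (basis_elt j)) m) *
        (\<Sum>ms\<in>rows g ks. mat_coef g ks ms * mat_coef h ms js')"
      using GL_lookup[OF assms, of "h (basis_elt j)" k] by (simp add: Cons Cons.IH)
    also have "\<dots> = (\<Sum>m\<in>row g k. \<Sum>ms\<in>rows g ks.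
        (lookup (g (basis_elt m)) k * lookup (h (basis_elt j)) m) *
        (mat_coef g ks ms * mat_coef h ms js'))"
      by (rule sum_product)
    finally show ?thesis by (simp only: Cons sum_rows_Cons mat_coef.simps mult_ac)
  qed
qed

section \<open>Monomial matrices: permutations and diagonal elements\<close>

definition mono_map :: "(nat \<Rightarrow> nat) \<Rightarrow> (nat \<Rightarrow> 'k::field) \<Rightarrow> 'k vec \<Rightarrow> 'k vec" where
  "mono_map p c = lin_extend (\<lambda>i. pm_scale (c i) (basis_elt (p i)))"

lemma mono_map_basis [simp]: "mono_map p c (basis_elt i) = pm_scale (c i) (basis_elt (p i))"
  by (simp add: mono_map_def)

lemma mono_map_GL:
  fixes c :: "nat \<Rightarrow> 'k::field"
  assumes p: "bij p" and c: "\<And>i. c i \<noteq> 0" and fin: "finite {i. p i \<noteq> i}" "finite {i. c i \<noteq> 1}"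
  shows "mono_map p c \<in> GL"
proof -
  have lin: "Vector_Spaces.linear pm_scale pm_scale (mono_map p c)" for p and c :: "nat \<Rightarrow> 'k::field"
    unfolding mono_map_def by (rule linear_lin_extend)
  have inv: "mono_map p' c' (mono_map p c v) = v"
    if "\<And>i. p' (p i) = i" "\<And>i. c i * c' (p i) = 1" for p' p and c' c :: "nat \<Rightarrow> 'k" and v
  proof -
    interpret l: Vector_Spaces.linear pm_scale pm_scale "mono_map p c" by (rule lin)
    interpret l': Vector_Spaces.linear pm_scale pm_scale "mono_map p' c'" by (rule lin)
    have "mono_map p' c' (mono_map p c (basis_elt i)) = basis_elt i" for i
      using that by (simp add: l'.scale)
    then have "mono_map p' c' (mono_map p c (\<Sum>b\<in>keys v. pm_scale (lookup v b) (basis_elt b))) =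
        (\<Sum>b\<in>keys v. pm_scale (lookup v b) (basis_elt b))"
      by (simp only: l.sum l.scale l'.sum l'.scale)
    then show ?thesis by (simp flip: pm_expand)
  qed
  have "bij (mono_map p c)"
  proof (rule o_bij)
    let ?c' = "\<lambda>i. inverse (c (inv_into UNIV p i))"
    show "mono_map (inv_into UNIV p) ?c' \<circ> mono_map p c = id"
      by (rule ext) (use p c in \<open>simp add: inv bij_is_inj\<close>)
    show "mono_map p c \<circ> mono_map (inv_into UNIV p) ?c' = id"
      by (rule ext) (use p c in \<open>simp add: inv bij_is_surj surj_f_inv_f\<close>)
  qed
  moreover have "finite {i. mono_map p c (basis_elt i) \<noteq> basis_elt i}"
    by (rule finite_subset[OF _ finite_UnI[OF fin]]) auto
  ultimately show ?thesis using lin by (auto simp: GL_def)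
qed

lemma mat_coef_mono_map:
  "mat_coef (mono_map p c) ls js = (if ls = map p js then prod_list (map c js) else 0)"
  by (induction "mono_map p c" ls js rule: mat_coef.induct) (auto simp: lookup_single when_def)

lemma sum_rows_mono_map:
  assumes g: "mono_map p c \<in> GL" and F: "\<And>ms. ls = map p ms \<Longrightarrow> ms = js"
    and 0: "\<And>ms. mat_coef (mono_map p c) ls ms = 0 \<Longrightarrow> G ms = 0"
  shows "(\<Sum>ms\<in>rows (mono_map p c) ls. G ms) = G js"
proof -
  have "(\<Sum>ms\<in>rows (mono_map p c) ls. G ms) = (\<Sum>ms\<in>{js}. G ms)"
  proof (rule sum_rows_superset[OF g])
    fix ms assume "ms \<in> rows (mono_map p c) ls - {js}"
    then have "ls = map p ms" "ms \<noteq> js" by (auto simp: rows_def mat_coef_mono_map split: if_splits)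
    with F show "G ms = 0" by blast
  next
    fix ms assume "ms \<in> {js} - rows (mono_map p c) ls"
    then show "G ms = 0" by (intro 0) (auto simp: rows_def)
  qed simp
  then show ?thesis by simp
qed

section \<open>Equivariance of coefficients\<close>

text \<open>Adding the variables of \<open>v\<close> one at a time turns \<open>v^[t]\<close> into a
  convolution by \<open>sum_exponents_insert\<close>, and only the factor belonging to
  \<open>j\<close> is differentiated.\<close>

lemma dp_der_pow:
  "dp_der j (dp_pow v t) = (if t = 0 then 0 else dp_const (lookup v j) * dp_pow v (t - 1))"
  for v :: "'k::field vec"
proof -
  define e where "e = (\<lambda>j n. dp_const (lookup v j ^ n) * dp_x j n)"
  define E where "E = (\<lambda>S t. \<Sum>a | (\<forall>j. j \<notin> S \<longrightarrow> a j = 0) \<and> sum a S = t. \<Prod>j\<in>S. e j (a j))"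
  have e: "dp_der j (e i n) = (if i = j \<and> n > 0 then dp_const (lookup v j) * e i (n - 1) else 0)" for i n
    by (cases n) (auto simp: e_def dp_der_mult dp_der_x dp_const.hom_mult)
  have "dp_der j (E S t) = (if t = 0 \<or> j \<notin> S then 0 else dp_const (lookup v j) * E S (t - 1))"
    if "finite S" for S t
    using that
  proof (induction S arbitrary: t rule: finite_induct)
    case empty
    have "{a :: nat \<Rightarrow> nat. (\<forall>j. j \<notin> {} \<longrightarrow> a j = 0) \<and> sum a {} = t} = (if t = 0 then {\<lambda>_. 0} else {})" for t
      by auto
    then have "E {} t = (if t = 0 then 1 else 0)" for t
      by (simp only: E_def) simp
    then show ?case by simp
  next
    case (insert i S)
    let ?c = "dp_const (lookup v j)"
    have E: "E (insert i S) t = (\<Sum>n\<le>t. e i n * E S (t - n))" for t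
      unfolding E_def by (rule sum_exponents_insert[OF insert.hyps])
    have D: "dp_der j (E (insert i S) t) = (\<Sum>n\<le>t. e i n * dp_der j (E S (t - n)) + dp_der j (e i n) * E S (t - n))"
      unfolding E by (simp add: dp_der_sum dp_der_mult)
    show ?case
    proof (cases t)
      case 0
      have "dp_der j (E S 0) = 0" using insert.IH[of 0] by simp
      with D show ?thesis by (simp add: e 0)
    next
      case (Suc t')
      show ?thesis
      proof (cases "i = j")
        case True
        then have "dp_der j (E S n) = 0" for n using insert by simp
        then have "dp_der j (E (insert i S) t) = (\<Sum>n\<le>Suc t'. dp_der j (e i n) * E S (t - n))"
          unfolding D by (simp add: Suc)
        also have "\<dots> = (\<Sum>n\<le>t'. dp_der j (e i (Suc n)) * E S (t - Suc n))"
          by (subst sum.atMost_Suc_shift) (simp add: e)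
        also have "\<dots> = ?c * E (insert i S) t'"
          unfolding E using True by (simp add: e Suc sum_distrib_left mult_ac)
        finally show ?thesis using True Suc by simp
      next
        case False
        then have "dp_der j (E (insert i S) t) = (\<Sum>n\<le>Suc t'. e i n * dp_der j (E S (Suc t' - n)))"
          unfolding D by (simp add: e Suc)
        also have "\<dots> = (\<Sum>n\<le>t'. e i n * dp_der j (E S (Suc t' - n)))"
          using insert.IH[of 0] by simp
        also have "\<dots> = (if j \<in> S then ?c * E (insert i S) t' else 0)"
          unfolding E using insert.IH by (auto simp: sum_distrib_left mult_ac Suc_diff_le intro!: sum.cong)
        finally show ?thesis using False Suc by simp
      qed
    qed
  qed
  note E = this[OF finite_keys, of v t]
  have "dp_pow v t = E (keys v) t" for t
    by (simp only: E_def e_def dp_pow_def)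
  with E show ?thesis by (simp add: in_keys_iff dp_const.hom_0)
qed

lemma dp_act_0 [simp]: "dp_act g 0 = 0"
  using dp_act_const[of g 0] by (simp add: dp_const.hom_0)


text \<open>The chain rule for the substitution \<open>g\<close>. Both sides obey the product rule
  along \<open>g\<close>, so only generators have to be checked, and there it is
  \<open>dp_der_pow\<close>.\<close>

lemma dp_der_act:
  assumes "g \<in> GL"
  shows "dp_der k (dp_act g a) =
      (\<Sum>j\<in>row g k. dp_const (lookup (g (basis_elt j)) k) * dp_act g (dp_der j a))"
proof (induction a rule: divpow_induct)
  case (const c)
  then show ?case by (simp add: dp_act_const)
next
  case (add a b)
  then show ?case by (simp add: dp_act_add dp_der_add distrib_left sum.distrib)
next
  case (mult i t a)
  have "(\<Sum>j\<in>row g k. dp_const (lookup (g (basis_elt j)) k) * dp_act g (dp_der j (dp_x i t))) =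
      (\<Sum>j\<in>row g k. if j = i then (if t > 0 then dp_const (lookup (g (basis_elt j)) k) * dp_pow (g (basis_elt i)) (t - 1) else 0) else 0)"
    by (rule sum.cong) (auto simp: dp_der_x dp_act_x)
  also have "\<dots> = (if t > 0 then dp_const (lookup (g (basis_elt i)) k) * dp_pow (g (basis_elt i)) (t - 1) else 0)"
    using finite_row[OF assms, of k] by (auto simp: row_def dp_const.hom_0)
  finally have x: "(\<Sum>j\<in>row g k. dp_const (lookup (g (basis_elt j)) k) * dp_act g (dp_der j (dp_x i t))) =
      dp_der k (dp_act g (dp_x i t))"
    by (simp add: dp_act_x dp_der_pow)
  show ?case
    unfolding dp_act_mult dp_der_mult mult dp_act_add x[symmetric]
    by (simp add: distrib_left sum.distrib sum_distrib_left sum_distrib_right mult_ac)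
qed

lemma dp_word_coef_sum: "dp_word_coef ks (sum f S) = (\<Sum>x\<in>S. dp_word_coef ks (f x))"
  by (induction S rule: infinite_finite_induct) (auto simp: dp_word_coef_add dp_word_coef_0)

lemma dp_aug_act: "dp_aug (dp_act g a) = dp_aug a"
proof (induction a rule: divpow_induct)
  case (mult i t a)
  have "dp_aug (dp_pow v t) = (if t = 0 then 1 else 0)" for v :: "'a vec"
  proof (cases "t = 0")
    case True
    then show ?thesis using dp_aug_const[of "1 :: 'a"] by (simp add: dp_pow_0 dp_const.hom_1)
  next
    case False
    have prod: "dp_aug (prod f S) = (\<Prod>x\<in>S. dp_aug (f x))" for f :: "nat \<Rightarrow> 'a divpow" and S
      using dp_aug_const[of "1 :: 'a"]
      by (induction S rule: infinite_finite_induct) (auto simp: dp_aug_mult dp_const.hom_1)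
    have sum: "dp_aug (sum f S) = (\<Sum>x\<in>S. dp_aug (f x))" for f :: "(nat \<Rightarrow> nat) \<Rightarrow> 'a divpow" and S
      using dp_aug_const[of "0 :: 'a"]
      by (induction S rule: infinite_finite_induct) (auto simp: dp_aug_add dp_const.hom_0)
    have "dp_aug (dp_pow v t) = 0"
      unfolding dp_pow_def sum prod
    proof (rule sum.neutral, rule ballI)
      fix a
      assume "a \<in> {a. (\<forall>j. j \<notin> keys v \<longrightarrow> a j = 0) \<and> (\<Sum>j\<in>keys v. a j) = t}"
      with False obtain j where "j \<in> keys v" "a j \<noteq> 0" by (metis (mono_tags, lifting) mem_Collect_eq sum.neutral)
      then show "(\<Prod>x\<in>keys v. dp_aug (dp_const (lookup v x ^ a x) * dp_x x (a x))) = 0"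
        by (auto intro!: prod_zero bexI[of _ j] simp: dp_aug_mult dp_aug_x)
    qed
    with False show ?thesis by simp
  qed
  with mult show ?case by (simp add: dp_act_mult dp_act_x dp_aug_mult dp_aug_x)
qed (auto simp: dp_act_const dp_act_add dp_aug_add)

text \<open>Iterating the chain rule along a word shows that the family of coefficients of
  \<open>a\<close> at \<open>mset js\<close> transforms like a tensor indexed by \<open>js\<close>.
  This identification with symmetric tensors is what makes \<open>delta\<close> equivariant.\<close>

lemma dp_coef_act:
  assumes "g \<in> GL"
  shows "dp_coef (dp_act g a) (mset ks) = (\<Sum>js\<in>rows g ks. mat_coef g ks js * dp_coef a (mset js))"
proof -
  have "dp_word_coef ks (dp_act g a) = (\<Sum>js\<in>rows g ks. mat_coef g ks js * dp_word_coef js a)"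
  proof (induction ks arbitrary: a)
    case Nil
    then show ?case by (simp add: rows_Nil dp_aug_act)
  next
    case (Cons k ks)
    then show ?case
      by (simp add: dp_der_act[OF assms] dp_word_coef_sum dp_word_coef_const_mult sum_rows_Cons
          sum_distrib_left mult.assoc)
  qed
  then show ?thesis by (simp add: dp_word_coef_eq)
qed

section \<open>Free modules on tensor powers\<close>

text \<open>The action in \<open>tensor_powers I d\<close> does not depend on \<open>I\<close> and
  \<open>d\<close>; naming it separately gives one calculus for all sums of tensor powers.\<close>

definition tact :: "('k::field vec \<Rightarrow> 'k vec) \<Rightarrow> (('i \<times> nat list) \<Rightarrow>\<^sub>0 'k) \<Rightarrow> (('i \<times> nat list) \<Rightarrow>\<^sub>0 'k)" where
  "tact g = lin_extend (\<lambda>(i, js).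
        lin_extend (\<lambda>ls. basis_elt (i, ls)) (tensor_vecs (map (\<lambda>j. g (basis_elt j)) js)))"

lemma gl_act_tensor_powers: "gl_act (tensor_powers I d) g = tact g"
  by (simp add: tensor_powers_def tact_def)

lemma lookup_tensor_vecs:
  "lookup (tensor_vecs (map (\<lambda>j. g (basis_elt j)) js)) ks = mat_coef g ks js"
proof (induction js arbitrary: ks)
  case Nil
  then show ?case by (cases ks) (auto simp: lookup_single when_def)
next
  case (Cons j js)
  let ?t = "tensor_vecs (map (\<lambda>j. g (basis_elt j)) js)"
  have 1: "lookup (lin_extend (\<lambda>js. basis_elt (i # js)) ?t) ks =
      (case ks of [] \<Rightarrow> 0 | k # ks' \<Rightarrow> if i = k then lookup ?t ks' else 0)" for i ks
    by (cases ks) (auto simp: lookup_lin_extend lookup_single when_def in_keys_iff if_distrib cong: if_cong)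
  show ?case
    by (cases ks) (auto simp: lookup_lin_extend[of _ "g (basis_elt j)"] 1 Cons.IH in_keys_iff if_distrib cong: if_cong)
qed

lemma lookup_tact_basis:
  "lookup (tact g (basis_elt (i, js))) (i', ls) = (if i = i' then mat_coef g ls js else 0)"
  by (auto simp: tact_def lookup_lin_extend lookup_single when_def lookup_tensor_vecs in_keys_iff
      if_distrib cong: if_cong)

lemma lookup_tact:
  assumes "g \<in> GL"
  shows "lookup (tact g y) (i, ls) = (\<Sum>js\<in>rows g ls. mat_coef g ls js * lookup y (i, js))"
proof -
  let ?K = "{js. (i, js) \<in> keys y}"
  have fin: "finite ?K"
    by (rule finite_subset[of _ "snd ` keys y"]) force+
  have "lookup (tact g y) (i, ls) =
      (\<Sum>b\<in>keys y. lookup y b * lookup (tact g (basis_elt b)) (i, ls))"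
    unfolding tact_def by (subst lookup_lin_extend) simp
  also have "\<dots> = (\<Sum>b\<in>Pair i ` ?K. lookup y b * lookup (tact g (basis_elt b)) (i, ls))"
    by (rule sum.mono_neutral_right) (auto simp: lookup_tact_basis split: if_splits)
  also have "\<dots> = (\<Sum>js\<in>?K. mat_coef g ls js * lookup y (i, js))"
    by (subst sum.reindex) (auto simp: inj_on_def lookup_tact_basis mult.commute)
  also have "\<dots> = (\<Sum>js\<in>rows g ls. mat_coef g ls js * lookup y (i, js))"
    by (rule sum_rows_superset[OF assms fin, symmetric]) (auto simp: in_keys_iff rows_def)
  finally show ?thesis .
qed

lemma poly_mapping_pair_eqI:
  "(\<And>i ls. lookup x (i, ls) = lookup y (i, ls)) \<Longrightarrow> x = y"
  by (rule poly_mapping_eqI) force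

lemma tact_add: "tact g (x + y) = tact g x + tact g y"
  unfolding tact_def by (rule lin_extend_add)

lemma tact_scale: "tact g (pm_scale c x) = pm_scale c (tact g x)"
  unfolding tact_def by (rule lin_extend_scale)

lemma tact_0 [simp]: "tact g 0 = 0"
  using tact_scale[of g 0 0] by simp

lemma tact_id: "tact id x = x"
proof (rule poly_mapping_pair_eqI)
  fix i ls
  have "(\<Sum>js\<in>rows id ls. mat_coef id ls js * lookup x (i, js)) =
      (\<Sum>js\<in>{ls}. mat_coef id ls js * lookup x (i, js))"
    by (rule sum_rows_superset[OF GL_id]) (auto simp: mat_coef_id rows_def split: if_splits)
  then show "lookup (tact id x) (i, ls) = lookup x (i, ls)"
    by (simp add: lookup_tact[OF GL_id] mat_coef_id)
qed

lemma tact_compose: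
  assumes g: "g \<in> GL" and h: "h \<in> GL"
  shows "tact (g \<circ> h) x = tact g (tact h x)"
proof (rule poly_mapping_pair_eqI)
  fix i ls
  \<comment> \<open>One finite index set large enough for the row of the composite and for all inner
    rows, so that the sums can be interchanged.\<close>
  let ?J = "rows (g \<circ> h) ls \<union> (\<Union>ms\<in>rows g ls. rows h ms)"
  have fin: "finite ?J" using g h by (simp add: finite_rows GL_compose)
  have "lookup (tact (g \<circ> h) x) (i, ls) =
      (\<Sum>js\<in>?J. mat_coef (g \<circ> h) ls js * lookup x (i, js))"
    unfolding lookup_tact[OF GL_compose[OF g h]]
    by (rule sum_rows_superset[OF GL_compose[OF g h] fin]) (auto simp: rows_def)
  also have "\<dots> = (\<Sum>ms\<in>rows g ls. \<Sum>js\<in>?J. mat_coef g ls ms * (mat_coef h ms js * lookup x (i, js)))"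
    unfolding mat_coef_compose[OF g] sum_distrib_right mult.assoc by (rule sum.swap)
  also have "\<dots> = (\<Sum>ms\<in>rows g ls. mat_coef g ls ms * (\<Sum>js\<in>rows h ms. mat_coef h ms js * lookup x (i, js)))"
  proof (rule sum.cong[OF refl])
    fix ms assume "ms \<in> rows g ls"
    then have "(\<Sum>js\<in>rows h ms. mat_coef h ms js * lookup x (i, js)) =
        (\<Sum>js\<in>?J. mat_coef h ms js * lookup x (i, js))"
      by (intro sum_rows_superset[OF h fin]) (auto simp: rows_def)
    then show "(\<Sum>js\<in>?J. mat_coef g ls ms * (mat_coef h ms js * lookup x (i, js))) =
        mat_coef g ls ms * (\<Sum>js\<in>rows h ms. mat_coef h ms js * lookup x (i, js))"
      by (simp add: sum_distrib_left)
  qed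
  also have "\<dots> = lookup (tact g (tact h x)) (i, ls)"
    by (simp add: lookup_tact g h)
  finally show "lookup (tact (g \<circ> h) x) (i, ls) = lookup (tact g (tact h x)) (i, ls)" .
qed

section \<open>The free module \<open>D \<otimes> T\<close> on a sum \<open>T\<close> of tensor
  powers\<close>

definition iota :: "('b \<Rightarrow>\<^sub>0 'k) \<Rightarrow> ('b \<Rightarrow>\<^sub>0 'k::field divpow)" where
  "iota = Poly_Mapping.map dp_const"

definition fscale :: "'k::field divpow \<Rightarrow> ('b \<Rightarrow>\<^sub>0 'k divpow) \<Rightarrow> ('b \<Rightarrow>\<^sub>0 'k divpow)" where
  "fscale a = Poly_Mapping.map ((*) a)"

text \<open>The coefficient in \<open>T\<close> of the monomial \<open>x^[A]\<close>, for the
  decomposition of \<open>D \<otimes> T\<close> into the pieces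
  \<open>x^[A] \<otimes> T\<close>.\<close>

definition slice :: "nat multiset \<Rightarrow> ('b \<Rightarrow>\<^sub>0 'k::field divpow) \<Rightarrow> ('b \<Rightarrow>\<^sub>0 'k)" where
  "slice A = Poly_Mapping.map (\<lambda>a. dp_coef a A)"

definition fproj :: "nat \<Rightarrow> nat multiset \<Rightarrow> ('b \<Rightarrow>\<^sub>0 'k::field divpow) \<Rightarrow> ('b \<Rightarrow>\<^sub>0 'k divpow)" where
  "fproj q e = Poly_Mapping.map (dp_proj q e)"

lemma lookup_map: "f 0 = 0 \<Longrightarrow> lookup (Poly_Mapping.map f y) b = f (lookup y b)"
  by (simp add: Poly_Mapping.map.rep_eq when_def)

lemma lookup_iota [simp]: "lookup (iota x) b = dp_const (lookup x b)"
  by (simp add: iota_def lookup_map dp_const.hom_0)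

lemma lookup_fscale [simp]: "lookup (fscale a y) b = a * lookup y b"
  by (simp add: fscale_def lookup_map)

lemma lookup_slice [simp]: "lookup (slice A y) b = dp_coef (lookup y b) A"
  by (simp add: slice_def lookup_map)

lemma lookup_fproj [simp]: "lookup (fproj q e y) b = dp_proj q e (lookup y b)"
  by (simp add: fproj_def lookup_map)

interpretation F: Modules.module "fscale :: 'k::field divpow \<Rightarrow> ('b \<Rightarrow>\<^sub>0 'k divpow) \<Rightarrow> _"
  by unfold_locales (auto intro!: poly_mapping_eqI simp: lookup_add algebra_simps)

lemma iota_add: "iota (x + y) = iota x + iota y"
  by (rule poly_mapping_eqI) (simp add: lookup_add dp_const.hom_add)

lemma iota_scale: "iota (pm_scale c x) = fscale (dp_const c) (iota x)"
  by (rule poly_mapping_eqI) (simp add: dp_const.hom_mult)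

lemma iota_0 [simp]: "iota 0 = 0"
  by (rule poly_mapping_eqI) (simp add: dp_const.hom_0)

lemma iota_diff: "iota (x - y) = iota x - iota y"
  using iota_add[of "x - y" y] by simp

lemma iota_sum: "iota (sum f S) = (\<Sum>x\<in>S. iota (f x))"
  by (induction S rule: infinite_finite_induct) (auto simp: iota_add)

lemma slice_add: "slice A (x + y) = slice A x + slice A y"
  by (rule poly_mapping_eqI) (simp add: lookup_add dp_coef_add)

lemma slice_0 [simp]: "slice A 0 = 0"
  by (rule poly_mapping_eqI) simp


lemma slice_fscale_iota: "slice A (fscale a (iota x)) = pm_scale (dp_coef a A) x"
  by (rule poly_mapping_eqI) (simp add: mult.commute[of a] dp_coef_const_mult)

lemma fproj_add: "fproj q e (x + y) = fproj q e x + fproj q e y"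
  by (rule poly_mapping_eqI) (simp add: lookup_add dp_proj_add)

lemma fproj_0 [simp]: "fproj q e 0 = 0"
  by (rule poly_mapping_eqI) simp

text \<open>The diagonal action, pinned down by \<open>gact_fscale\<close> (semilinear along
  \<open>dp_act\<close>) and \<open>gact_iota\<close> (equal to \<open>tact\<close> on constant
  vectors).\<close>

definition gact :: "('k::field vec \<Rightarrow> 'k vec) \<Rightarrow> (('i \<times> nat list) \<Rightarrow>\<^sub>0 'k divpow) \<Rightarrow> (('i \<times> nat list) \<Rightarrow>\<^sub>0 'k divpow)" where
  "gact g y = (\<Sum>b\<in>keys y. fscale (dp_act g (lookup y b)) (iota (tact g (basis_elt b))))"

lemma gact_superset:
  assumes "finite S" "keys y \<subseteq> S"
  shows "gact g y = (\<Sum>b\<in>S. fscale (dp_act g (lookup y b)) (iota (tact g (basis_elt b))))"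
  unfolding gact_def by (rule sum.mono_neutral_left) (use assms in \<open>auto simp: in_keys_iff\<close>)

lemma gact_add: "gact g (x + y) = gact g x + gact g y"
proof -
  let ?S = "keys x \<union> keys y"
  have "finite ?S" by simp
  then show ?thesis
    using keys_add[of x y]
    by (simp add: gact_superset[of ?S] lookup_add dp_act_add F.scale_left_distrib sum.distrib)
qed

lemma gact_fscale: "gact g (fscale a x) = fscale (dp_act g a) (gact g x)"
proof -
  have "keys (fscale a x) \<subseteq> keys x" by (auto simp: in_keys_iff)
  then show ?thesis
    by (simp add: gact_superset[of "keys x"] dp_act_mult F.scale_sum_right)
qed

lemma gact_0 [simp]: "gact g 0 = 0"
  by (simp add: gact_def)


lemma gact_iota: "gact g (iota x) = iota (tact g x)"
proof -
  have "keys (iota x) \<subseteq> keys x"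
    by (auto simp: in_keys_iff dp_const.hom_0)
  then have "gact g (iota x) = (\<Sum>b\<in>keys x. iota (pm_scale (lookup x b) (tact g (basis_elt b))))"
    by (simp add: gact_superset[of "keys x"] dp_act_const iota_scale)
  also have "\<dots> = iota (tact g x)"
    unfolding iota_sum[symmetric] by (simp add: tact_def lin_extend_def[of _ x])
  finally show ?thesis .
qed

lemma lookup_gact:
  assumes "g \<in> GL"
  shows "lookup (gact g y) (i, ls) =
    (\<Sum>js\<in>rows g ls. dp_const (mat_coef g ls js) * dp_act g (lookup y (i, js)))"
proof -
  let ?K = "{js. (i, js) \<in> keys y}"
  have fin: "finite ?K"
    by (rule finite_subset[of _ "snd ` keys y"]) force+
  have "lookup (gact g y) (i, ls) =
      (\<Sum>b\<in>keys y. dp_act g (lookup y b) * dp_const (lookup (tact g (basis_elt b)) (i, ls)))"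
    unfolding gact_def by (simp add: lookup_sum)
  also have "\<dots> = (\<Sum>b\<in>Pair i ` ?K. dp_act g (lookup y b) * dp_const (lookup (tact g (basis_elt b)) (i, ls)))"
    by (rule sum.mono_neutral_right) (auto simp: lookup_tact_basis dp_const.hom_0 split: if_splits)
  also have "\<dots> = (\<Sum>js\<in>?K. dp_const (mat_coef g ls js) * dp_act g (lookup y (i, js)))"
    by (subst sum.reindex) (auto simp: inj_on_def lookup_tact_basis mult.commute)
  also have "\<dots> = (\<Sum>js\<in>rows g ls. dp_const (mat_coef g ls js) * dp_act g (lookup y (i, js)))"
    by (rule sum_rows_superset[OF assms fin, symmetric]) (auto simp: in_keys_iff rows_def dp_const.hom_0)
  finally show ?thesis .
qed

lemma slice_expand:
  "\<exists>\<A>. finite \<A> \<and> (\<forall>A. A \<notin> \<A> \<longrightarrow> slice A y = 0) \<and>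
      y = (\<Sum>A\<in>\<A>. fscale (dp_mono A) (iota (slice A y)))"
proof -
  let ?A = "\<Union>b\<in>keys y. {A. dp_coef (lookup y b) A \<noteq> 0}"
  have fin: "finite ?A" by (simp add: finite_dp_coef)
  have sub: "{A. dp_coef (lookup y b) A \<noteq> 0} \<subseteq> ?A" for b
    by (cases "b \<in> keys y") (auto simp: in_keys_iff)
  have "slice A y = 0" if "A \<notin> ?A" for A
    by (rule poly_mapping_eqI) (use that sub in auto)
  moreover have "y = (\<Sum>A\<in>?A. fscale (dp_mono A) (iota (slice A y)))"
    by (rule poly_mapping_eqI)
       (simp add: lookup_sum mult.commute[of "dp_mono _"] dp_expand_superset[OF fin sub, symmetric])
  ultimately show ?thesis using fin by blast
qed


text \<open>Because \<open>D\<close> is free over \<open>k\<close> on the monomials,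
  \<open>D \<otimes> S\<close> is cut out of \<open>D \<otimes> T\<close> slice by slice. No basis
  of \<open>S\<close> has to be chosen.\<close>

lemma slice_span:
  assumes "pm.subspace S"
  shows "y \<in> F.span (iota ` S) \<longleftrightarrow> (\<forall>A. slice A y \<in> S)"
proof
  assume "y \<in> F.span (iota ` S)"
  then show "\<forall>A. slice A y \<in> S"
  proof (induction rule: F.span_induct_alt)
    case base
    then show ?case using assms by (simp add: pm.subspace_0)
  next
    case (step a x y)
    then show ?case
      using assms by (auto simp: slice_add slice_fscale_iota intro!: pm.subspace_add pm.subspace_scale)
  qed
next
  assume *: "\<forall>A. slice A y \<in> S"
  obtain \<A> where "y = (\<Sum>A\<in>\<A>. fscale (dp_mono A) (iota (slice A y)))"
    using slice_expand[of y] by blast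
  moreover have "(\<Sum>A\<in>\<A>. fscale (dp_mono A) (iota (slice A y))) \<in> F.span (iota ` S)"
    by (intro F.span_sum F.span_scale F.span_base) (use * in auto)
  ultimately show "y \<in> F.span (iota ` S)" by simp
qed

section \<open>Vectors with coefficients in \<open>D_q\<close>\<close>

definition flow :: "nat \<Rightarrow> ('b \<Rightarrow>\<^sub>0 'k::field divpow) set" where
  "flow q = {y. \<forall>b. lookup y b \<in> dp_low q}"

lemma flow_0: "0 \<in> flow q"
  by (simp add: flow_def dp_low_0)

lemma flow_add: "x \<in> flow q \<Longrightarrow> y \<in> flow q \<Longrightarrow> x + y \<in> flow q"
  by (auto simp: flow_def lookup_add intro: dp_low_add)

lemma flow_const_scale: "x \<in> flow q \<Longrightarrow> fscale (dp_const c) x \<in> flow q"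
  by (auto simp: flow_def intro: dp_low_const_mult)

lemma flow_iota: "q > 0 \<Longrightarrow> iota x \<in> flow q"
  by (auto simp: flow_def intro: dp_low_const)

lemma flow_fproj: "fproj q e y \<in> flow q"
  by (simp add: flow_def dp_proj_low)

context frobenius_power
begin

lemma flow_gact:
  assumes "g \<in> GL" "(y :: ('i \<times> nat list) \<Rightarrow>\<^sub>0 'k divpow) \<in> flow q"
  shows "gact g y \<in> flow q"
  using assms unfolding flow_def
  by (auto simp: lookup_gact intro!: dp_low_sum dp_low_const_mult dp_low_act)

text \<open>Here the vector supplies the factors from \<open>D_q\<close> and the scalar is
  arbitrary, so \<open>D_q\<close>-linearity moves the projection onto the scalar.\<close>

lemma fproj_fscale:
  assumes "(y :: 'b \<Rightarrow>\<^sub>0 'k divpow) \<in> flow q"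
  shows "fproj q e (fscale a y) = fscale (dp_proj q e a) y"
proof (rule poly_mapping_eqI)
  fix b
  have "dp_proj q e (lookup y b * a) = lookup y b * dp_proj q e a"
    by (rule dp_proj_mult) (use assms in \<open>simp add: flow_def\<close>)
  then show "lookup (fproj q e (fscale a y)) b = lookup (fscale (dp_proj q e a) y) b"
    by (simp add: mult.commute)
qed

lemma fproj_span:
  fixes G :: "('b \<Rightarrow>\<^sub>0 'k divpow) set"
  assumes "G \<subseteq> flow q" "y \<in> F.span G"
  shows "fproj q e y \<in> F.span G"
  using assms(2)
proof (induction rule: F.span_induct_alt)
  case base
  then show ?case by (simp add: F.span_zero)
next
  case (step a x y)
  then have "x \<in> flow q" using assms(1) by blast
  with step show ?case
    by (simp add: fproj_add fproj_fscale F.span_add F.span_scale F.span_base)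
qed

end

text \<open>The exponents occurring in finitely many vectors are bounded by some \<open>r0\<close>,
  and \<open>r < p^r\<close>, so the bound itself can serve as the exponent of
  \<open>p\<close>.\<close>

lemma flow_exists:
  assumes "finite K" "1 < CHAR('k::field)"
  shows "\<exists>r0. \<forall>r. r0 \<le> r \<longrightarrow> K \<subseteq> (flow (CHAR('k) ^ r) :: ('b \<Rightarrow>\<^sub>0 'k divpow) set)"
proof -
  let ?C = "insert 0 (\<Union>y\<in>K. \<Union>b\<in>keys y. size ` {A. dp_coef (lookup y b) A \<noteq> 0})"
  have fin: "finite ?C" using assms(1) by (simp add: finite_dp_coef)
  define r0 where "r0 = Suc (Max ?C)"
  have "K \<subseteq> flow (CHAR('k) ^ r)" if r: "r \<ge> r0" for r
  proof
    fix y :: "'b \<Rightarrow>\<^sub>0 'k divpow" assume y: "y \<in> K"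
    have "count A i < CHAR('k) ^ r" if "dp_coef (lookup y b) A \<noteq> 0" for b A i
    proof -
      have "b \<in> keys y" using that by (auto simp: in_keys_iff)
      then have "size A \<in> ?C" using y that by blast
      then have "size A \<le> Max ?C" using fin by (rule Max_ge[rotated])
      then have "count A i < r0" using count_le_size[of A i] by (simp add: r0_def)
      also have "r0 \<le> r" by (rule r)
      also have "r < CHAR('k) ^ r" by (rule power_gt_expt) (use assms(2) in simp)
      finally show ?thesis .
    qed
    then show "y \<in> flow (CHAR('k) ^ r)" by (auto simp: flow_def dp_low_def low_def)
  qed
  then show ?thesis by blast
qed

section \<open>Embedding divided powers into tensor powers\<close>

text \<open>The map \<open>x\<^sub>i\<^bsup>[t]\<^esup> \<mapsto> x\<^sub>i \<otimes> \<dots> \<otimes> x\<^sub>i\<close>, multiplicative for the shuffle product. Degree \<open>e\<close> elements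
  with coefficients in the summand \<open>(v, n)\<close> go to the summand \<open>(v, prod_encode (n, e))\<close>.\<close>

definition delta_fun :: "((('v \<times> nat) \<times> nat list) \<Rightarrow>\<^sub>0 'k::field divpow) \<Rightarrow> (('v \<times> nat) \<times> nat list) \<Rightarrow> 'k" where
  "delta_fun y = (\<lambda>((v, m), ls). case prod_decode m of (n, e) \<Rightarrow>
     if e \<le> length ls then dp_coef (lookup y ((v, n), drop e ls)) (mset (take e ls)) else 0)"

lemma finite_delta_fun: "finite {b. delta_fun y b \<noteq> 0}"
proof (rule finite_subset)
  let ?A = "\<lambda>b. {A. dp_coef (lookup y b) A \<noteq> 0}"
  let ?f = "\<lambda>((v, n), js). \<lambda>ks. ((v, prod_encode (n, length ks)), ks @ js)"
  show "finite (\<Union>b\<in>keys y. \<Union>A\<in>?A b. ?f b ` {ks. mset ks = A})"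
  proof (intro finite_UN_I finite_imageI)
    show "finite {ks :: nat list. mset ks = A}" for A
      using ex_mset[of A] mset_eq_finite by metis
  qed (simp_all add: finite_dp_coef)
  show "{b. delta_fun y b \<noteq> 0} \<subseteq> (\<Union>b\<in>keys y. \<Union>A\<in>?A b. ?f b ` {ks. mset ks = A})"
  proof
    fix b assume "b \<in> {b. delta_fun y b \<noteq> 0}"
    then obtain v m ls n e where b: "b = ((v, m), ls)" "prod_decode m = (n, e)" "e \<le> length ls"
      and nz: "dp_coef (lookup y ((v, n), drop e ls)) (mset (take e ls)) \<noteq> 0"
      by (cases b) (auto simp: delta_fun_def split: prod.splits if_splits)
    have "m = prod_encode (n, e)" using b(2) by (metis prod_decode_inverse)
    then have "b = ?f ((v, n), drop e ls) (take e ls)" using b by simp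
    moreover have "((v, n), drop e ls) \<in> keys y" using nz by (auto simp: in_keys_iff)
    ultimately show "b \<in> (\<Union>b\<in>keys y. \<Union>A\<in>?A b. ?f b ` {ks. mset ks = A})"
      using nz by blast
  qed
qed

definition delta :: "((('v \<times> nat) \<times> nat list) \<Rightarrow>\<^sub>0 'k::field divpow) \<Rightarrow> ((('v \<times> nat) \<times> nat list) \<Rightarrow>\<^sub>0 'k)" where
  "delta y = Abs_poly_mapping (delta_fun y)"

lemma lookup_delta: "lookup (delta y) ((v, m), ls) = (case prod_decode m of (n, e) \<Rightarrow>
     if e \<le> length ls then dp_coef (lookup y ((v, n), drop e ls)) (mset (take e ls)) else 0)"
  by (simp add: delta_def Abs_poly_mapping_inverse finite_delta_fun) (simp add: delta_fun_def)

lemma delta_eqI: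
  "(\<And>v m ls. lookup x ((v, m), ls) = lookup y ((v, m), ls)) \<Longrightarrow> x = y"
  by (rule poly_mapping_eqI) force

lemma delta_add: "delta (x + y) = delta x + delta y"
  by (rule delta_eqI) (simp add: lookup_delta lookup_add dp_coef_add split: prod.split)

lemma delta_scale: "delta (fscale (dp_const c) y) = pm_scale c (delta y)"
  by (rule delta_eqI) (simp add: lookup_delta dp_coef_const_mult split: prod.split)

lemma delta_inj: "inj delta"
proof (rule injI)
  fix x y :: "(('v \<times> nat) \<times> nat list) \<Rightarrow>\<^sub>0 'k::field divpow"
  assume *: "delta x = delta y"
  have "dp_coef (lookup x ((v, n), js)) A = dp_coef (lookup y ((v, n), js)) A" for v n js A
  proof -
    obtain ks where ks: "mset ks = A" by (rule ex_mset[THEN exE])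
    have "lookup (delta z) ((v, prod_encode (n, length ks)), ks @ js) =
        dp_coef (lookup z ((v, n), js)) A" for z :: "(('v \<times> nat) \<times> nat list) \<Rightarrow>\<^sub>0 'k divpow"
      by (simp add: lookup_delta ks)
    then show ?thesis using * by metis
  qed
  then have "lookup x ((v, n), js) = lookup y ((v, n), js)" for v n js
    by (rule dp_coef_eqI)
  then show "x = y" by (rule delta_eqI)
qed

lemma sum_rows_append:
  "(\<Sum>xs\<in>rows g (ks @ ls). G xs) = (\<Sum>hs\<in>rows g ks. \<Sum>js\<in>rows g ls. G (hs @ js))"
  by (induction ks arbitrary: G) (simp_all add: rows_Nil sum_rows_Cons)

text \<open>Cutting a row index after \<open>e\<close> letters factors the matrix entry. The first
  factor acts on the coefficients of \<open>D\<close> by \<open>dp_coef_act\<close>, the second on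
  the old tensor slots.\<close>

lemma delta_gact:
  assumes g: "g \<in> GL"
  shows "delta (gact g y) = tact g (delta y)"
proof (rule delta_eqI)
  fix v m ls
  obtain n e where m: "prod_decode m = (n, e)" by force
  show "lookup (delta (gact g y)) ((v, m), ls) = lookup (tact g (delta y)) ((v, m), ls)"
  proof (cases "e \<le> length ls")
    case False
    have "mat_coef g ls js * lookup (delta y) ((v, m), js) = 0" for js
      by (cases "mat_coef g ls js = 0") (use False mat_coef_length[of g ls js] in \<open>auto simp: lookup_delta m\<close>)
    then have "lookup (tact g (delta y)) ((v, m), ls) = 0"
      unfolding lookup_tact[OF g] by (intro sum.neutral) simp
    then show ?thesis using False by (simp add: lookup_delta m)
  next
    case True
    define ks ls' where "ks = take e ls" and "ls' = drop e ls"
    have ls: "ls = ks @ ls'" "length ks = e" using True by (auto simp: ks_def ls'_def)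
    let ?y = "\<lambda>js. lookup y ((v, n), js)"
    have "lookup (tact g (delta y)) ((v, m), ls) =
        (\<Sum>hs\<in>rows g ks. \<Sum>js\<in>rows g ls'. mat_coef g (ks @ ls') (hs @ js) * lookup (delta y) ((v, m), hs @ js))"
      unfolding lookup_tact[OF g] ls(1) by (rule sum_rows_append)
    also have "\<dots> = (\<Sum>hs\<in>rows g ks. \<Sum>js\<in>rows g ls'. mat_coef g ls' js * (mat_coef g ks hs * dp_coef (?y js) (mset hs)))"
    proof (intro sum.cong refl)
      fix hs js assume "hs \<in> rows g ks"
      then have "length ks = length hs" by (auto simp: rows_def dest: mat_coef_length)
      then show "mat_coef g (ks @ ls') (hs @ js) * lookup (delta y) ((v, m), hs @ js) =
          mat_coef g ls' js * (mat_coef g ks hs * dp_coef (?y js) (mset hs))"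
        using ls(2) by (simp add: mat_coef_append lookup_delta m)
    qed
    also have "\<dots> = (\<Sum>js\<in>rows g ls'. mat_coef g ls' js * dp_coef (dp_act g (?y js)) (mset ks))"
      unfolding dp_coef_act[OF g] sum_distrib_left by (rule sum.swap)
    also have "\<dots> = lookup (delta (gact g y)) ((v, m), ls)"
      using ls by (simp add: lookup_delta m lookup_gact[OF g] dp_coef_sum dp_coef_const_mult)
    finally show ?thesis by simp
  qed
qed

text \<open>Instead of computing divided powers along a composite, the law is pulled back along the
  injective equivariant map \<open>delta\<close> from tensor powers, where it is matrix
  multiplication.\<close>

lemma gact_compose:
  fixes y :: "(('v \<times> nat) \<times> nat list) \<Rightarrow>\<^sub>0 'k::field divpow"
  shows "g \<in> GL \<Longrightarrow> h \<in> GL \<Longrightarrow> gact (g \<circ> h) y = gact g (gact h y)"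
  by (rule injD[OF delta_inj]) (simp add: delta_gact GL_compose tact_compose)

lemma gact_id: "gact id y = y"
  for y :: "(('v \<times> nat) \<times> nat list) \<Rightarrow>\<^sub>0 'k::field divpow"
  by (rule injD[OF delta_inj]) (simp add: delta_gact GL_id tact_id)

text \<open>A splitting of vector spaces only. It need not commute with \<open>GL\<close> off the
  image of \<open>delta\<close>; equivariance is later claimed only on that image.\<close>

lemma delta_left_inverse:
  "\<exists>nabla :: ((('v \<times> nat) \<times> nat list) \<Rightarrow>\<^sub>0 'k::field) \<Rightarrow> _.
     (\<forall>x y. nabla (x + y) = nabla x + nabla y) \<and>
     (\<forall>c x. nabla (pm_scale c x) = fscale (dp_const c) (nabla x)) \<and> (\<forall>y. nabla (delta y) = y)"
proof -
  let ?s = "\<lambda>c :: 'k. \<lambda>y :: (('v \<times> nat) \<times> nat list) \<Rightarrow>\<^sub>0 'k divpow. fscale (dp_const c) y"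
  interpret vector_space_pair ?s pm_scale
    by unfold_locales (auto simp: dp_const.hom_add dp_const.hom_mult dp_const.hom_1 algebra_simps)
  have "Vector_Spaces.linear ?s pm_scale delta"
    by unfold_locales (auto simp: delta_add delta_scale)
  from linear_injective_left_inverse[OF this delta_inj]
  obtain n where n: "Vector_Spaces.linear pm_scale ?s n" "n \<circ> delta = id" by blast
  interpret n: Vector_Spaces.linear pm_scale ?s n by (rule n)
  show ?thesis
    by (rule exI[of _ n]) (use n(2) in \<open>auto simp: n.add n.scale fun_eq_iff\<close>)
qed

definition dlin :: "('b \<Rightarrow> ('c \<Rightarrow>\<^sub>0 'k::field divpow)) \<Rightarrow> ('b \<Rightarrow>\<^sub>0 'k divpow) \<Rightarrow> ('c \<Rightarrow>\<^sub>0 'k divpow)" where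
  "dlin h y = (\<Sum>b\<in>keys y. fscale (lookup y b) (h b))"

lemma dlin_superset:
  assumes "finite S" "keys y \<subseteq> S"
  shows "dlin h y = (\<Sum>b\<in>S. fscale (lookup y b) (h b))"
  unfolding dlin_def by (rule sum.mono_neutral_left) (use assms in \<open>auto simp: in_keys_iff\<close>)

lemma dlin_add: "dlin h (x + y) = dlin h x + dlin h y"
proof -
  let ?S = "keys x \<union> keys y"
  have "finite ?S" by simp
  then show ?thesis
    using keys_add[of x y] by (simp add: dlin_superset[of ?S] lookup_add F.scale_left_distrib sum.distrib)
qed

lemma dlin_fscale: "dlin h (fscale a x) = fscale a (dlin h x)"
proof -
  have "keys (fscale a x) \<subseteq> keys x" by (auto simp: in_keys_iff)
  then show ?thesis
    by (simp add: dlin_superset[of "keys x"] F.scale_sum_right)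
qed

lemma dlin_0 [simp]: "dlin h 0 = 0"
  by (simp add: dlin_def)

lemma dlin_iota:
  assumes "\<And>x y. f (x + y) = f x + f y" "\<And>c x. f (pm_scale c x) = fscale (dp_const c) (f x)"
  shows "dlin (\<lambda>b. f (basis_elt b)) (iota x) = f x"
proof -
  have f0: "f 0 = 0" using assms(2)[of 0 0] by (simp add: dp_const.hom_0)
  have fsum: "f (sum h S) = (\<Sum>s\<in>S. f (h s))" for h and S :: "'a set"
    by (induction S rule: infinite_finite_induct) (auto simp: f0 assms(1))
  have "keys (iota x) \<subseteq> keys x"
    by (auto simp: in_keys_iff dp_const.hom_0)
  then have "dlin (\<lambda>b. f (basis_elt b)) (iota x) =
      f (\<Sum>b\<in>keys x. pm_scale (lookup x b) (basis_elt b))"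
    by (simp add: dlin_superset[of "keys x"] fsum assms(2))
  then show ?thesis by (simp flip: pm_expand)
qed

section \<open>Higman's lemma\<close>

text \<open>The position map is made strictly increasing on all of \<open>nat\<close>, beyond the
  end of \<open>xs\<close>: non-leading monomials in other summands may involve larger variables,
  and these must be renamed monotonically too.\<close>

lemma subseq_strict_mono:
  assumes "subseq xs ys"
  shows "\<exists>f :: nat \<Rightarrow> nat. strict_mono f \<and> (\<forall>i<length xs. f i < length ys \<and> ys ! f i = xs ! i)"
  using assms
proof (induction rule: list_emb.induct)
  case (list_emb_Nil ys)
  show ?case by (rule exI[of _ id]) (simp add: strict_mono_def)
next
  case (list_emb_Cons xs ys y)
  then obtain f where f: "strict_mono f" "\<forall>i<length xs. f i < length ys \<and> ys ! f i = xs ! i" by blast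
  then show ?case by (intro exI[of _ "\<lambda>i. Suc (f i)"]) (auto simp: strict_mono_def)
next
  case (list_emb_Cons2 x y xs ys)
  then obtain f where f: "strict_mono f" "\<forall>i<length xs. f i < length ys \<and> ys ! f i = xs ! i" by blast
  have "strict_mono (\<lambda>i. case i of 0 \<Rightarrow> 0 | Suc i \<Rightarrow> Suc (f i))"
    using f(1) by (auto simp: strict_mono_def split: nat.split)
  with f(2) list_emb_Cons2(1) show ?case
    by (intro exI[of _ "\<lambda>i. case i of 0 \<Rightarrow> 0 | Suc i \<Rightarrow> Suc (f i)"]) (auto split: nat.split simp: nth_Cons')
qed

text \<open>The minimal bad sequence argument of Nash-Williams.\<close>

lemma higman:
  fixes w :: "nat \<Rightarrow> 'a list"
  assumes fin: "finite \<Sigma>" and w: "\<And>n. set (w n) \<subseteq> \<Sigma>"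
  shows "\<exists>i j. i < j \<and> subseq (w i) (w j)"
proof (rule ccontr)
  assume bad_w: "\<not> ?thesis"
  define B where "B = {f :: nat \<Rightarrow> 'a list. (\<forall>n. set (f n) \<subseteq> \<Sigma>) \<and> (\<forall>i j. i < j \<longrightarrow> \<not> subseq (f i) (f j))}"
  have wB: "w \<in> B" using w bad_w by (auto simp: B_def)
  define P where "P = (\<lambda>n g. g \<in> B \<and> (\<forall>f\<in>B. (\<forall>i<n. f i = g i) \<longrightarrow> length (g n) \<le> length (f n)))"
  have ex: "\<exists>g. P n g \<and> (\<forall>i<n. g i = h i)" if "h \<in> B" for n h
  proof -
    have "h \<in> B \<and> (\<forall>i<n. h i = h i)" using that by simp
    from ex_has_least_nat[of "\<lambda>f. f \<in> B \<and> (\<forall>i<n. f i = h i)", OF this, of "\<lambda>f. length (f n)"]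
    obtain g where g: "g \<in> B" "\<forall>i<n. g i = h i"
      "\<forall>f. f \<in> B \<and> (\<forall>i<n. f i = h i) \<longrightarrow> length (g n) \<le> length (f n)" by blast
    then have "P n g" unfolding P_def by metis
    with g(2) show ?thesis by blast
  qed
  have "\<exists>g. \<forall>n. P n (g n) \<and> (\<forall>i<Suc n. g (Suc n) i = g n i)"
  proof (rule dependent_nat_choice)
    show "\<exists>g. P 0 g" using ex[OF wB] by blast
    show "\<exists>g'. P (Suc n) g' \<and> (\<forall>i<Suc n. g' i = g i)" if "P n g" for g n
      using ex[of g "Suc n"] that by (auto simp: P_def)
  qed
  then obtain g where g: "\<And>n. P n (g n)" "\<And>n i. i < Suc n \<Longrightarrow> g (Suc n) i = g n i" by blast
  define m where "m n = g n n" for n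
  have agree: "g n i = m i" if "i \<le> n" for n i
    using that
  proof (induction n rule: dec_induct)
    case (step n)
    then show ?case using g(2)[of i n] by simp
  qed (simp add: m_def)
  have gB: "g n \<in> B" for n using g(1)[of n] by (simp add: P_def)
  have m_set: "set (m n) \<subseteq> \<Sigma>" for n using gB[of n] by (simp add: B_def m_def)
  have m_bad: "\<not> subseq (m i) (m j)" if "i < j" for i j
  proof -
    have "\<not> subseq (g j i) (g j j)" using gB[of j] that by (simp add: B_def)
    then show ?thesis using agree[of i j] agree[of j j] that by simp
  qed
  have m_ne: "m n \<noteq> []" for n using m_bad[of n "Suc n"] by auto
  have "finite (range (\<lambda>n. hd (m n)))"
  proof (rule finite_subset[OF image_subsetI fin])
    show "hd (m n) \<in> \<Sigma>" for n using m_set[of n] hd_in_set[OF m_ne, of n] by blast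
  qed
  then obtain n0 where inf: "infinite {n. hd (m n) = hd (m n0)}"
    using pigeonhole_infinite[of "UNIV :: nat set" "\<lambda>n. hd (m n)"] by auto
  define k where "k = enumerate {n. hd (m n) = hd (m n0)}"
  have k_mono: "strict_mono k" unfolding k_def by (rule strict_mono_enumerate[OF inf])
  have k_hd: "hd (m (k i)) = hd (m n0)" for i
    using enumerate_in_set[OF inf, of i] by (simp add: k_def)
  \<comment> \<open>The minimal sequence before the first position with the recurring letter,
    followed by the tails of the words starting with it. It is still bad, but shorter at
    \<open>k 0\<close>.\<close>
  define f where "f n = (if n < k 0 then m n else tl (m (k (n - k 0))))" for n
  have k_ge: "k 0 \<le> k i" for i using k_mono by (simp add: strict_mono_less_eq)
  have "f \<in> B"
    unfolding B_def
  proof (intro CollectI conjI allI impI notI)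
    fix n show "set (f n) \<subseteq> \<Sigma>"
      using m_set[of n] m_set[of "k (n - k 0)"] by (cases "m (k (n - k 0))") (auto simp: f_def)
  next
    fix i j :: nat assume ij: "i < j" and sub: "subseq (f i) (f j)"
    show False
    proof (cases "j < k 0")
      case True
      then show ?thesis using sub ij m_bad[of i j] by (simp add: f_def)
    next
      case j: False
      let ?j = "k (j - k 0)"
      have "f j = tl (m ?j)" using j by (simp add: f_def)
      then have mj: "m ?j = hd (m n0) # f j"
        by (simp only: k_hd[of "j - k 0", symmetric] list.collapse[OF m_ne])
      show ?thesis
      proof (cases "i < k 0")
        case True
        then have "f i = m i" by (simp add: f_def)
        then have "subseq (m i) (m ?j)" unfolding mj using sub by (simp add: list_emb_Cons)
        moreover have "i < ?j" using True k_ge[of "j - k 0"] by simp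
        ultimately show ?thesis using m_bad by blast
      next
        case False
        let ?i = "k (i - k 0)"
        have "f i = tl (m ?i)" using False by (simp add: f_def)
        then have mi: "m ?i = hd (m n0) # f i"
          by (simp only: k_hd[of "i - k 0", symmetric] list.collapse[OF m_ne])
        have "subseq (m ?i) (m ?j)" unfolding mi mj using sub by simp
        moreover have "?i < ?j" using False ij k_mono by (simp add: strict_mono_less)
        ultimately show ?thesis using m_bad by blast
      qed
    qed
  qed
  moreover have "\<forall>i<k 0. f i = g (k 0) i" using agree by (simp add: f_def)
  ultimately have "length (g (k 0) (k 0)) \<le> length (f (k 0))"
    using g(1)[of "k 0"] by (simp add: P_def)
  then show False using m_ne[of "k 0"] by (cases "g (k 0) (k 0)") (auto simp: f_def m_def)
qed

text \<open>Otherwise one could go on forever choosing elements that lie above none of those chosen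
  before; the lists \<open>F n\<close> record the earlier choices.\<close>

lemma finite_basis:
  assumes "\<And>f :: nat \<Rightarrow> 'a. (\<And>n. f n \<in> L) \<Longrightarrow> \<exists>i j. i < j \<and> R (f i) (f j)"
  shows "\<exists>L0. finite L0 \<and> L0 \<subseteq> L \<and> (\<forall>m\<in>L. \<exists>m0\<in>L0. R m0 m)"
proof (rule ccontr)
  assume neg: "\<not> ?thesis"
  then have ex: "\<exists>m. m \<in> L \<and> (\<forall>m0\<in>set ms. \<not> R m0 m)" if "set ms \<subseteq> L" for ms
    using that by (meson List.finite_set)
  have "\<exists>F. \<forall>n. set (F n) \<subseteq> L \<and> (\<exists>m. m \<in> L \<and> (\<forall>m0\<in>set (F n). \<not> R m0 m) \<and> F (Suc n) = m # F n)"
  proof (rule dependent_nat_choice)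
    show "\<exists>ms. set ms \<subseteq> L" by (rule exI[of _ "[]"]) simp
    show "\<exists>ms'. set ms' \<subseteq> L \<and> (\<exists>m. m \<in> L \<and> (\<forall>m0\<in>set ms. \<not> R m0 m) \<and> ms' = m # ms)"
      if ms: "set ms \<subseteq> L" for ms and n :: nat
    proof -
      obtain m where "m \<in> L" "\<forall>m0\<in>set ms. \<not> R m0 m" using ex[OF ms] by blast
      then show ?thesis by (intro exI[of _ "m # ms"]) (use ms in auto)
    qed
  qed
  then obtain F where F: "\<And>n. \<exists>m. m \<in> L \<and> (\<forall>m0\<in>set (F n). \<not> R m0 m) \<and> F (Suc n) = m # F n" by blast
  define f where "f n = hd (F (Suc n))" for n
  have f: "f n \<in> L" "\<forall>m0\<in>set (F n). \<not> R m0 (f n)" "F (Suc n) = f n # F n" for n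
    using F[of n] by (auto simp: f_def)
  have "f i \<in> set (F j)" if "i < j" for i j
    using that
  proof (induction j)
    case (Suc j)
    then show ?case using f(3)[of j] by (cases "i = j") auto
  qed simp
  with f(2) have "\<not> R (f i) (f j)" if "i < j" for i j using that by blast
  with assms[of f] f(1) show False by blast
qed

section \<open>Finite generation\<close>

text \<open>Inside \<open>S \<union> f\<close> S the points that are not yet arguments and those
  that are not yet values are equally many, so any bijection between them completes
  \<open>f\<close>.\<close>

lemma extend_to_permutation:
  fixes f :: "'a \<Rightarrow> 'a"
  assumes "finite S" "inj_on f S"
  shows "\<exists>p. bij p \<and> finite {x. p x \<noteq> x} \<and> (\<forall>x\<in>S. p x = f x)"
proof -
  let ?T = "S \<union> f ` S"
  have "card (?T - S) = card (?T - f ` S)"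
    using assms by (simp add: card_Diff_subset card_image)
  then obtain h where h: "bij_betw h (?T - S) (?T - f ` S)"
    using finite_same_card_bij[of "?T - S" "?T - f ` S"] assms(1) by auto
  define p where "p x = (if x \<in> S then f x else if x \<in> ?T then h x else x)" for x
  have "bij_betw p S (f ` S)"
    using assms(2) by (auto simp: bij_betw_def p_def inj_on_def)
  moreover have "bij_betw p (?T - S) (?T - f ` S)"
    by (rule bij_betw_cong[THEN iffD1, OF _ h]) (auto simp: p_def)
  ultimately have "bij_betw p (S \<union> (?T - S)) (f ` S \<union> (?T - f ` S))"
    by (rule bij_betw_combine) auto
  then have "bij_betw p ?T ?T" by (simp add: Un_absorb1)
  then have "p permutes ?T" by (rule bij_imp_permutes) (auto simp: p_def)
  moreover have "finite {x. p x \<noteq> x}"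
    by (rule finite_subset[of _ ?T]) (use assms(1) in \<open>auto simp: p_def\<close>)
  ultimately show ?thesis by (intro exI[of _ p]) (auto simp: permutes_bij p_def)
qed

section \<open>Permutations of the variables\<close>

definition perm_map :: "(nat \<Rightarrow> nat) \<Rightarrow> 'k::field vec \<Rightarrow> 'k vec" where
  "perm_map p = mono_map p (\<lambda>_. 1)"

lemma perm_map_GL: "bij p \<Longrightarrow> finite {x. p x \<noteq> x} \<Longrightarrow> perm_map p \<in> GL"
  unfolding perm_map_def by (rule mono_map_GL) auto

lemma mat_coef_perm_map: "mat_coef (perm_map p) ls js = (if ls = map p js then 1 else 0)"
proof -
  have "prod_list (map (\<lambda>_. 1) js) = (1 :: 'a)" by (induction js) auto
  then show ?thesis by (simp add: perm_map_def mat_coef_mono_map)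
qed

lemma sum_rows_perm_map:
  assumes "bij p" "finite {x. p x \<noteq> x}"
    and 0: "\<And>ms. mat_coef (perm_map p :: 'k::field vec \<Rightarrow> 'k vec) (map p js) ms = 0 \<Longrightarrow> G ms = 0"
  shows "(\<Sum>ms\<in>rows (perm_map p :: 'k vec \<Rightarrow> 'k vec) (map p js). G ms) = G js"
proof -
  have "inj (map p)" using assms(1) by (simp add: bij_is_inj)
  moreover have "(perm_map p :: 'k vec \<Rightarrow> 'k vec) \<in> GL" by (rule perm_map_GL[OF assms(1,2)])
  ultimately show ?thesis
    using 0 unfolding perm_map_def
    by (intro sum_rows_mono_map) (auto dest: injD)
qed

lemma lookup_tact_perm:
  assumes "bij p" "finite {x. p x \<noteq> x}"
  shows "lookup (tact (perm_map p) y) (i, map p js) = lookup y (i, js)"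
  unfolding lookup_tact[OF perm_map_GL[OF assms]]
  by (subst sum_rows_perm_map[OF assms]) (auto simp: mat_coef_perm_map)

lemma dp_coef_act_perm:
  assumes "bij p" "finite {x. p x \<noteq> x}"
  shows "dp_coef (dp_act (perm_map p) a) (image_mset p A) = dp_coef a A"
proof -
  obtain ks where ks: "mset ks = A" by (rule ex_mset[THEN exE])
  have "dp_coef (dp_act (perm_map p) a) (mset (map p ks)) = dp_coef a (mset ks)"
    unfolding dp_coef_act[OF perm_map_GL[OF assms]]
    by (subst sum_rows_perm_map[OF assms]) (auto simp: mat_coef_perm_map)
  then show ?thesis by (simp add: ks)
qed

lemma lookup_gact_perm:
  assumes "bij p" "finite {x. p x \<noteq> x}"
  shows "dp_coef (lookup (gact (perm_map p) y) (i, map p js)) (image_mset p A) =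
    dp_coef (lookup y (i, js)) A"
  unfolding lookup_gact[OF perm_map_GL[OF assms]]
  by (subst sum_rows_perm_map[OF assms])
     (auto simp: mat_coef_perm_map dp_coef_act_perm[OF assms] dp_const.hom_0 dp_const.hom_1)

section \<open>Monomials of \<open>D \<otimes> T\<close> and their order\<close>

type_synonym 'i fmono = "nat multiset \<times> 'i \<times> nat list"

text \<open>Each occurrence of a variable carries a tag: 0 for a factor of \<open>x^[A]\<close>, and
  the position counted from 1 for a tensor slot. Tags are compared after variables, so large
  variables dominate; keeping 0 for \<open>x^[A]\<close> lets \<open>A\<close> and \<open>js\<close>
  be recovered.\<close>

definition word_mset :: "nat multiset \<Rightarrow> nat list \<Rightarrow> (nat \<times> nat) multiset" where
  "word_mset A js = image_mset (\<lambda>n. (n, 0)) A + mset (zip js [1..<Suc (length js)])"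

lemma word_mset_inj:
  assumes eq: "word_mset A js = word_mset A' js'" and len: "length js = length js'"
  shows "A = A'" "js = js'"
proof -
  have z: "filter_mset (\<lambda>x. snd x = 0) (mset (zip js [1..<Suc (length js)])) = {#}" for js :: "nat list"
    by (rule multiset_eqI) (auto simp: count_eq_zero_iff set_zip simp del: upt_Suc)
  have f: "filter_mset (\<lambda>x. snd x = 0) (image_mset (\<lambda>n. (n, 0 :: nat)) B) = image_mset (\<lambda>n. (n, 0)) B" for B :: "nat multiset"
    by (rule filter_mset_eq_conv[THEN iffD2]) auto
  have w: "image_mset fst (filter_mset (\<lambda>x. snd x = 0) (word_mset B ks)) = B" for B ks
    by (simp only: word_mset_def filter_union_mset z f) (simp add: multiset.map_comp comp_def)
  show A: "A = A'" using w[of A js] w[of A' js'] eq by simp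
  from eq have "mset (zip js [1..<Suc (length js)]) = mset (zip js' [1..<Suc (length js')])"
    by (simp add: A word_mset_def del: upt_Suc)
  then have set: "set (zip js [1..<Suc (length js)]) = set (zip js' [1..<Suc (length js')])"
    by (rule mset_eq_setD)
  show "js = js'"
  proof (rule nth_equalityI[OF len])
    fix l assume l: "l < length js"
    then have "(js ! l, Suc l) \<in> set (zip js [1..<Suc (length js)])"
      by (auto simp: set_zip simp del: upt_Suc intro!: exI[of _ l])
    then have "(js ! l, Suc l) \<in> set (zip js' [1..<Suc (length js')])" by (simp only: set)
    then show "js ! l = js' ! l" by (auto simp: set_zip simp del: upt_Suc)
  qed
qed

lemma word_mset_map: "word_mset (image_mset f A) (map f js) = image_mset (map_prod f id) (word_mset A js)"
proof -
  have "zip (map f js) ts = map (map_prod f id) (zip js ts)" for ts :: "nat list"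
    by (simp add: zip_map1 map_prod_def id_def)
  then show ?thesis by (simp add: word_mset_def multiset.map_comp comp_def del: upt_Suc)
qed

lemma word_mset_add: "word_mset (U + A) js = image_mset (\<lambda>n. (n, 0)) U + word_mset A js"
  by (simp add: word_mset_def add_ac)


definition mono_key :: "('i \<Rightarrow> nat) \<Rightarrow> 'i fmono \<Rightarrow> nat \<times> (nat \<times> nat) multiset" where
  "mono_key \<nu> = (\<lambda>(A, i, js). (\<nu> i, word_mset A js))"

definition fsupp :: "(('i \<times> nat list) \<Rightarrow>\<^sub>0 'k::field divpow) \<Rightarrow> 'i fmono set" where
  "fsupp y = {(A, b). dp_coef (lookup y b) A \<noteq> 0}"

lemma fsupp_iff: "(A, b) \<in> fsupp y \<longleftrightarrow> dp_coef (lookup y b) A \<noteq> 0"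
  by (simp add: fsupp_def)

lemma finite_fsupp: "finite (fsupp y)"
proof (rule finite_subset)
  show "fsupp y \<subseteq> (\<Union>b\<in>keys y. {A. dp_coef (lookup y b) A \<noteq> 0} \<times> {b})"
    by (auto simp: fsupp_def in_keys_iff)
  show "finite (\<Union>b\<in>keys y. {A. dp_coef (lookup y b) A \<noteq> 0} \<times> {b})"
    by (simp add: finite_dp_coef)
qed

lemma fsupp_empty: "fsupp y = {} \<Longrightarrow> y = 0"
  by (rule poly_mapping_eqI, rule dp_coef_eqI) (auto simp: fsupp_def)

section \<open>Leading monomials\<close>

definition is_lead :: "('i \<Rightarrow> nat) \<Rightarrow> (('i \<times> nat list) \<Rightarrow>\<^sub>0 'k::field divpow) \<Rightarrow> 'i fmono \<Rightarrow> bool" where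
  "is_lead \<nu> y m \<longleftrightarrow> m \<in> fsupp y \<and> (\<forall>m'\<in>fsupp y. mono_key \<nu> m' \<le> mono_key \<nu> m)"

lemma is_lead_exists:
  assumes "y \<noteq> 0"
  shows "\<exists>m. is_lead \<nu> y m"
proof -
  have "fsupp y \<noteq> {}" using assms fsupp_empty by blast
  then have "Max (mono_key \<nu> ` fsupp y) \<in> mono_key \<nu> ` fsupp y"
    by (intro Max_in) (auto simp: finite_fsupp)
  then obtain m where "m \<in> fsupp y" "mono_key \<nu> m = Max (mono_key \<nu> ` fsupp y)" by force
  then show ?thesis by (intro exI[of _ m]) (auto simp: is_lead_def finite_fsupp)
qed

lemma mono_key_add_le:
  "mono_key \<nu> (U + A, b) \<le> mono_key \<nu> (U + A', b') \<longleftrightarrow> mono_key \<nu> (A, b) \<le> mono_key \<nu> (A', b')"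
  by (auto simp: mono_key_def word_mset_add less_eq_prod_def split: prod.split)

text \<open>Multiplication by \<open>x^[U]\<close> shifts all keys monotonically but may annihilate
  terms. It suffices that the structure constant at the leading term survives in
  \<open>k\<close>.\<close>

lemma is_lead_fscale:
  fixes y :: "('i \<times> nat list) \<Rightarrow>\<^sub>0 'k::field divpow"
  assumes "is_lead \<nu> y (A, b)" "of_nat (mbinom U A) \<noteq> (0 :: 'k)"
  shows "is_lead \<nu> (fscale (dp_mono U) y) (U + A, b)"
  unfolding is_lead_def
proof (intro conjI ballI)
  show "(U + A, b) \<in> fsupp (fscale (dp_mono U) y)"
    using assms by (simp add: fsupp_iff dp_coef_mono_mult is_lead_def)
  fix m' assume m': "m' \<in> fsupp (fscale (dp_mono U) y)"
  obtain B c where Bc: "m' = (B, c)" by (metis surj_pair)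
  from m' have "U \<subseteq># B" "(B - U, c) \<in> fsupp y"
    by (auto simp: Bc fsupp_iff dp_coef_mono_mult split: if_splits)
  then have "mono_key \<nu> (U + (B - U), c) \<le> mono_key \<nu> (U + A, b)"
    unfolding mono_key_add_le using assms(1) by (simp add: is_lead_def)
  then show "mono_key \<nu> m' \<le> mono_key \<nu> (U + A, b)"
    using \<open>U \<subseteq># B\<close> by (simp add: Bc)
qed

lemma is_lead_fproj:
  assumes "is_lead \<nu> y (repeat_mset q e + A, b)" "low q A"
  shows "is_lead \<nu> (fproj q e y) (A, b)"
  unfolding is_lead_def
proof (intro conjI ballI)
  show "(A, b) \<in> fsupp (fproj q e y)"
    using assms by (simp add: fsupp_iff dp_coef_proj is_lead_def)
  fix m' assume m': "m' \<in> fsupp (fproj q e y)"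
  obtain B c where Bc: "m' = (B, c)" by (metis surj_pair)
  from m' have "(repeat_mset q e + B, c) \<in> fsupp y"
    by (auto simp: Bc fsupp_iff dp_coef_proj split: if_splits)
  then have "mono_key \<nu> (repeat_mset q e + B, c) \<le> mono_key \<nu> (repeat_mset q e + A, b)"
    using assms(1) by (simp add: is_lead_def)
  then show "mono_key \<nu> m' \<le> mono_key \<nu> (A, b)" by (simp add: Bc mono_key_add_le)
qed

lemma word_mset_map_le:
  fixes f :: "nat \<Rightarrow> nat"
  assumes f: "strict_mono f" and le: "word_mset A js \<le> word_mset A' js'"
  shows "word_mset (image_mset f A) (map f js) \<le> word_mset (image_mset f A') (map f js')"
  unfolding word_mset_map
proof (rule image_mset_mono)
  show "\<forall>x\<in>#word_mset A js. \<forall>y\<in>#word_mset A' js'. x < y \<longrightarrow> map_prod f id x < map_prod f id y"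
    using f by (auto simp: less_prod_def strict_mono_less strict_mono_less_eq)
qed (rule le)

text \<open>Membership in \<open>GL\<close> needs a permutation, preservation of the order needs a
  monotone map; \<open>p\<close> and \<open>f\<close> coincide on every variable occurring in
  \<open>y\<close>.\<close>

lemma is_lead_gact:
  assumes p: "bij p" "finite {x. p x \<noteq> x}" and f: "strict_mono f"
    and pf: "\<And>A i js n. (A, i, js) \<in> fsupp y \<Longrightarrow> n \<in> set_mset A \<union> set js \<Longrightarrow> p n = f n"
    and lead: "is_lead \<nu> y (A, i, js)"
  shows "is_lead \<nu> (gact (perm_map p) y) (image_mset f A, i, map f js)"
proof -
  have pf': "image_mset p A = image_mset f A \<and> map p js = map f js" if "(A, i, js) \<in> fsupp y" for A i js
    using pf[OF that] by (auto intro!: image_mset_cong)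
  have supp: "(A, i, js) \<in> fsupp y" using lead by (simp add: is_lead_def)
  show ?thesis
    unfolding is_lead_def
  proof (intro conjI ballI)
    show "(image_mset f A, i, map f js) \<in> fsupp (gact (perm_map p) y)"
      using supp lookup_gact_perm[OF p, of y i js A]
      unfolding pf'[OF supp, THEN conjunct1] pf'[OF supp, THEN conjunct2] by (simp add: fsupp_iff)
    fix m' assume m': "m' \<in> fsupp (gact (perm_map p) y)"
    obtain B0 j ks0 where m'_eq: "m' = (B0, j, ks0)" by (cases m')
    define B ks where "B = image_mset (inv_into UNIV p) B0" and "ks = map (inv_into UNIV p) ks0"
    have "p \<circ> inv_into UNIV p = id" using p(1) by (auto simp: bij_is_surj surj_f_inv_f)
    then have B0: "B0 = image_mset p B" "ks0 = map p ks"
      by (simp_all add: B_def ks_def multiset.map_comp)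
    then have Bks: "(B, j, ks) \<in> fsupp y"
      using m' lookup_gact_perm[OF p, of y j ks B] by (simp add: m'_eq fsupp_iff)
    then have "mono_key \<nu> (B, j, ks) \<le> mono_key \<nu> (A, i, js)"
      using lead by (simp add: is_lead_def)
    then show "mono_key \<nu> m' \<le> mono_key \<nu> (image_mset f A, i, map f js)"
      using word_mset_map_le[OF f, of B ks A js]
      unfolding m'_eq B0 pf'[OF Bks, THEN conjunct1] pf'[OF Bks, THEN conjunct2]
      by (auto simp: mono_key_def less_eq_prod_def)
  qed
qed

text \<open>Divisibility up to monotone renaming of variables. Disjointness of \<open>U\<close> from
  the renamed variables forces the exponents of \<open>A\<close> to be matched exactly, since
  raising them would bring in binomials that may vanish in characteristic \<open>p\<close>.\<close>

definition mono_divides :: "'i fmono \<Rightarrow> 'i fmono \<Rightarrow> bool" where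
  "mono_divides = (\<lambda>(A, i, js) (A', i', js'). i = i' \<and> (\<exists>f U. strict_mono f \<and> js' = map f js \<and>
     A' = U + image_mset f A \<and> set_mset U \<inter> f ` set_mset A = {}))"

text \<open>A monomial is encoded by the word whose letter at position \<open>n\<close> records the exponent of
  \<open>x\<^sub>n\<close> together with the tensor slots occupied by \<open>x\<^sub>n\<close>.\<close>

lemma mono_divides_good:
  fixes m :: "nat \<Rightarrow> 'i fmono"
  assumes fin: "finite I"
    and m: "\<And>n. case m n of (A, i, js) \<Rightarrow> low q A \<and> i \<in> I \<and> length js = d i"
  shows "\<exists>i j. i < j \<and> mono_divides (m i) (m j)"
proof -
  define letter where "letter = (\<lambda>(A :: nat multiset, i :: 'i, js :: nat list) n. (i, count A n, {l. l < length js \<and> js ! l = n}))"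
  define len where "len = (\<lambda>(A :: nat multiset, i :: 'i, js :: nat list). Suc (Max (insert 0 (set_mset A \<union> set js))))"
  define w where "w n = map (letter (m n)) [0..<len (m n)]" for n
  let ?S = "I \<times> {..<q} \<times> Pow (\<Union>i\<in>I. {..<d i})"
  have "set (w n) \<subseteq> ?S" for n
    using m[of n] by (auto simp: w_def letter_def low_def split: prod.splits)
  moreover have "finite ?S" using fin by simp
  ultimately obtain a b where ab: "a < b" "subseq (w a) (w b)" using higman by metis
  then obtain f where f: "strict_mono f" "\<And>i. i < length (w a) \<Longrightarrow> f i < length (w b) \<and> w b ! f i = w a ! i"
    using subseq_strict_mono by blast
  obtain A i js where ma: "m a = (A, i, js)" by (cases "m a")
  obtain A' i' js' where mb: "m b = (A', i', js')" by (cases "m b")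
  have lenw: "length (w n) = len (m n)" for n by (simp add: w_def)
  have L: "i' = i \<and> count A' (f n) = count A n \<and>
      {l. l < length js' \<and> js' ! l = f n} = {l. l < length js \<and> js ! l = n}" if "n < len (m a)" for n
    using f(2)[of n] that unfolding lenw by (auto simp: w_def letter_def ma mb)
  have small: "n < len (m a)" if "n \<in> set_mset A \<union> set js" for n
  proof -
    have "n \<le> Max (insert 0 (set_mset A \<union> set js))" by (rule Max_ge) (use that in auto)
    then show ?thesis by (simp add: len_def ma)
  qed
  \<comment> \<open>The \<open>Suc\<close> in \<open>len\<close> makes every word non-empty, and
    every letter carries the summand index, so position 0 already compares the summands.\<close>
  have ii: "i' = i" using L[of 0] by (simp add: len_def ma)
  have len_js: "length js' = length js" using m[of a] m[of b] ii by (simp add: ma mb)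
  have js': "js' = map f js"
  proof (rule nth_equalityI)
    fix l assume l: "l < length js'"
    then have "js ! l \<in> set js" using len_js by simp
    then have "l \<in> {l. l < length js' \<and> js' ! l = f (js ! l)}"
      using L[OF small, of "js ! l"] l len_js by auto
    then show "js' ! l = map f js ! l" using l len_js by simp
  qed (simp add: len_js)
  have inj: "inj f" using f(1) by (rule strict_mono_imp_inj_on)
  have cnt: "count (image_mset f A) (f n) = count A n" for n
    by (induction A) (auto simp: inj_eq[OF inj])
  have "image_mset f A \<subseteq># A'"
  proof (rule mset_subset_eqI)
    fix x show "count (image_mset f A) x \<le> count A' x"
    proof (cases "x \<in># image_mset f A")
      case True
      then obtain n where n: "n \<in># A" "x = f n" by auto
      then show ?thesis using L[OF small, of n] by (simp add: cnt)
    next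
      case False
      then have "count (image_mset f A) x = 0" by (simp only: not_in_iff)
      then show ?thesis by simp
    qed
  qed
  then have A': "A' = (A' - image_mset f A) + image_mset f A" by simp
  have "set_mset (A' - image_mset f A) \<inter> f ` set_mset A = {}"
    using L[OF small] by (auto simp: in_diff_count cnt)
  with f(1) js' A' have "mono_divides (m a) (m b)" unfolding mono_divides_def ma mb ii by auto
  with ab(1) show ?thesis by blast
qed

lemma (in frobenius_power) finitely_generated_if_proj_closed:
  fixes P :: "(('i \<times> nat list) \<Rightarrow>\<^sub>0 'k divpow) set"
  assumes fin: "finite I"
    and keys: "\<And>y i js. y \<in> P \<Longrightarrow> (i, js) \<in> keys y \<Longrightarrow> i \<in> I \<and> length js = d i"
    and sub: "F.subspace P"
    and gl: "\<And>g y. g \<in> GL \<Longrightarrow> y \<in> P \<Longrightarrow> gact g y \<in> P"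
    and proj: "\<And>e y. y \<in> P \<Longrightarrow> fproj q e y \<in> P"
  shows "\<exists>G. finite G \<and> G \<subseteq> P \<and> P = F.span (\<Union>g\<in>GL. gact g ` G)"
proof -
  obtain \<nu> :: "'i \<Rightarrow> nat" where \<nu>: "inj_on \<nu> I"
    using finite_imp_inj_to_nat_seg[OF fin] by blast
  define L where "L = {m. \<exists>y\<in>P \<inter> flow q. is_lead \<nu> y m}"
  have supp_keys: "i \<in> I \<and> length js = d i" if "y \<in> P" "(A, i, js) \<in> fsupp y" for y A i js
  proof (rule keys[OF that(1)])
    show "(i, js) \<in> keys y" using that(2) by (auto simp: fsupp_iff in_keys_iff)
  qed
  have Lm: "case m of (A, i, js) \<Rightarrow> low q A \<and> i \<in> I \<and> length js = d i" if m: "m \<in> L" for m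
  proof -
    obtain A i js where m_eq: "m = (A, i, js)" by (cases m)
    obtain y where y: "y \<in> P" "y \<in> flow q" "(A, i, js) \<in> fsupp y"
      using m by (auto simp: L_def is_lead_def m_eq)
    from y(2,3) have "low q A" by (simp add: flow_def dp_low_def fsupp_iff)
    then show ?thesis using supp_keys[OF y(1,3)] by (simp add: m_eq)
  qed
  have "\<exists>L0. finite L0 \<and> L0 \<subseteq> L \<and> (\<forall>m\<in>L. \<exists>m0\<in>L0. mono_divides m0 m)"
  proof (rule finite_basis)
    fix f :: "nat \<Rightarrow> 'i fmono" assume "\<And>n. f n \<in> L"
    from Lm[OF this] show "\<exists>i j. i < j \<and> mono_divides (f i) (f j)"
      by (rule mono_divides_good[OF fin])
  qed
  then obtain L0 where L0: "finite L0" "L0 \<subseteq> L" "\<And>m. m \<in> L \<Longrightarrow> \<exists>m0\<in>L0. mono_divides m0 m" by blast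
  have "\<forall>m\<in>L0. \<exists>y\<in>P. is_lead \<nu> y m" using L0(2) by (auto simp: L_def)
  then obtain h where h: "\<And>m. m \<in> L0 \<Longrightarrow> h m \<in> P \<and> is_lead \<nu> (h m) m" by metis
  let ?G = "h ` L0"
  let ?Q = "F.span (\<Union>g\<in>GL. gact g ` ?G)"
  have QP: "?Q \<subseteq> P"
    by (rule F.span_minimal[OF _ sub]) (use h gl in auto)
  \<comment> \<open>The projection cuts an arbitrary leading monomial down to one with exponents
    below \<open>q\<close>, where the finite basis applies. Multiplying by \<open>x^[U]\<close> and
    then by \<open>x^[qe]\<close> restores it, each time with structure constant 1.\<close>
  have lead: "\<exists>z\<in>?Q. is_lead \<nu> z m" if y: "y \<in> P" and m: "is_lead \<nu> y m" for y m
  proof -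
    obtain A i js where m_eq: "m = (A, i, js)" by (cases m)
    obtain e A' where A: "A = repeat_mset q e + A'" and low: "low q A'"
      by (rule low_decompose[OF q_pos])
    have lead': "is_lead \<nu> (fproj q e y) (A', i, js)"
      using is_lead_fproj[OF _ low] m unfolding m_eq A by blast
    then have "(A', i, js) \<in> L"
      using proj[OF y] flow_fproj unfolding L_def by blast
    then obtain m0 where m0: "m0 \<in> L0" "mono_divides m0 (A', i, js)" using L0(3) by blast
    obtain A1 i1 js1 where m0_eq: "m0 = (A1, i1, js1)" by (cases m0)
    obtain f U where f: "strict_mono f" "js = map f js1" "A' = U + image_mset f A1"
      "set_mset U \<inter> f ` set_mset A1 = {}" and i1: "i1 = i"
      using m0(2) unfolding mono_divides_def m0_eq by blast
    let ?z = "h m0"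
    let ?E = "\<Union>(A, i, js)\<in>fsupp ?z. set_mset A \<union> set js"
    have "finite ?E" using finite_fsupp[of ?z] by auto
    moreover have "inj_on f ?E" using f(1) by (meson inj_on_subset strict_mono_imp_inj_on subset_UNIV)
    ultimately obtain p where p: "bij p" "finite {x. p x \<noteq> x}" "\<forall>x\<in>?E. p x = f x"
      using extend_to_permutation by blast
    have hm: "is_lead \<nu> ?z (A1, i, js1)" using h[OF m0(1)] by (simp add: m0_eq i1)
    have z1: "is_lead \<nu> (gact (perm_map p) ?z) (image_mset f A1, i, js)"
      unfolding f(2) by (rule is_lead_gact[OF p(1,2) f(1) _ hm]) (use p(3) in fastforce)
    have z2: "is_lead \<nu> (fscale (dp_mono U) (gact (perm_map p) ?z)) (A', i, js)"
      unfolding f(3) by (rule is_lead_fscale[OF z1]) (use f(4) in \<open>simp add: mbinom_disjoint\<close>)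
    have z3: "is_lead \<nu> (fscale (dp_mono (repeat_mset q e)) (fscale (dp_mono U) (gact (perm_map p) ?z))) m"
      unfolding m_eq A by (rule is_lead_fscale[OF z2]) (simp add: mbinom_repeat[OF low])
    have "gact (perm_map p) ?z \<in> (\<Union>g\<in>GL. gact g ` ?G)"
      using perm_map_GL[OF p(1,2)] m0(1) by blast
    then have "fscale (dp_mono (repeat_mset q e)) (fscale (dp_mono U) (gact (perm_map p) ?z)) \<in> ?Q"
      by (intro F.span_scale F.span_base)
    with z3 show ?thesis by blast
  qed
  \<comment> \<open>Keys determine monomials only among those whose summand lies in \<open>I\<close>
    and whose word has the prescribed length. This makes cancelling the leading term strictly lower
    all keys.\<close>
  have inj_key: "m' = m" if "y \<in> P" "m \<in> fsupp y" "y' \<in> P" "m' \<in> fsupp y'" "mono_key \<nu> m' = mono_key \<nu> m" for y y' m m'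
  proof -
    obtain A i js where m: "m = (A, i, js)" by (cases m)
    obtain A' i' js' where m': "m' = (A', i', js')" by (cases m')
    have "i \<in> I" "length js = d i" "i' \<in> I" "length js' = d i'"
      using supp_keys that(1-4) m m' by blast+
    then show ?thesis
      using that(5) \<nu> word_mset_inj[of A' js' A js] by (auto simp: mono_key_def m m' dest: inj_onD)
  qed
  have "y \<in> ?Q" if "y \<in> P" "\<And>m. m \<in> fsupp y \<Longrightarrow> mono_key \<nu> m < K" for y K
    using that
  proof (induction K arbitrary: y rule: less_induct)
    case (less K)
    show ?case
    proof (cases "y = 0")
      case True
      then show ?thesis by (simp add: F.span_zero)
    next
      case False
      then obtain m where m: "is_lead \<nu> y m" using is_lead_exists by blast
      then obtain z where z: "z \<in> ?Q" "is_lead \<nu> z m" using lead[OF less.prems(1)] by blast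
      obtain A b where m_eq: "m = (A, b)" by (cases m)
      let ?c = "dp_coef (lookup y b) A / dp_coef (lookup z b) A"
      let ?y = "y - fscale (dp_const ?c) z"
      have zP: "z \<in> P" using z(1) QP by blast
      have yP: "?y \<in> P"
        using less.prems(1) zP sub by (intro F.subspace_diff F.subspace_scale)
      have "(A, b) \<in> fsupp z" using z(2) by (simp add: is_lead_def m_eq)
      then have "(A, b) \<notin> fsupp ?y"
        by (simp add: fsupp_iff lookup_minus dp_coef_diff dp_coef_const_mult)
      have "mono_key \<nu> m' < mono_key \<nu> m" if m': "m' \<in> fsupp ?y" for m'
      proof -
        have "m' \<in> fsupp y \<union> fsupp z"
          using m' by (cases m') (auto simp: fsupp_iff lookup_minus dp_coef_diff dp_coef_const_mult)
        then have "mono_key \<nu> m' \<le> mono_key \<nu> m"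
          using m z(2) by (auto simp: is_lead_def)
        moreover have "mono_key \<nu> m' \<noteq> mono_key \<nu> m"
        proof
          assume eq: "mono_key \<nu> m' = mono_key \<nu> m"
          have "m \<in> fsupp y" using m by (simp add: is_lead_def)
          from inj_key[OF less.prems(1) this yP m' eq] show False
            using m' \<open>(A, b) \<notin> fsupp ?y\<close> m_eq by simp
        qed
        ultimately show ?thesis by simp
      qed
      moreover have "mono_key \<nu> m < K" using less.prems(2) m by (simp add: is_lead_def)
      ultimately have "?y \<in> ?Q" using less.IH yP by blast
      then have "?y + fscale (dp_const ?c) z \<in> ?Q"
        using z(1) by (intro F.span_add F.span_scale)
      then show ?thesis by simp
    qed
  qed
  note main = this
  have "P \<subseteq> ?Q"
  proof
    fix y assume y: "y \<in> P"
    show "y \<in> ?Q"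
    proof (cases "y = 0")
      case False
      then obtain m where m: "is_lead \<nu> y m" using is_lead_exists by blast
      obtain n M where nM: "mono_key \<nu> m = (n, M)" by force
      \<comment> \<open>A starting bound for the well-founded induction: this key exceeds every key
        with first component at most \<open>n\<close>.\<close>
      have "mono_key \<nu> m' < (Suc n, {#})" if "m' \<in> fsupp y" for m'
      proof -
        have "mono_key \<nu> m' \<le> (n, M)" using m that nM by (simp add: is_lead_def)
        then show ?thesis by (auto simp: less_eq_prod_def less_prod_def)
      qed
      then show ?thesis using main[OF y] by blast
    qed (simp add: F.span_zero)
  qed
  with QP have "P = ?Q" by simp
  moreover have "finite ?G" "?G \<subseteq> P" using L0(1) h by auto
  ultimately show ?thesis by blast
qed

section \<open>Modules as records\<close>

lemma ring_of_type_algebra_simps [simp]: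
  "carrier (ring_of_type_algebra :: 'a::comm_ring_1 ring) = UNIV"
  "monoid.mult (ring_of_type_algebra :: 'a ring) = (*)" "monoid.one (ring_of_type_algebra :: 'a ring) = 1"
  "ring.zero (ring_of_type_algebra :: 'a ring) = 0" "add (ring_of_type_algebra :: 'a ring) = (+)"
  by (simp_all add: ring_of_type_algebra_def fun_eq_iff)

lemma concrete_module:
  fixes s :: "'a::comm_ring_1 \<Rightarrow> 'm::ab_group_add \<Rightarrow> 'm" and M :: "('a, 'm, 'c) module_scheme"
  assumes "Modules.module s" "Modules.module.subspace s (carrier M)"
    and M: "ring.zero M = 0" "add M = (+)" "module.smult M = s"
  shows "Module.module ring_of_type_algebra M"
proof -
  interpret s: Modules.module s by fact
  have sub: "0 \<in> carrier M" "\<And>x y. x \<in> carrier M \<Longrightarrow> y \<in> carrier M \<Longrightarrow> x + y \<in> carrier M"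
    "\<And>c x. x \<in> carrier M \<Longrightarrow> s c x \<in> carrier M" "\<And>x. x \<in> carrier M \<Longrightarrow> - x \<in> carrier M"
    using assms(2) by (auto simp: s.subspace_0 s.subspace_add s.subspace_scale s.subspace_neg)
  have "abelian_group M"
    by (rule abelian_groupI) (use sub in \<open>auto simp: M intro!: bexI[of _ "- _"]\<close>)
  then show ?thesis
    by (rule moduleI[OF cring_from_type_algebra])
       (use sub in \<open>auto simp: M s.scale_left_distrib s.scale_right_distrib\<close>)
qed

lemma submodule_iff:
  fixes M :: "('a::comm_ring_1, 'm, 'c) module_scheme"
  assumes "Module.module ring_of_type_algebra M"
  shows "submodule H ring_of_type_algebra M \<longleftrightarrow> H \<subseteq> carrier M \<and> ring.zero M \<in> H \<and>
    (\<forall>x\<in>H. \<forall>y\<in>H. add M x y \<in> H) \<and> (\<forall>a. \<forall>x\<in>H. module.smult M a x \<in> H)"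
proof -
  interpret M: Module.module ring_of_type_algebra M by fact
  show ?thesis
  proof
    assume H: "submodule H ring_of_type_algebra M"
    have "ring.zero M \<in> H"
      using H unfolding submodule_def by (metis M.submoduleE(2,4) H M.smult_l_null all_not_in_conv
          M.submoduleE(1) in_mono M.R.zero_closed)
    then show "H \<subseteq> carrier M \<and> ring.zero M \<in> H \<and>
      (\<forall>x\<in>H. \<forall>y\<in>H. add M x y \<in> H) \<and> (\<forall>a. \<forall>x\<in>H. module.smult M a x \<in> H)"
      using M.submoduleE[OF H] by simp
  next
    assume H: "H \<subseteq> carrier M \<and> ring.zero M \<in> H \<and>
      (\<forall>x\<in>H. \<forall>y\<in>H. add M x y \<in> H) \<and> (\<forall>a. \<forall>x\<in>H. module.smult M a x \<in> H)"
    show "submodule H ring_of_type_algebra M"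
    proof (rule M.submoduleI)
      fix a assume a: "a \<in> H"
      then have ac: "a \<in> carrier M" using H by blast
      have "a_inv M a = module.smult M (a_inv ring_of_type_algebra (monoid.one ring_of_type_algebra)) a"
        using M.smult_l_minus[OF M.R.one_closed ac] M.smult_one[OF ac] by simp
      then show "a_inv M a \<in> H" using H a by simp
    qed (use H in auto)
  qed
qed

text \<open>From \<open>N\<close> one passes to a strictly larger submodule with least
  \<open>len\<close>; nothing fits in between, and the distance to \<open>len (carrier U)\<close>
  drops. Keeping \<open>len\<close> abstract avoids a notion of dimension for
  \<open>U\<close>.\<close>

lemma strict_composition_series:
  fixes U :: "('k::field, 'k, 'm) gl_module" and len :: "'m set \<Rightarrow> nat"
  assumes len: "\<And>N N'. gl_submodule N U \<Longrightarrow> gl_submodule N' U \<Longrightarrow> N \<subset> N' \<Longrightarrow> len N < len N'"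
    and top: "gl_submodule (carrier U) U" and sub: "\<And>N. gl_submodule N U \<Longrightarrow> N \<subseteq> carrier U"
    and bot: "gl_submodule {ring.zero U} U"
  shows "finite_length U"
proof -
  have "\<exists>n C. C 0 = N \<and> C n = carrier U \<and> (\<forall>i\<le>n. gl_submodule (C i) U) \<and>
        (\<forall>i<n. C i \<subset> C (Suc i) \<and> \<not> (\<exists>N. gl_submodule N U \<and> C i \<subset> N \<and> N \<subset> C (Suc i)))"
    if "gl_submodule N U" for N
    using that
  proof (induction "len (carrier U) - len N" arbitrary: N rule: less_induct)
    case less
    show ?case
    proof (cases "N = carrier U")
      case True
      then show ?thesis using top by (intro exI[of _ 0] exI[of _ "\<lambda>_. N"]) auto
    next
      case False
      then have "gl_submodule (carrier U) U \<and> N \<subset> carrier U" using sub[OF less.prems] top by blast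
      from ex_has_least_nat[of "\<lambda>N'. gl_submodule N' U \<and> N \<subset> N'", OF this, of len]
      obtain N' where N': "gl_submodule N' U" "N \<subset> N'"
        "\<And>N''. gl_submodule N'' U \<Longrightarrow> N \<subset> N'' \<Longrightarrow> len N' \<le> len N''" by blast
      have "len N < len N'" using len less.prems N'(1,2) by blast
      moreover have "len N' \<le> len (carrier U)"
      proof (cases "N' = carrier U")
        case False
        then have "N' \<subset> carrier U" using sub[OF N'(1)] by blast
        then show ?thesis using len[OF N'(1) top] by simp
      qed simp
      ultimately have "len (carrier U) - len N' < len (carrier U) - len N" by simp
      from less.hyps[OF this N'(1)] obtain n C where C: "C 0 = N'" "C n = carrier U" "\<forall>i\<le>n. gl_submodule (C i) U"
        "\<forall>i<n. C i \<subset> C (Suc i) \<and> \<not> (\<exists>N. gl_submodule N U \<and> C i \<subset> N \<and> N \<subset> C (Suc i))"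
        by (elim exE conjE) (rule that; assumption)
      have no: "\<not> (\<exists>N''. gl_submodule N'' U \<and> N \<subset> N'' \<and> N'' \<subset> N')"
      proof
        assume "\<exists>N''. gl_submodule N'' U \<and> N \<subset> N'' \<and> N'' \<subset> N'"
        then obtain N'' where N'': "gl_submodule N'' U" "N \<subset> N''" "N'' \<subset> N'" by (elim exE conjE) (rule that; assumption)
        show False using N'(3)[OF N''(1,2)] len[OF N''(1) N'(1) N''(3)] by simp
      qed
      let ?C = "\<lambda>i. case i of 0 \<Rightarrow> N | Suc i \<Rightarrow> C i"
      show ?thesis
      proof (intro exI[of _ "Suc n"] exI[of _ ?C] conjI allI impI)
        fix i assume "i \<le> Suc n"
        then show "gl_submodule (?C i) U" using C(3) less.prems by (cases i) auto
      next
        fix i assume i: "i < Suc n"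
        show "?C i \<subset> ?C (Suc i)" using i C(1,4) N'(2) by (cases i) auto
        show "\<not> (\<exists>N. gl_submodule N U \<and> ?C i \<subset> N \<and> N \<subset> ?C (Suc i))"
          using i C(1,4) no by (cases i) auto
      qed (use C in auto)
    qed
  qed
  from this[OF bot] show ?thesis unfolding finite_length_def by blast
qed

text \<open>One vector is taken from each layer \<open>C (Suc i) - C i\<close>. If \<open>N\<close>
  contains them and \<open>C i\<close>, then its intersection with \<open>C (Suc i)\<close> lies
  strictly above \<open>C i\<close>, hence is all of \<open>C (Suc i)\<close>.\<close>

lemma finite_length_generated:
  fixes W :: "('k::field, 'k, 'm) gl_module"
  assumes fl: "finite_length W" and gl: "is_gl_module (\<lambda>g c. c) W"
  shows "\<exists>F. finite F \<and> F \<subseteq> carrier W \<and> (\<forall>N. gl_submodule N W \<longrightarrow> F \<subseteq> N \<longrightarrow> N = carrier W)"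
proof -
  have mod: "Module.module ring_of_type_algebra W" using gl by (simp add: is_gl_module_def)
  note sub = submodule_iff[OF mod]
  from fl obtain n C where C: "C 0 = {ring.zero W}" "C n = carrier W" "\<forall>i\<le>n. gl_submodule (C i) W"
    and all: "\<forall>i<n. C i \<subset> C (Suc i) \<and> \<not> (\<exists>N. gl_submodule N W \<and> C i \<subset> N \<and> N \<subset> C (Suc i))"
    unfolding finite_length_def by (elim exE conjE) (rule that; assumption)
  have step: "C i \<subset> C (Suc i)" "gl_submodule N W \<Longrightarrow> C i \<subset> N \<Longrightarrow> \<not> N \<subset> C (Suc i)" if "i < n" for i N
    using all[rule_format, OF that] by (iprover, iprover)
  have "\<forall>i\<in>{..<n}. \<exists>w. w \<in> C (Suc i) - C i" using step(1) by blast
  then obtain w where w: "\<And>i. i < n \<Longrightarrow> w i \<in> C (Suc i) - C i" by (metis lessThan_iff)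
  have Csub: "C i \<subseteq> carrier W" if "i \<le> n" for i
    using C(3)[rule_format, OF that] sub by (auto simp: gl_submodule_def)
  have "N = carrier W" if N: "gl_submodule N W" and wN: "w ` {..<n} \<subseteq> N" for N
  proof -
    have "C i \<subseteq> N" if "i \<le> n" for i
      using that
    proof (induction i)
      case 0
      then show ?case using N C(1) sub by (auto simp: gl_submodule_def)
    next
      case (Suc i)
      let ?N = "N \<inter> C (Suc i)"
      have "gl_submodule ?N W"
        using N C(3)[rule_format, OF Suc.prems] unfolding gl_submodule_def sub by blast
      moreover have "C i \<subset> ?N"
        using Suc step(1)[of i] w[of i] wN by (auto simp: subset_iff)
      ultimately have "\<not> ?N \<subset> C (Suc i)" using step(2)[of i ?N] Suc.prems by simp
      then show ?case by blast
    qed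
    then have "carrier W \<subseteq> N" using C(2) by auto
    then show ?thesis using N sub by (auto simp: gl_submodule_def)
  qed
  moreover have "w ` {..<n} \<subseteq> carrier W" using w Csub[OF Suc_leI] by blast
  ultimately show ?thesis by (intro exI[of _ "w ` {..<n}"]) auto
qed

section \<open>Subrepresentations of finite sums of tensor powers\<close>

definition tp_sub :: "'i set \<Rightarrow> ('i \<Rightarrow> nat) \<Rightarrow> (('i \<times> nat list) \<Rightarrow>\<^sub>0 'k::field) set \<Rightarrow> bool" where
  "tp_sub I d S \<longleftrightarrow> pm.subspace S \<and>
     (\<forall>y\<in>S. \<forall>i js. (i, js) \<in> keys y \<longrightarrow> i \<in> I \<and> length js = d i) \<and>
     (\<forall>g\<in>GL. \<forall>y\<in>S. tact g y \<in> S)"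

lemma tensor_powers_simps:
  "carrier (tensor_powers I d) = {f. \<forall>(i, js)\<in>keys f. i \<in> I \<and> length js = d i}"
  "ring.zero (tensor_powers I d) = 0" "add (tensor_powers I d) = (+)" "module.smult (tensor_powers I d) = pm_scale"
  by (simp_all add: tensor_powers_def)

lemma subspace_tensor_powers:
  fixes I :: "'i set"
  shows "pm.subspace (carrier (tensor_powers I d) :: (('i \<times> nat list) \<Rightarrow>\<^sub>0 'k::field) set)"
proof (rule pm.subspaceI)
  fix x y :: "('i \<times> nat list) \<Rightarrow>\<^sub>0 'k"
  assume "x \<in> carrier (tensor_powers I d)" "y \<in> carrier (tensor_powers I d)"
  then show "x + y \<in> carrier (tensor_powers I d)"
    using keys_add[of x y] by (auto simp: tensor_powers_simps)
next
  fix c and x :: "('i \<times> nat list) \<Rightarrow>\<^sub>0 'k"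
  assume "x \<in> carrier (tensor_powers I d)"
  then show "pm_scale c x \<in> carrier (tensor_powers I d)"
    by (auto simp: tensor_powers_simps in_keys_iff)
qed (simp add: tensor_powers_simps)

lemma module_tensor_powers: "Module.module ring_of_type_algebra (tensor_powers I d)"
  by (rule concrete_module[where s=pm_scale])
     (auto simp: tensor_powers_simps(2-) subspace_tensor_powers pm.module_axioms)

lemma gl_submodule_tensor_powers: "gl_submodule S (tensor_powers I d) \<longleftrightarrow> tp_sub I d S"
  unfolding gl_submodule_def submodule_iff[OF module_tensor_powers] tp_sub_def pm.subspace_def gl_act_tensor_powers
  by (auto simp: tensor_powers_simps)

lemma tp_sub_carrier: "tp_sub I d (carrier (tensor_powers I d))"
proof -
  have "tact g y \<in> carrier (tensor_powers I d)" if g: "g \<in> GL" and y: "y \<in> carrier (tensor_powers I d)" for g y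
  proof -
    have "i \<in> I \<and> length ls = d i" if nz: "lookup (tact g y) (i, ls) \<noteq> 0" for i ls
    proof -
      obtain js where "mat_coef g ls js * lookup y (i, js) \<noteq> 0"
        using nz unfolding lookup_tact[OF g] by (meson sum.neutral)
      then have "length ls = length js" "(i, js) \<in> keys y"
        by (auto dest: mat_coef_length simp: in_keys_iff)
      then show ?thesis using y by (auto simp: tensor_powers_simps)
    qed
    then show ?thesis by (auto simp: tensor_powers_simps in_keys_iff)
  qed
  then show ?thesis
    by (auto simp: tp_sub_def subspace_tensor_powers) (auto simp: tensor_powers_simps)
qed

section \<open>Weight components of subrepresentations\<close>

definition restr :: "('b \<Rightarrow> bool) \<Rightarrow> ('b \<Rightarrow>\<^sub>0 'k::field) \<Rightarrow> ('b \<Rightarrow>\<^sub>0 'k)" where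
  "restr Q y = (\<Sum>b | b \<in> keys y \<and> Q b. pm_scale (lookup y b) (basis_elt b))"

lemma lookup_restr [simp]: "lookup (restr Q y) b = (if Q b then lookup y b else 0)"
  by (simp add: restr_def lookup_sum lookup_single when_def if_distrib in_keys_iff cong: if_cong)

lemma infinite_alg_closed: "infinite (UNIV :: 'k::alg_closed_field set)"
proof
  assume fin: "finite (UNIV :: 'k set)"
  define p where "p = (\<Prod>a\<in>(UNIV :: 'k set). [:- a, 1:])"
  have "degree p = (\<Sum>a\<in>(UNIV :: 'k set). degree [:- a, 1:])"
    unfolding p_def by (rule degree_prod_eq_sum_degree) auto
  then have "degree p = card (UNIV :: 'k set)" by simp
  then have "degree p > 0" using fin by (simp add: card_gt_0_iff)
  then have "degree (p + 1) > 0" by (simp add: degree_add_eq_left)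
  then obtain x where "poly (p + 1) x = 0" using alg_closed_imp_poly_has_root by blast
  moreover have "poly p x = 0"
    unfolding p_def poly_prod using fin by (intro prod_zero) (auto intro!: bexI[of _ x])
  ultimately show False by simp
qed

text \<open>Supplies the scalar that separates weights: an infinite field has a nonzero
  \<open>t\<close> avoiding the finitely many solutions of \<open>t^m = 1\<close> with
  \<open>1 \<le> m \<le> D\<close>.\<close>

lemma distinct_powers:
  "\<exists>t :: 'k::alg_closed_field. t \<noteq> 0 \<and> inj_on (\<lambda>c :: nat. t ^ c) {..D}"
proof -
  have fin: "finite {t :: 'k. t ^ m = 1}" if "m > 0" for m
  proof -
    have "coeff (monom (1 :: 'k) m - 1) m = 1" using that by simp
    then have "monom (1 :: 'k) m - 1 \<noteq> 0" by force
    from poly_roots_finite[OF this] show ?thesis by (simp add: poly_monom)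
  qed
  have "finite (insert 0 (\<Union>m\<in>{1..D}. {t :: 'k. t ^ m = 1}))" using fin by simp
  from ex_new_if_finite[OF infinite_alg_closed this]
  obtain t :: 'k where t: "t \<noteq> 0" "\<And>m. 1 \<le> m \<Longrightarrow> m \<le> D \<Longrightarrow> t ^ m \<noteq> 1" by auto
  have "False" if "a < b" "b \<le> D" "t ^ a = t ^ b" for a b
  proof -
    have "t ^ b = t ^ a * t ^ (b - a)" using that(1) by (simp flip: power_add)
    then have "t ^ (b - a) = 1" using that(3) t(1) by simp
    then show False using t(2)[of "b - a"] that by simp
  qed
  then have "inj_on (\<lambda>c. t ^ c) {..D}" by (intro inj_onI) (metis atMost_iff linorder_neqE_nat)
  with t(1) show ?thesis by blast
qed

text \<open>Applying \<open>L\<close> minus the eigenvalue at \<open>c0\<close> kills one component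
  and rescales the others by nonzero factors, so induction on the number of components
  applies.\<close>

lemma eigen_components:
  fixes L :: "('b \<Rightarrow>\<^sub>0 'k::field) \<Rightarrow> ('b \<Rightarrow>\<^sub>0 'k)"
  assumes N: "pm.subspace N" and stable: "\<And>y. y \<in> N \<Longrightarrow> L y \<in> N"
    and add: "\<And>x y. L (x + y) = L x + L y" and sc: "\<And>c x. L (pm_scale c x) = pm_scale c (L x)"
  shows "finite C \<Longrightarrow> inj_on ev C \<Longrightarrow> (\<And>c. c \<in> C \<Longrightarrow> L (x c) = pm_scale (ev c) (x c)) \<Longrightarrow>
    (\<Sum>c\<in>C. x c) \<in> N \<Longrightarrow> \<forall>c\<in>C. x c \<in> N"
proof (induction C arbitrary: x rule: finite_induct)
  case (insert c0 C)
  have L0: "L 0 = 0" using sc[of 0 0] by simp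
  have Lsum: "L (sum x A) = (\<Sum>c\<in>A. L (x c))" for A
    by (induction A rule: infinite_finite_induct) (auto simp: L0 add)
  let ?s = "\<Sum>c\<in>insert c0 C. x c"
  let ?x = "\<lambda>c. pm_scale (ev c - ev c0) (x c)"
  have "L ?s - pm_scale (ev c0) ?s \<in> N"
    using insert.prems(3) stable by (intro pm.subspace_diff[OF N] pm.subspace_scale[OF N]) auto
  moreover have "L ?s = (\<Sum>c\<in>insert c0 C. pm_scale (ev c) (x c))"
    unfolding Lsum by (rule sum.cong) (use insert.prems(2) in auto)
  then have "L ?s - pm_scale (ev c0) ?s = (\<Sum>c\<in>insert c0 C. ?x c)"
    by (simp add: pm.scale_sum_right sum_subtractf pm.scale_left_diff_distrib del: sum.insert)
  then have "L ?s - pm_scale (ev c0) ?s = (\<Sum>c\<in>C. ?x c)"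
    using insert.hyps by simp
  ultimately have "(\<Sum>c\<in>C. ?x c) \<in> N" by simp
  then have "\<forall>c\<in>C. ?x c \<in> N"
    using insert.prems by (intro insert.IH) (auto simp: sc pm.scale_left_commute mult.commute)
  then have C: "x c \<in> N" if "c \<in> C" for c
  proof -
    have "ev c \<noteq> ev c0" using insert.prems(1) insert.hyps(2) that by (metis inj_onD insertCI)
    then have "ev c - ev c0 \<noteq> 0" by simp
    moreover have "pm_scale (inverse (ev c - ev c0)) (?x c) \<in> N"
      by (rule pm.subspace_scale[OF N]) (use \<open>\<forall>c\<in>C. ?x c \<in> N\<close> that in blast)
    ultimately show ?thesis by simp
  qed
  have "x c0 = ?s - (\<Sum>c\<in>C. x c)" using insert.hyps by simp
  also have "\<dots> \<in> N" by (rule pm.subspace_diff[OF N insert.prems(3)]) (rule pm.subspace_sum[OF N C])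
  finally show ?case using C by auto
qed simp

text \<open>The diagonal element scaling \<open>x_n\<close> by \<open>t\<close> has eigenvalue
  \<open>t^c\<close> on tensors in which \<open>n\<close> occurs \<open>c\<close> times, and these
  eigenvalues are distinct up to degree \<open>D\<close>.\<close>

lemma restr_count_in:
  fixes S :: "(('i \<times> nat list) \<Rightarrow>\<^sub>0 'k::alg_closed_field) set"
  assumes S: "tp_sub I d S" and y: "y \<in> S"
  shows "restr (\<lambda>b. count (mset (snd b)) n = c) y \<in> S"
proof -
  have sub: "pm.subspace S" using S by (simp add: tp_sub_def)
  define D where "D = Max (insert 0 ((\<lambda>b. length (snd b)) ` keys y))"
  have D: "count (mset (snd b)) n \<le> D" if "b \<in> keys y" for b
  proof -
    have "length (snd b) \<le> D" unfolding D_def by (rule Max_ge) (use that in auto)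
    then show ?thesis using count_le_size[of "mset (snd b)" n] by simp
  qed
  obtain t :: 'k where t: "t \<noteq> 0" "inj_on (\<lambda>c :: nat. t ^ c) {..D}" using distinct_powers by blast
  define g where "g = mono_map id (\<lambda>i. if i = n then t else 1)"
  have "finite {i. (if i = n then t else 1) \<noteq> 1}"
    by (rule finite_subset[of _ "{n}"]) (auto split: if_splits)
  then have g: "g \<in> GL" unfolding g_def by (intro mono_map_GL) (use t in auto)
  have pl: "prod_list (map (\<lambda>i. if i = n then t else 1) js) = t ^ count (mset js) n" for js
    by (induction js) auto
  have act: "lookup (tact g z) (i, js) = t ^ count (mset js) n * lookup z (i, js)" for z :: "('i \<times> nat list) \<Rightarrow>\<^sub>0 'k" and i js
  proof -
    have "lookup (tact g z) (i, js) = mat_coef g js js * lookup z (i, js)"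
      unfolding lookup_tact[OF g]
      by (subst sum_rows_superset[OF g, of "{js}"]) (auto simp: rows_def g_def mat_coef_mono_map split: if_splits)
    then show ?thesis by (simp add: g_def mat_coef_mono_map pl)
  qed
  let ?x = "\<lambda>c. restr (\<lambda>b. count (mset (snd b)) n = c) y"
  have sum: "(\<Sum>c\<le>D. ?x c) = y"
    by (rule poly_mapping_eqI) (use D in \<open>auto simp: lookup_sum in_keys_iff\<close>)
  have "\<forall>c\<in>{..D}. ?x c \<in> S"
  proof (rule eigen_components[OF sub, of "tact g"])
    show "tact g y \<in> S" if "y \<in> S" for y using S g that by (simp add: tp_sub_def)
    show "tact g (?x c) = pm_scale (t ^ c) (?x c)" for c
      by (rule poly_mapping_pair_eqI) (simp add: act)
  qed (use t y sum in \<open>auto simp: tact_add tact_scale\<close>)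
  moreover have "?x c = 0" if "c > D"
    by (rule poly_mapping_eqI) (use D that in \<open>force simp: in_keys_iff\<close>)
  ultimately show ?thesis using pm.subspace_0[OF sub] by (cases "c \<le> D") auto
qed

lemma restr_content_in:
  fixes S :: "(('i \<times> nat list) \<Rightarrow>\<^sub>0 'k::alg_closed_field) set"
  assumes S: "tp_sub I d S" and y: "y \<in> S"
  shows "restr (\<lambda>b. mset (snd b) = C) y \<in> S"
proof -
  \<comment> \<open>Finitely many variables suffice: outside this set the count of \<open>C\<close>
    and of every word in the support of \<open>y\<close> is 0.\<close>
  let ?V = "set_mset C \<union> (\<Union>b\<in>keys y. set (snd b))"
  have "restr (\<lambda>b. \<forall>n\<in>V. count (mset (snd b)) n = count C n) y \<in> S" if "finite V" for V
    using that
  proof induction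
    case empty
    have "restr (\<lambda>b. \<forall>n\<in>{}. count (mset (snd b)) n = count C n) y = y"
      by (rule poly_mapping_eqI) simp
    then show ?case using y by simp
  next
    case (insert n V)
    have "restr (\<lambda>b. \<forall>m\<in>insert n V. count (mset (snd b)) m = count C m) y =
        restr (\<lambda>b. count (mset (snd b)) n = count C n) (restr (\<lambda>b. \<forall>m\<in>V. count (mset (snd b)) m = count C m) y)"
      by (rule poly_mapping_eqI) simp
    then show ?case using restr_count_in[OF S insert.IH] by simp
  qed
  from this[of ?V] have "restr (\<lambda>b. \<forall>n\<in>?V. count (mset (snd b)) n = count C n) y \<in> S" by simp
  also have "restr (\<lambda>b. \<forall>n\<in>?V. count (mset (snd b)) n = count C n) y = restr (\<lambda>b. mset (snd b) = C) y"
  proof (rule poly_mapping_eqI)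
    fix b
    have "mset (snd b) = C" if "b \<in> keys y" "\<forall>n\<in>?V. count (mset (snd b)) n = count C n"
    proof (rule multiset_eqI)
      fix n show "count (mset (snd b)) n = count C n"
      proof (cases "n \<in> ?V")
        case False
        then have "n \<notin># C" "n \<notin> set (snd b)" using that(1) by auto
        then show ?thesis by (simp add: count_eq_zero_iff[THEN iffD2])
      qed (use that(2) in blast)
    qed
    then show "lookup (restr (\<lambda>b. \<forall>n\<in>?V. count (mset (snd b)) n = count C n) y) b =
        lookup (restr (\<lambda>b. mset (snd b) = C) y) b"
      by (auto simp: in_keys_iff)
  qed
  finally show ?thesis .
qed

text \<open>A subrepresentation is determined by its vectors involving only the first \<open>max d\<close>
  variables, since a vector of pure weight can be permuted into these.\<close>

lemma tp_sub_determined: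
  fixes N N' :: "(('i \<times> nat list) \<Rightarrow>\<^sub>0 'k::alg_closed_field) set"
  assumes N: "tp_sub I d N" and N': "tp_sub I d N'" and D: "\<And>i. i \<in> I \<Longrightarrow> d i \<le> D"
    and small: "\<And>y. y \<in> N' \<Longrightarrow> (\<And>i js. (i, js) \<in> keys y \<Longrightarrow> set js \<subseteq> {..<D}) \<Longrightarrow> y \<in> N"
  shows "N' \<subseteq> N"
proof
  fix y assume y: "y \<in> N'"
  have sub: "pm.subspace N" using N by (simp add: tp_sub_def)
  let ?r = "\<lambda>C. restr (\<lambda>b. mset (snd b) = C) y"
  have "?r C \<in> N" for C
  proof (cases "?r C = 0")
    case True
    then show ?thesis using pm.subspace_0[OF sub] by simp
  next
    case False
    then obtain i js where ijs: "(i, js) \<in> keys (?r C)"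
      by (metis all_not_in_conv keys_eq_empty surj_pair)
    then have C: "C = mset js" by (auto simp: in_keys_iff split: if_splits)
    have rN: "?r C \<in> N'" by (rule restr_content_in[OF N' y])
    have "i \<in> I" "length js = d i" using N' rN ijs by (auto simp: tp_sub_def)
    have "card (set js) \<le> length js" by (rule card_length)
    also have "\<dots> \<le> D" using D[OF \<open>i \<in> I\<close>] \<open>length js = d i\<close> by simp
    finally obtain f where f: "inj_on f (set js)" "f ` set js \<subseteq> {..<D}"
      using card_le_inj[of "set js" "{..<D}"] by auto
    obtain p where p: "bij p" "finite {x. p x \<noteq> x}" "\<forall>x\<in>set js. p x = f x"
      using extend_to_permutation[OF _ f(1)] by auto
    let ?p' = "inv_into UNIV p"
    have inv: "?p' (p x) = x" "p (?p' x) = x" for x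
      using p(1) by (simp_all add: bij_is_inj bij_is_surj surj_f_inv_f)
    have p': "bij ?p'" "finite {x. ?p' x \<noteq> x}"
    proof -
      show "bij ?p'" using p(1) by (rule bij_imp_bij_inv)
      have "{x. ?p' x \<noteq> x} \<subseteq> {x. p x \<noteq> x}"
      proof (intro subsetI CollectI notI)
        fix x assume "x \<in> {x. ?p' x \<noteq> x}" "p x = x"
        then show False using inv(1)[of x] by simp
      qed
      then show "finite {x. ?p' x \<noteq> x}" using p(2) finite_subset by blast
    qed
    have gp: "(perm_map p :: 'k vec \<Rightarrow> 'k vec) \<in> GL" "(perm_map ?p' :: 'k vec \<Rightarrow> 'k vec) \<in> GL"
      by (rule perm_map_GL[OF p(1,2)], rule perm_map_GL[OF p'])
    let ?z = "tact (perm_map p) (?r C)"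
    have "?z \<in> N"
    proof (rule small)
      show "?z \<in> N'" using N' rN gp(1) by (simp add: tp_sub_def)
      fix i' ls assume "(i', ls) \<in> keys ?z"
      moreover have ls: "ls = map p (map ?p' ls)" by (simp add: comp_def inv)
      ultimately have "(i', map ?p' ls) \<in> keys (?r C)"
        using lookup_tact_perm[OF p(1,2), of "?r C" i' "map ?p' ls"] by (simp add: in_keys_iff comp_def inv)
      then have "mset (map ?p' ls) = mset js" by (auto simp: in_keys_iff C split: if_splits)
      then have "set (map ?p' ls) = set js" by (rule mset_eq_setD)
      moreover have "set ls = p ` set (map ?p' ls)" by (simp add: image_image inv)
      ultimately have "set ls = p ` set js" by (simp only:)
      also have "\<dots> = f ` set js" using p(3) by auto
      finally show "set ls \<subseteq> {..<D}" using f(2) by simp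
    qed
    then have "tact (perm_map ?p') ?z \<in> N"
      using N gp(2) by (simp add: tp_sub_def)
    also have "tact (perm_map ?p') ?z = ?r C"
    proof (rule poly_mapping_pair_eqI)
      fix i' ls
      have ls: "ls = map ?p' (map p ls)" by (simp add: comp_def inv)
      have "lookup (tact (perm_map ?p') ?z) (i', map ?p' (map p ls)) = lookup (?r C) (i', ls)"
        unfolding lookup_tact_perm[OF p'] by (rule lookup_tact_perm[OF p(1,2)])
      then show "lookup (tact (perm_map ?p') ?z) (i', ls) = lookup (?r C) (i', ls)"
        by (simp only: ls[symmetric])
    qed
    finally show ?thesis .
  qed
  moreover have "y = (\<Sum>C\<in>(\<lambda>b. mset (snd b)) ` keys y. ?r C)"
    by (rule poly_mapping_eqI) (auto simp: lookup_sum in_keys_iff)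
  ultimately show "y \<in> N" using pm.subspace_sum[OF sub] by metis
qed

text \<open>The length function counts leading basis vectors of the part of \<open>N\<close> inside
  the finite-dimensional space spanned by \<open>K\<close>. With \<open>N \<subset> N'\<close> and
  the same leading vectors, elimination identifies these parts, and \<open>tp_sub_determined\<close>
  then identifies \<open>N\<close> and \<open>N'\<close>.\<close>

lemma tp_sub_length:
  fixes d :: "'i \<Rightarrow> nat"
  assumes I: "finite I"
  shows "\<exists>len :: (('i \<times> nat list) \<Rightarrow>\<^sub>0 'k::alg_closed_field) set \<Rightarrow> nat.
    \<forall>N N'. tp_sub I d N \<longrightarrow> tp_sub I d N' \<longrightarrow> N \<subset> N' \<longrightarrow> len N < len N'"
proof -
  define D where "D = Max (insert 0 (d ` I))"
  have D: "d i \<le> D" if "i \<in> I" for i unfolding D_def by (rule Max_ge) (use I that in auto)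
  define K where "K = {(i, js). i \<in> I \<and> length js = d i \<and> set js \<subseteq> {..<D}}"
  have "K \<subseteq> (\<Union>i\<in>I. Pair i ` {js. set js \<subseteq> {..<D} \<and> length js = d i})" by (auto simp: K_def)
  then have fin: "finite K"
    by (rule finite_subset) (auto intro!: finite_UN_I I finite_imageI finite_lists_length_eq)
  then obtain \<nu> :: "'i \<times> nat list \<Rightarrow> nat" where \<nu>: "inj_on \<nu> K"
    using finite_imp_inj_to_nat_seg by blast
  define Ld where "Ld = (\<lambda>N. {b\<in>K. \<exists>y\<in>N :: (('i \<times> nat list) \<Rightarrow>\<^sub>0 'k) set. keys y \<subseteq> K \<and>
      b \<in> keys y \<and> (\<forall>b'\<in>keys y. \<nu> b' \<le> \<nu> b)})"
  have "card (Ld N) < card (Ld N')" if N: "tp_sub I d N" and N': "tp_sub I d N'" and lt: "N \<subset> N'" for N N'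
  proof (rule psubset_card_mono)
    show "finite (Ld N')" unfolding Ld_def using fin by simp
    have "Ld N \<subseteq> Ld N'" unfolding Ld_def using lt by blast
    moreover have "Ld N \<noteq> Ld N'"
    proof
      assume eq: "Ld N = Ld N'"
      have sub: "pm.subspace N" "pm.subspace N'" using N N' by (auto simp: tp_sub_def)
      have "y \<in> N" if "y \<in> N'" "keys y \<subseteq> K" "\<And>b. b \<in> keys y \<Longrightarrow> \<nu> b < m" for y m
        using that
      proof (induction m arbitrary: y rule: less_induct)
        case (less m)
        show ?case
        proof (cases "y = 0")
          case True
          then show ?thesis using pm.subspace_0[OF sub(1)] by simp
        next
          case False
          then have "\<nu> ` keys y \<noteq> {}" by simp
          then have "Max (\<nu> ` keys y) \<in> \<nu> ` keys y" by (intro Max_in) auto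
          then obtain b where b: "b \<in> keys y" "\<nu> b = Max (\<nu> ` keys y)" by force
          then have bmax: "\<nu> b' \<le> \<nu> b" if "b' \<in> keys y" for b' using that by simp
          have "b \<in> Ld N'" unfolding Ld_def using b(1) bmax less.prems(1,2) by blast
          then obtain z where z: "z \<in> N" "keys z \<subseteq> K" "b \<in> keys z"
            "\<And>b'. b' \<in> keys z \<Longrightarrow> \<nu> b' \<le> \<nu> b"
            unfolding eq[symmetric] by (auto simp: Ld_def)
          let ?c = "lookup y b / lookup z b"
          let ?y = "y - pm_scale ?c z"
          have keys: "keys ?y \<subseteq> keys y \<union> keys z"
            by (auto simp: in_keys_iff lookup_minus)
          have nb: "b \<notin> keys ?y"
            using z(3) by (simp add: in_keys_iff lookup_minus)
          have "\<nu> b' < \<nu> b" if "b' \<in> keys ?y" for b'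
          proof -
            have "\<nu> b' \<le> \<nu> b" using that keys bmax z(4) by blast
            moreover have "\<nu> b' \<noteq> \<nu> b"
            proof
              assume eq': "\<nu> b' = \<nu> b"
              have "b' \<in> K" using that keys z(2) less.prems(2) by blast
              moreover have "b \<in> K" using z(2,3) by blast
              ultimately have "b' = b" by (rule inj_onD[OF \<nu> eq'])
              with nb that show False by simp
            qed
            ultimately show ?thesis by simp
          qed
          moreover have "\<nu> b < m" using less.prems(3) b(1) .
          moreover have "?y \<in> N'"
            using less.prems(1) z(1) lt by (intro pm.subspace_diff[OF sub(2)] pm.subspace_scale[OF sub(2)]) auto
          moreover have "keys ?y \<subseteq> K" using keys z(2) less.prems(2) by blast
          ultimately have "?y \<in> N" using less.IH by blast
          then have "?y + pm_scale ?c z \<in> N"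
            using z(1) by (intro pm.subspace_add[OF sub(1)] pm.subspace_scale[OF sub(1)])
          then show ?thesis by simp
        qed
      qed
      note main = this
      have "N' \<subseteq> N"
      proof (rule tp_sub_determined[OF N N' D])
        fix y assume y: "y \<in> N'" and ks: "\<And>i js. (i, js) \<in> keys y \<Longrightarrow> set js \<subseteq> {..<D}"
        have K: "keys y \<subseteq> K"
          using N' y ks by (auto simp: K_def tp_sub_def)
        have "\<nu> b < Suc (Max (insert 0 (\<nu> ` keys y)))" if "b \<in> keys y" for b
          using that by (auto simp: less_Suc_eq_le intro!: Max_ge)
        from main[OF y K this] show "y \<in> N" .
      qed
      with lt show False by blast
    qed
    ultimately show "Ld N \<subset> Ld N'" by blast
  qed
  then show ?thesis by (intro exI[of _ "\<lambda>N. card (Ld N)"]) blast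
qed

text \<open>\<open>finitely_presented\<close> asks for representations on the type
  \<open>'k vec\<close>. Finitely many summands and words of naturals can be encoded as naturals,
  and the structure of \<open>S\<close> is transported along the resulting injection.\<close>

lemma realize_tp_sub:
  fixes S :: "(('i \<times> nat list) \<Rightarrow>\<^sub>0 'k::alg_closed_field) set"
  assumes S: "tp_sub I d S" and I: "finite I"
  shows "\<exists>(U :: ('k, 'k, 'k vec) gl_module) f. is_gl_module (\<lambda>g c. c) U \<and> finite_length U \<and>
    f \<in> gl_hom ((tensor_powers I d)\<lparr>carrier := S\<rparr>) U \<and> f ` S = carrier U \<and>
    {s \<in> S. f s = ring.zero U} = {0}"
proof -
  obtain \<nu> :: "'i \<Rightarrow> nat" where \<nu>: "inj_on \<nu> I"
    using finite_imp_inj_to_nat_seg[OF I] by blast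
  define \<epsilon> where "\<epsilon> = (\<lambda>(i, js). prod_encode (\<nu> i, list_encode js))"
  have inj: "b = b'" if "\<epsilon> b = \<epsilon> b'" "fst b \<in> I" "fst b' \<in> I" for b b'
    using that \<nu> by (auto simp: \<epsilon>_def prod_encode_eq list_encode_eq dest: inj_onD split: prod.splits)
  define E :: "(('i \<times> nat list) \<Rightarrow>\<^sub>0 'k) \<Rightarrow> 'k vec" where "E = lin_extend (\<lambda>b. basis_elt (\<epsilon> b))"
  have sub: "pm.subspace S" and keys: "\<And>y b. y \<in> S \<Longrightarrow> b \<in> keys y \<Longrightarrow> fst b \<in> I"
    and act: "\<And>g y. g \<in> GL \<Longrightarrow> y \<in> S \<Longrightarrow> tact g y \<in> S"
    using S by (auto simp: tp_sub_def)
  have E_add: "E (x + y) = E x + E y" and E_sc: "E (pm_scale c x) = pm_scale c (E x)" for x y c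
    by (simp_all add: E_def lin_extend_add lin_extend_scale)
  have E_0: "E 0 = 0" using E_sc[of 0 0] by simp
  have look: "lookup (E y) (\<epsilon> b) = lookup y b" if y: "y \<in> S" and b: "fst b \<in> I" for y b
  proof -
    have "lookup (E y) (\<epsilon> b) = (\<Sum>b'\<in>keys y. if b' = b then lookup y b else 0)"
      unfolding E_def lookup_lin_extend
      by (rule sum.cong) (use inj[OF _ keys[OF y] b] in \<open>auto simp: lookup_single when_def\<close>)
    then show ?thesis by (simp add: in_keys_iff)
  qed
  have E_eq0: "y = 0" if "y \<in> S" "E y = 0" for y
  proof (rule poly_mapping_eqI)
    fix b
    show "lookup y b = lookup 0 b"
      using look[OF that(1), of b] that(2) keys[OF that(1), of b] by (cases "fst b \<in> I") (auto simp: in_keys_iff)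
  qed
  have E_inj: "inj_on E S"
  proof (rule inj_onI)
    fix x y assume "x \<in> S" "y \<in> S" "E x = E y"
    then have "x - y = 0" using E_add[of "x - y" y] by (intro E_eq0 pm.subspace_diff[OF sub]) auto
    then show "x = y" by simp
  qed
  define U :: "('k, 'k, 'k vec) gl_module" where
    "U = \<lparr>carrier = E ` S, monoid.mult = undefined, one = undefined, ring.zero = 0, add = (+),
      module.smult = pm_scale, gl_act = (\<lambda>g v. E (tact g (inv_into S E v)))\<rparr>"
  have U: "carrier U = E ` S" "ring.zero U = 0" "add U = (+)" "module.smult U = pm_scale"
    by (simp_all add: U_def)
  have U_act: "gl_act U g (E s) = E (tact g s)" if "s \<in> S" for g s
    using that E_inj by (simp add: U_def)
  have subE: "pm.subspace (E ` T)" if "pm.subspace T" for T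
  proof (rule pm.subspaceI)
    show "0 \<in> E ` T" using E_0 pm.subspace_0[OF that] by (metis image_eqI)
    show "x + y \<in> E ` T" if "x \<in> E ` T" "y \<in> E ` T" for x y
      using that pm.subspace_add[OF \<open>pm.subspace T\<close>] by (auto simp flip: E_add)
    show "pm_scale c x \<in> E ` T" if "x \<in> E ` T" for c x
      using that pm.subspace_scale[OF \<open>pm.subspace T\<close>] by (auto simp flip: E_sc)
  qed
  have mod: "Module.module ring_of_type_algebra U"
    by (rule concrete_module[where s=pm_scale]) (use subE[OF sub] in \<open>auto simp: U pm.module_axioms\<close>)
  have gl: "is_gl_module (\<lambda>g c. c) U"
    unfolding is_gl_module_def using mod sub act
    by (auto simp: U U_act tact_id tact_compose tact_add tact_scale GL_compose pm.subspace_add pm.subspace_scale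
        simp flip: E_add E_sc)
  have hom: "E \<in> gl_hom ((tensor_powers I d)\<lparr>carrier := S\<rparr>) U"
    unfolding gl_hom_def by (auto simp: U U_act tensor_powers_simps gl_act_tensor_powers E_add E_sc)
  have gs: "gl_submodule N U \<longleftrightarrow> N \<subseteq> E ` S \<and> pm.subspace N \<and> (\<forall>g\<in>GL. \<forall>x\<in>N. gl_act U g x \<in> N)" for N
    unfolding gl_submodule_def submodule_iff[OF mod] pm.subspace_def by (auto simp: U)
  have pull: "tp_sub I d {s \<in> S. E s \<in> N}" "N = E ` {s \<in> S. E s \<in> N}" if N: "gl_submodule N U" for N
  proof -
    have N': "N \<subseteq> E ` S" "pm.subspace N" "\<And>g x. g \<in> GL \<Longrightarrow> x \<in> N \<Longrightarrow> gl_act U g x \<in> N"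
      using N gs by blast+
    show "N = E ` {s \<in> S. E s \<in> N}" using N'(1) by auto
    have "pm.subspace {s \<in> S. E s \<in> N}"
      using sub N'(2) by (auto simp: pm.subspace_def E_0 E_add E_sc)
    moreover have "tact g s \<in> {s \<in> S. E s \<in> N}" if "g \<in> GL" "s \<in> {s \<in> S. E s \<in> N}" for g s
      using that act N'(3)[of g "E s"] by (simp add: U_act)
    ultimately show "tp_sub I d {s \<in> S. E s \<in> N}"
      using S by (auto simp: tp_sub_def)
  qed
  obtain len :: "(('i \<times> nat list) \<Rightarrow>\<^sub>0 'k) set \<Rightarrow> nat" where len:
    "\<And>N N'. tp_sub I d N \<Longrightarrow> tp_sub I d N' \<Longrightarrow> N \<subset> N' \<Longrightarrow> len N < len N'"
    using tp_sub_length[OF I, of d, where 'k='k] by blast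
  have fl: "finite_length U"
  proof (rule strict_composition_series[where len = "\<lambda>N. len {s \<in> S. E s \<in> N}"])
    fix N N' assume N: "gl_submodule N U" "gl_submodule N' U" "N \<subset> N'"
    have "{s \<in> S. E s \<in> N} \<subseteq> {s \<in> S. E s \<in> N'}" using N(3) by blast
    moreover have "{s \<in> S. E s \<in> N} \<noteq> {s \<in> S. E s \<in> N'}" using pull(2)[OF N(1)] pull(2)[OF N(2)] N(3) by (metis psubsetE subset_refl)
    ultimately show "len {s \<in> S. E s \<in> N} < len {s \<in> S. E s \<in> N'}"
      using pull(1)[OF N(1)] pull(1)[OF N(2)] by (intro len) auto
  next
    show "gl_submodule (carrier U) U"
      unfolding gs using subE[OF sub] gl by (auto simp: U is_gl_module_def)
    show "gl_submodule {ring.zero U} U"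
      unfolding gs using E_0 pm.subspace_0[OF sub] U_act[OF pm.subspace_0[OF sub]]
      by (auto simp: U image_iff intro!: bexI[of _ 0])
  qed (use gs U in auto)
  have "{s \<in> S. E s = ring.zero U} = {0}" using E_eq0 E_0 pm.subspace_0[OF sub] by (auto simp: U)
  with gl fl hom U(1) show ?thesis by blast
qed

section \<open>Covering \<open>D \<otimes> U\<close> by a submodule of a free module\<close>

abbreviation free_span :: "('b \<Rightarrow>\<^sub>0 'k::field) set \<Rightarrow> ('b \<Rightarrow>\<^sub>0 'k divpow) set" where
  "free_span S \<equiv> F.span (iota ` S)"

lemma free_span_gact:
  assumes S: "\<And>s. s \<in> S \<Longrightarrow> tact g s \<in> S" and y: "y \<in> free_span S"
  shows "gact g y \<in> free_span S"
  using y
proof (induction rule: F.span_induct_alt)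
  case (step a x y)
  then obtain s where s: "x = iota s" "s \<in> S" by blast
  have "fscale (dp_act g a) (iota (tact g s)) + gact g y \<in> free_span S"
    using S[OF s(2)] step by (intro F.span_add[OF F.span_scale[OF F.span_base]]) auto
  then show ?case by (simp add: s(1) gact_add gact_fscale gact_iota)
qed (simp add: F.span_zero)

text \<open>\<open>div_tensor\<close> lets an element act on a coset by mapping it pointwise and
  then adding \<open>R\<close>, because the image of \<open>R\<close> may be smaller than
  \<open>R\<close>. This computes such an action on a representative.\<close>

lemma image_coset_plus:
  fixes R :: "'a::ab_group_add set"
  assumes "\<And>x y. h (x + y) = h x + h y" "h ` R \<subseteq> R" "\<And>x y. x \<in> R \<Longrightarrow> y \<in> R \<Longrightarrow> x + y \<in> R" "0 \<in> R"
  shows "h ` (z +o R) + R = h z +o R"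
proof
  show "h ` (z +o R) + R \<subseteq> h z +o R"
  proof
    fix w assume "w \<in> h ` (z +o R) + R"
    then obtain r r' where "w = h (z + r) + r'" "r \<in> R" "r' \<in> R"
      by (auto simp: set_plus_def elt_set_plus_def)
    then have "w = h z + (h r + r')" "h r + r' \<in> R" using assms(1-3) by (auto simp: add.assoc)
    then show "w \<in> h z +o R" by (simp add: set_plus_intro2)
  qed
  show "h z +o R \<subseteq> h ` (z +o R) + R"
  proof
    fix w assume "w \<in> h z +o R"
    then obtain r where r: "w = h z + r" "r \<in> R" by (auto simp: elt_set_plus_def)
    have "z + 0 \<in> z +o R" using assms(4) by (rule set_plus_intro2)
    then have "h z \<in> h ` (z +o R)" by simp
    then show "w \<in> h ` (z +o R) + R" unfolding r(1) using r(2) by (rule set_plus_intro)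
  qed
qed

lemma coset_eq_iff:
  fixes R :: "('b \<Rightarrow>\<^sub>0 'k::field) set"
  assumes "pm.subspace R"
  shows "z +o R = z' +o R \<longleftrightarrow> z - z' \<in> R"
proof
  assume "z +o R = z' +o R"
  then have "z \<in> z' +o R" using set_plus_intro2[OF pm.subspace_0[OF assms], of z] by simp
  then show "z - z' \<in> R" by (auto simp: elt_set_plus_def)
next
  assume *: "z - z' \<in> R"
  have "z + r = z' + (z - z' + r)" "z' + r = z + (r - (z - z'))" for r by simp_all
  then show "z +o R = z' +o R"
    unfolding elt_set_plus_def using pm.subspace_add[OF assms *] pm.subspace_diff[OF assms _ *] by blast
qed

lemma lin_extend_diff: "lin_extend h (x - y) = lin_extend h x - lin_extend h y"
  using lin_extend_add[of h "x - y" y] by simp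

text \<open>The purpose is to identify \<open>D \<otimes> U\<close> with the quotient of
  \<open>D \<otimes> S\<close> by \<open>D \<otimes> ker\<close>, where elements have coordinates in
  a free module.\<close>

locale tp_cover =
  fixes I :: "'i set" and d S and U :: "('k::field, 'k, 'u) gl_module" and f
  assumes S: "tp_sub I d S" and gl: "is_gl_module (\<lambda>g c. c) U"
    and hom: "f \<in> gl_hom ((tensor_powers I d)\<lparr>carrier := S\<rparr>) U" and surj: "f ` S = carrier U"
begin

lemma subspace_S: "pm.subspace S"
  using S by (simp add: tp_sub_def)

lemma tact_S: "g \<in> GL \<Longrightarrow> s \<in> S \<Longrightarrow> tact g s \<in> S"
  using S by (simp add: tp_sub_def)

lemma f_carrier: "s \<in> S \<Longrightarrow> f s \<in> carrier U"
  and f_add: "s \<in> S \<Longrightarrow> t \<in> S \<Longrightarrow> f (s + t) = f s \<oplus>\<^bsub>U\<^esub> f t"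
  and f_scale: "s \<in> S \<Longrightarrow> f (pm_scale c s) = c \<odot>\<^bsub>U\<^esub> f s"
  and f_act: "g \<in> GL \<Longrightarrow> s \<in> S \<Longrightarrow> f (tact g s) = gl_act U g (f s)"
  using hom by (auto simp: gl_hom_def tensor_powers_simps gl_act_tensor_powers)

sublocale U: Module.module ring_of_type_algebra U
  using gl by (simp add: is_gl_module_def)

lemma U_act: "g \<in> GL \<Longrightarrow> u \<in> carrier U \<Longrightarrow> gl_act U g u \<in> carrier U"
  and U_act_add: "g \<in> GL \<Longrightarrow> u \<in> carrier U \<Longrightarrow> v \<in> carrier U \<Longrightarrow>
    gl_act U g (u \<oplus>\<^bsub>U\<^esub> v) = gl_act U g u \<oplus>\<^bsub>U\<^esub> gl_act U g v"
  and U_act_scale: "g \<in> GL \<Longrightarrow> u \<in> carrier U \<Longrightarrow> gl_act U g (c \<odot>\<^bsub>U\<^esub> u) = c \<odot>\<^bsub>U\<^esub> gl_act U g u"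
  using gl by (auto simp: is_gl_module_def)

lemma U_scale: "u \<in> carrier U \<Longrightarrow> c \<odot>\<^bsub>U\<^esub> u \<in> carrier U"
  using U.smult_closed by simp

lemma f_0: "f 0 = \<zero>\<^bsub>U\<^esub>"
  using f_scale[OF pm.subspace_0[OF subspace_S], of 0] U.smult_l_null[OF f_carrier[OF pm.subspace_0[OF subspace_S]]]
  by simp

definition ker where "ker = {s \<in> S. f s = \<zero>\<^bsub>U\<^esub>}"

lemma subspace_ker: "pm.subspace ker"
  using subspace_S f_carrier U.smult_r_null
  by (auto simp: pm.subspace_def ker_def f_0 f_add f_scale)

lemma f_eq_iff: "s \<in> S \<Longrightarrow> t \<in> S \<Longrightarrow> f s = f t \<longleftrightarrow> s - t \<in> ker"
proof -
  assume s: "s \<in> S" "t \<in> S"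
  then have st: "s - t \<in> S" by (rule pm.subspace_diff[OF subspace_S])
  have "f s = f (s - t) \<oplus>\<^bsub>U\<^esub> f t" using f_add[OF st s(2)] by simp
  then show ?thesis
    using st s f_carrier U.add.r_cancel_one[of "f t" "f (s - t)"] by (auto simp: ker_def)
qed

lemma tact_ker: "g \<in> GL \<Longrightarrow> s \<in> ker \<Longrightarrow> tact g s \<in> ker"
proof -
  assume g: "g \<in> GL" and s: "s \<in> ker"
  have z: "\<zero>\<^bsub>U\<^esub> \<in> carrier U" by simp
  have "gl_act U g (0 \<odot>\<^bsub>U\<^esub> \<zero>\<^bsub>U\<^esub>) = 0 \<odot>\<^bsub>U\<^esub> gl_act U g \<zero>\<^bsub>U\<^esub>" by (rule U_act_scale[OF g z])
  then have "gl_act U g \<zero>\<^bsub>U\<^esub> = \<zero>\<^bsub>U\<^esub>"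
    using U.smult_l_null[OF z] U.smult_l_null[OF U_act[OF g z]] by simp
  then show ?thesis using g s by (simp add: ker_def f_act tact_S)
qed

definition sec where "sec u = (SOME s. s \<in> S \<and> f s = u)"

lemma sec: "u \<in> carrier U \<Longrightarrow> sec u \<in> S" "u \<in> carrier U \<Longrightarrow> f (sec u) = u"
proof -
  assume "u \<in> carrier U"
  then have "u \<in> f ` S" by (simp only: surj)
  then obtain s where "s \<in> S \<and> f s = u" by blast
  then have "sec u \<in> S \<and> f (sec u) = u" unfolding sec_def by (rule someI)
  then show "sec u \<in> S" "f (sec u) = u" by iprover+
qed

text \<open>Lifts a formal tensor to \<open>D \<otimes> S\<close> by means of the chosen section.
  The section need not be linear or equivariant, so relations are respected only modulo
  \<open>free_span ker\<close>.\<close>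

definition kap :: "(('k divpow \<times> 'u) \<Rightarrow>\<^sub>0 'k) \<Rightarrow> (('i \<times> nat list) \<Rightarrow>\<^sub>0 'k divpow)" where
  "kap z = (\<Sum>p\<in>keys z. fscale (dp_const (lookup z p) * fst p) (iota (sec (snd p))))"

lemma kap_superset:
  assumes "finite T" "keys z \<subseteq> T"
  shows "kap z = (\<Sum>p\<in>T. fscale (dp_const (lookup z p) * fst p) (iota (sec (snd p))))"
  unfolding kap_def
  by (rule sum.mono_neutral_left) (use assms in \<open>auto simp: in_keys_iff dp_const.hom_0\<close>)

lemma kap_add: "kap (x + y) = kap x + kap y"
proof -
  let ?S = "keys x \<union> keys y"
  have "finite ?S" by simp
  then show ?thesis
    using keys_add[of x y]
    by (simp add: kap_superset[of ?S] lookup_add dp_const.hom_add distrib_right F.scale_left_distrib sum.distrib)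
qed

lemma kap_scale: "kap (pm_scale c x) = fscale (dp_const c) (kap x)"
proof -
  have "keys (pm_scale c x) \<subseteq> keys x" by (auto simp: in_keys_iff)
  then show ?thesis
    by (simp add: kap_superset[of "keys x"] F.scale_sum_right dp_const.hom_mult mult.assoc)
qed

lemma kap_0: "kap 0 = 0"
  by (simp add: kap_def)

lemma kap_diff: "kap (x - y) = kap x - kap y"
  using kap_add[of "x - y" y] by simp

lemma kap_basis: "kap (basis_elt (a, u)) = fscale a (iota (sec u))"
  by (simp add: kap_def dp_const.hom_1)

lemma kap_sum: "kap (sum h A) = (\<Sum>x\<in>A. kap (h x))"
  by (induction A rule: infinite_finite_induct) (auto simp: kap_0 kap_add)

abbreviation R where "R \<equiv> tensor_rels U"

lemma subspace_R: "pm.subspace R"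
  unfolding tensor_rels_def by (rule pm.subspace_span)

lemma R_add1: "u \<in> carrier U \<Longrightarrow> basis_elt (a + b, u) - basis_elt (a, u) - basis_elt (b, u) \<in> R"
  and R_add2: "u \<in> carrier U \<Longrightarrow> v \<in> carrier U \<Longrightarrow>
    basis_elt (a, u \<oplus>\<^bsub>U\<^esub> v) - basis_elt (a, u) - basis_elt (a, v) \<in> R"
  and R_scale1: "u \<in> carrier U \<Longrightarrow> basis_elt (dp_const c * a, u) - pm_scale c (basis_elt (a, u)) \<in> R"
  and R_scale2: "u \<in> carrier U \<Longrightarrow> basis_elt (a, c \<odot>\<^bsub>U\<^esub> u) - pm_scale c (basis_elt (a, u)) \<in> R"
  unfolding tensor_rels_def by (rule pm.span_base; blast)+

lemma R_induct [consumes 1, case_names zero step add1 add2 scale1 scale2]: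
  assumes "z \<in> R" and zero: "P 0"
    and step: "\<And>c x y. P x \<Longrightarrow> P y \<Longrightarrow> P (pm_scale c x + y)"
    and "\<And>a b u. u \<in> carrier U \<Longrightarrow> P (basis_elt (a + b, u) - basis_elt (a, u) - basis_elt (b, u))"
    and "\<And>a u v. u \<in> carrier U \<Longrightarrow> v \<in> carrier U \<Longrightarrow> P (basis_elt (a, u \<oplus>\<^bsub>U\<^esub> v) - basis_elt (a, u) - basis_elt (a, v))"
    and "\<And>c a u. u \<in> carrier U \<Longrightarrow> P (basis_elt (dp_const c * a, u) - pm_scale c (basis_elt (a, u)))"
    and "\<And>c a u. u \<in> carrier U \<Longrightarrow> P (basis_elt (a, c \<odot>\<^bsub>U\<^esub> u) - pm_scale c (basis_elt (a, u)))"
  shows "P z"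
  using assms(1) unfolding tensor_rels_def
proof (induction rule: pm.span_induct_alt)
  case base
  show ?case by (rule zero)
next
  case (step c x y)
  from step(1) have "P x"
    by (elim UnE CollectE exE conjE; simp only: assms(4) assms(5) assms(6) assms(7))
  then show ?case using step(2) by (rule assms(3))
qed

lemma kap_R: "z \<in> R \<Longrightarrow> kap z \<in> free_span ker"
proof (induction rule: R_induct)
  case (step c x y)
  then show ?case by (simp add: kap_add kap_scale F.span_add F.span_scale)
next
  case (add1 a b u)
  have "kap (basis_elt (a + b, u) - basis_elt (a, u) - basis_elt (b, u)) = 0"
    by (simp add: kap_diff kap_basis F.scale_left_distrib)
  then show ?case by (simp add: F.span_zero)
next
  case (add2 a u v)
  let ?s = "sec (u \<oplus>\<^bsub>U\<^esub> v) - (sec u + sec v)"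
  have "?s \<in> ker"
    using add2 sec f_add pm.subspace_add[OF subspace_S] by (subst f_eq_iff[symmetric]) auto
  moreover have "kap (basis_elt (a, u \<oplus>\<^bsub>U\<^esub> v) - basis_elt (a, u) - basis_elt (a, v)) = fscale a (iota ?s)"
    by (simp add: kap_diff kap_basis iota_diff iota_add F.scale_right_diff_distrib F.scale_right_distrib)
  ultimately show ?case by (simp add: F.span_scale F.span_base)
next
  case (scale1 c a u)
  have "kap (basis_elt (dp_const c * a, u) - pm_scale c (basis_elt (a, u))) = 0"
    by (simp only: kap_diff kap_basis kap_scale F.scale_scale diff_self)
  then show ?case by (simp add: F.span_zero)
next
  case (scale2 c a u)
  let ?s = "sec (c \<odot>\<^bsub>U\<^esub> u) - pm_scale c (sec u)"
  have "?s \<in> ker"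
    using scale2 sec f_scale U_scale pm.subspace_scale[OF subspace_S] by (subst f_eq_iff[symmetric]) auto
  moreover have "kap (basis_elt (a, c \<odot>\<^bsub>U\<^esub> u) - pm_scale c (basis_elt (a, u))) = fscale a (iota ?s)"
    by (simp add: kap_diff kap_basis kap_scale iota_diff iota_scale F.scale_right_diff_distrib mult.commute)
  ultimately show ?case by (simp add: F.span_scale F.span_base)
qed (simp add: kap_0 F.span_zero)

definition ok where "ok z \<longleftrightarrow> keys z \<subseteq> UNIV \<times> carrier U"

lemma ok_add: "ok x \<Longrightarrow> ok y \<Longrightarrow> ok (x + y)"
  using keys_add[of x y] by (auto simp: ok_def)

lemma ok_scale: "ok x \<Longrightarrow> ok (pm_scale c x)"
  by (auto simp: ok_def in_keys_iff)

lemma ok_diff: "ok x \<Longrightarrow> ok y \<Longrightarrow> ok (x - y)"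
  using keys_diff[of x y] by (auto simp: ok_def)

lemma ok_basis: "u \<in> carrier U \<Longrightarrow> ok (basis_elt (a, u))"
  by (simp add: ok_def)

lemma ok_0: "ok 0"
  by (simp add: ok_def)

lemma ok_sum: "(\<And>x. x \<in> A \<Longrightarrow> ok (h x)) \<Longrightarrow> ok (sum h A)"
  by (induction A rule: infinite_finite_induct) (auto intro: ok_add ok_0)

lemma ok_induct [consumes 1, case_names zero add basis]:
  assumes "ok z" and zero: "P 0"
    and add: "\<And>x y. ok x \<Longrightarrow> ok y \<Longrightarrow> P x \<Longrightarrow> P y \<Longrightarrow> P (x + y)"
    and basis: "\<And>c a u. u \<in> carrier U \<Longrightarrow> P (pm_scale c (basis_elt (a, u)))"
  shows "P z"
proof -
  have "ok (\<Sum>p\<in>T. pm_scale (lookup z p) (basis_elt p)) \<and>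
      P (\<Sum>p\<in>T. pm_scale (lookup z p) (basis_elt p))"
    if "finite T" "T \<subseteq> keys z" for T
    using that
  proof (induction T rule: finite_induct)
    case (insert p T)
    then have "snd p \<in> carrier U" using assms(1) by (auto simp: ok_def)
    then show ?case
      using insert by (cases p) (auto intro!: add basis ok_add ok_scale ok_basis)
  qed (auto simp: zero ok_0)
  from this[OF finite_keys order_refl] show ?thesis by (simp flip: pm_expand)
qed

lemma kap_in: "ok z \<Longrightarrow> kap z \<in> free_span S"
proof (induction rule: ok_induct)
  case (basis c a u)
  then show ?case by (simp add: kap_scale kap_basis sec F.span_scale F.span_base del: F.scale_scale)
qed (auto simp: kap_0 kap_add F.span_zero F.span_add)

definition nf :: "nat multiset set \<Rightarrow> _ \<Rightarrow> (('k divpow \<times> 'u) \<Rightarrow>\<^sub>0 'k)" where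
  "nf \<A> y = (\<Sum>A\<in>\<A>. basis_elt (dp_mono A, f (slice A y)))"

text \<open>Modulo the relations, \<open>z\<close> equals the normal form with one simple tensor per
  monomial, read off from the slices of \<open>y\<close>. It replaces a basis of \<open>U\<close> in
  the proof that \<open>kap\<close> loses nothing.\<close>

definition represents where
  "represents z y \<longleftrightarrow> (\<exists>\<A>. finite \<A> \<and> (\<forall>A. A \<notin> \<A> \<longrightarrow> slice A y = 0) \<and> z - nf \<A> y \<in> R)"

lemma R_zero: "basis_elt (a, \<zero>\<^bsub>U\<^esub>) \<in> R"
  using R_scale2[of "\<zero>\<^bsub>U\<^esub>" a 0] U.smult_l_null[of "\<zero>\<^bsub>U\<^esub>"] by simp

lemma nf_superset:
  assumes "finite \<A>'" "\<A> \<subseteq> \<A>'" "\<forall>A. A \<notin> \<A> \<longrightarrow> slice A y = 0"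
  shows "nf \<A>' y - nf \<A> y \<in> R"
proof -
  have "nf \<A>' y - nf \<A> y = (\<Sum>A\<in>\<A>' - \<A>. basis_elt (dp_mono A, f (slice A y)))"
    unfolding nf_def using assms(1,2) by (simp add: sum_diff)
  also have "\<dots> \<in> R"
    by (rule pm.subspace_sum[OF subspace_R]) (use assms(3) in \<open>simp add: f_0 R_zero\<close>)
  finally show ?thesis .
qed

lemma represents_add:
  assumes "represents z y" "represents z' y'" "y \<in> free_span S" "y' \<in> free_span S"
  shows "represents (z + z') (y + y')"
proof -
  obtain \<A> where A: "finite \<A>" "\<forall>A. A \<notin> \<A> \<longrightarrow> slice A y = 0" "z - nf \<A> y \<in> R"
    using assms(1) by (auto simp: represents_def)
  obtain \<A>' where A': "finite \<A>'" "\<forall>A. A \<notin> \<A>' \<longrightarrow> slice A y' = 0" "z' - nf \<A>' y' \<in> R"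
    using assms(2) by (auto simp: represents_def)
  let ?A = "\<A> \<union> \<A>'"
  have fin: "finite ?A" using A A' by simp
  have "(\<Sum>A\<in>?A. basis_elt (dp_mono A, f (slice A y + slice A y')) - basis_elt (dp_mono A, f (slice A y)) -
      basis_elt (dp_mono A, f (slice A y'))) \<in> R"
    using assms(3,4) slice_span[OF subspace_S]
    by (intro pm.subspace_sum[OF subspace_R]) (auto simp: f_add f_carrier R_add2)
  then have 1: "nf ?A (y + y') - nf ?A y - nf ?A y' \<in> R"
    by (simp add: nf_def slice_add sum_subtractf)
  have 2: "nf ?A y - nf \<A> y \<in> R" "nf ?A y' - nf \<A>' y' \<in> R"
    using nf_superset[OF fin] A(2) A'(2) by auto
  have "z + z' - nf ?A (y + y') =
      (z - nf \<A> y) + (z' - nf \<A>' y') - (nf ?A y - nf \<A> y) - (nf ?A y' - nf \<A>' y') -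
      (nf ?A (y + y') - nf ?A y - nf ?A y')" by (simp add: algebra_simps)
  also have "\<dots> \<in> R"
    by (intro pm.subspace_diff[OF subspace_R] pm.subspace_add[OF subspace_R] A(3) A'(3) 1 2)
  finally show ?thesis
    unfolding represents_def using fin A(2) A'(2) by (intro exI[of _ ?A]) (auto simp: slice_add)
qed

lemma R_sum1:
  assumes "u \<in> carrier U"
  shows "basis_elt (sum h A, u) - (\<Sum>x\<in>A. basis_elt (h x, u)) \<in> R"
proof (induction A rule: infinite_finite_induct)
  case (insert x A)
  have "basis_elt (sum h (insert x A), u) - (\<Sum>x\<in>insert x A. basis_elt (h x, u)) =
     (basis_elt (h x + sum h A, u) - basis_elt (h x, u) - basis_elt (sum h A, u)) +
     (basis_elt (sum h A, u) - (\<Sum>x\<in>A. basis_elt (h x, u)))"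
    using insert.hyps by simp
  also have "\<dots> \<in> R" by (rule pm.subspace_add[OF subspace_R R_add1[OF assms] insert.IH])
  finally show ?case .
qed (use R_scale1[OF assms, of 0 0] in \<open>simp_all add: dp_const.hom_0\<close>)

lemma represents_basis:
  assumes u: "u \<in> carrier U"
  shows "represents (pm_scale c (basis_elt (a, u))) (fscale (dp_const c * a) (iota (sec u)))"
proof -
  let ?a = "dp_const c * a"
  let ?A = "{A. dp_coef ?a A \<noteq> 0}"
  let ?b = "\<lambda>A. basis_elt (dp_mono A, u) :: ('k divpow \<times> 'u) \<Rightarrow>\<^sub>0 'k"
  have sl: "slice A (fscale ?a (iota (sec u))) = pm_scale (dp_coef ?a A) (sec u)" for A
    by (rule slice_fscale_iota)
  have nf: "nf ?A (fscale ?a (iota (sec u))) = (\<Sum>A\<in>?A. basis_elt (dp_mono A, dp_coef ?a A \<odot>\<^bsub>U\<^esub> u))"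
    unfolding nf_def sl by (intro sum.cong refl) (simp add: f_scale sec[OF u])
  have 1: "(\<Sum>A\<in>?A. basis_elt (dp_mono A, dp_coef ?a A \<odot>\<^bsub>U\<^esub> u) - pm_scale (dp_coef ?a A) (?b A)) \<in> R"
    by (intro pm.subspace_sum[OF subspace_R] R_scale2 u)
  have 2: "(\<Sum>A\<in>?A. basis_elt (dp_const (dp_coef ?a A) * dp_mono A, u) - pm_scale (dp_coef ?a A) (?b A)) \<in> R"
    by (intro pm.subspace_sum[OF subspace_R] R_scale1 u)
  have 3: "basis_elt (?a, u) - (\<Sum>A\<in>?A. basis_elt (dp_const (dp_coef ?a A) * dp_mono A, u)) \<in> R"
    using R_sum1[OF u, of "\<lambda>A. dp_const (dp_coef ?a A) * dp_mono A" ?A] by (simp flip: dp_expand)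
  have 4: "basis_elt (?a, u) - pm_scale c (basis_elt (a, u)) \<in> R" by (rule R_scale1[OF u])
  have "pm_scale c (basis_elt (a, u)) - nf ?A (fscale ?a (iota (sec u))) =
    (basis_elt (?a, u) - (\<Sum>A\<in>?A. basis_elt (dp_const (dp_coef ?a A) * dp_mono A, u))) -
    (basis_elt (?a, u) - pm_scale c (basis_elt (a, u))) +
    (\<Sum>A\<in>?A. basis_elt (dp_const (dp_coef ?a A) * dp_mono A, u) - pm_scale (dp_coef ?a A) (?b A)) -
    (\<Sum>A\<in>?A. basis_elt (dp_mono A, dp_coef ?a A \<odot>\<^bsub>U\<^esub> u) - pm_scale (dp_coef ?a A) (?b A))"
    unfolding nf sum_subtractf by (simp add: algebra_simps)
  also have "\<dots> \<in> R"
    by (intro pm.subspace_diff[OF subspace_R] pm.subspace_add[OF subspace_R] 1 2 3 4)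
  finally show ?thesis
    unfolding represents_def by (intro exI[of _ ?A]) (simp add: finite_dp_coef sl)
qed

lemma represents_kap: "ok z \<Longrightarrow> represents z (kap z)"
proof (induction rule: ok_induct)
  case zero
  show ?case unfolding represents_def
    by (intro exI[of _ "{}"]) (simp add: kap_0 nf_def pm.subspace_0[OF subspace_R])
next
  case (add x y)
  then show ?case unfolding kap_add by (intro represents_add kap_in)
next
  case (basis c a u)
  from represents_basis[OF this] show ?case by (simp add: kap_scale kap_basis)
qed

text \<open>If all slices of \<open>kap z\<close> lie in \<open>ker\<close>, each simple tensor of
  the normal form of \<open>z\<close> has second entry zero and hence is a relation.\<close>

lemma kap_ker_iff: "ok z \<Longrightarrow> kap z \<in> free_span ker \<longleftrightarrow> z \<in> R"
proof
  assume "ok z" and ker: "kap z \<in> free_span ker"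
  obtain \<A> where A: "z - nf \<A> (kap z) \<in> R"
    using represents_kap[OF \<open>ok z\<close>] by (auto simp: represents_def)
  have "nf \<A> (kap z) \<in> R"
    unfolding nf_def
  proof (rule pm.subspace_sum[OF subspace_R])
    fix A
    have "slice A (kap z) \<in> ker" using ker slice_span[OF subspace_ker] by blast
    then show "basis_elt (dp_mono A, f (slice A (kap z))) \<in> R" by (simp add: ker_def R_zero)
  qed
  from pm.subspace_add[OF subspace_R A this] show "z \<in> R" by simp
qed (rule kap_R)

lemma kap_surj:
  assumes "y \<in> free_span S"
  shows "\<exists>z. ok z \<and> kap z - y \<in> free_span ker"
proof -
  obtain \<A> where A: "finite \<A>" "y = (\<Sum>A\<in>\<A>. fscale (dp_mono A) (iota (slice A y)))"
    using slice_expand[of y] by blast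
  have sl: "slice A y \<in> S" for A using assms slice_span[OF subspace_S] by blast
  have "kap (nf \<A> y) - y = (\<Sum>A\<in>\<A>. fscale (dp_mono A) (iota (sec (f (slice A y)) - slice A y)))"
    by (subst (2) A(2)) (simp add: nf_def kap_sum kap_basis iota_diff F.scale_right_diff_distrib sum_subtractf)
  also have "\<dots> \<in> free_span ker"
  proof (intro F.span_sum F.span_scale F.span_base imageI)
    fix A
    show "sec (f (slice A y)) - slice A y \<in> ker"
      using sl[of A] by (subst f_eq_iff[symmetric]) (auto simp: sec f_carrier)
  qed
  finally have "kap (nf \<A> y) - y \<in> free_span ker" .
  moreover have "ok (nf \<A> y)"
    unfolding nf_def by (intro ok_sum ok_basis f_carrier sl)
  ultimately show ?thesis by blast
qed

text \<open>The canonical map from \<open>D \<otimes> S\<close> to \<open>D \<otimes> U\<close>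
  induced by \<open>f\<close>, defined backwards: the coset of any formal tensor whose lift agrees
  with \<open>y\<close> modulo \<open>free_span ker\<close>.\<close>

definition tau where "tau y = (SOME z. ok z \<and> kap z - y \<in> free_span ker) +o R"

lemma tau_eqI: "ok z \<Longrightarrow> kap z - y \<in> free_span ker \<Longrightarrow> tau y = z +o R"
proof -
  assume z: "ok z" "kap z - y \<in> free_span ker"
  define w where "w = (SOME z. ok z \<and> kap z - y \<in> free_span ker)"
  have w: "ok w \<and> kap w - y \<in> free_span ker" unfolding w_def by (rule someI[of _ z]) (use z in simp)
  have "kap (w - z) = (kap w - y) - (kap z - y)" by (simp add: kap_diff)
  also have "\<dots> \<in> free_span ker" by (rule F.span_diff[OF conjunct2[OF w] z(2)])
  finally have "w - z \<in> R" using w z kap_ker_iff ok_diff by blast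
  then show ?thesis unfolding tau_def w_def[symmetric] by (simp add: coset_eq_iff[OF subspace_R])
qed

lemma tau_obtain:
  assumes "y \<in> free_span S"
  obtains z where "ok z" "kap z - y \<in> free_span ker" "tau y = z +o R"
  using kap_surj[OF assms] tau_eqI by blast

lemma carrier_div_tensor: "carrier (div_tensor U) = {z +o R |z. ok z}"
  by (simp add: div_tensor_def ok_def)

lemma tau_eq_iff:
  assumes "x \<in> free_span S" "y \<in> free_span S"
  shows "tau x = tau y \<longleftrightarrow> x - y \<in> free_span ker"
proof -
  obtain z where z: "ok z" "kap z - x \<in> free_span ker" "tau x = z +o R" by (rule tau_obtain[OF assms(1)])
  obtain w where w: "ok w" "kap w - y \<in> free_span ker" "tau y = w +o R" by (rule tau_obtain[OF assms(2)])
  have "tau x = tau y \<longleftrightarrow> kap (z - w) \<in> free_span ker"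
    unfolding z(3) w(3) coset_eq_iff[OF subspace_R] using kap_ker_iff[OF ok_diff[OF z(1) w(1)]] by simp
  also have "\<dots> \<longleftrightarrow> x - y \<in> free_span ker"
  proof
    assume "kap (z - w) \<in> free_span ker"
    from F.span_add[OF F.span_diff[OF this z(2)] w(2)]
    have "kap (z - w) - (kap z - x) + (kap w - y) \<in> free_span ker" .
    then show "x - y \<in> free_span ker" by (simp add: kap_diff algebra_simps)
  next
    assume "x - y \<in> free_span ker"
    from F.span_diff[OF F.span_add[OF this z(2)] w(2)]
    have "x - y + (kap z - x) - (kap w - y) \<in> free_span ker" .
    then show "kap (z - w) \<in> free_span ker" by (simp add: kap_diff algebra_simps)
  qed
  finally show ?thesis .
qed

lemma tau_image: "tau ` free_span S = carrier (div_tensor U)"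
proof (intro equalityI subsetI)
  fix Z assume "Z \<in> tau ` free_span S"
  then obtain y where y: "y \<in> free_span S" "Z = tau y" by (rule imageE)
  obtain z where "ok z" "tau y = z +o R" by (rule tau_obtain[OF y(1)])
  then show "Z \<in> carrier (div_tensor U)" unfolding carrier_div_tensor y(2) by fast
next
  fix Z assume "Z \<in> carrier (div_tensor U)"
  then obtain z where z: "ok z" "Z = z +o R" unfolding carrier_div_tensor by fast
  have "tau (kap z) = Z" using tau_eqI[OF z(1), of "kap z"] by (simp add: F.span_zero z(2))
  with kap_in[OF z(1)] show "Z \<in> tau ` free_span S" by (metis imageI)
qed

lemma tau_add:
  assumes "x \<in> free_span S" "y \<in> free_span S"
  shows "tau (x + y) = tau x \<oplus>\<^bsub>div_tensor U\<^esub> tau y"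
proof -
  obtain z where z: "ok z" "kap z - x \<in> free_span ker" "tau x = z +o R" by (rule tau_obtain[OF assms(1)])
  obtain w where w: "ok w" "kap w - y \<in> free_span ker" "tau y = w +o R" by (rule tau_obtain[OF assms(2)])
  have "kap (z + w) - (x + y) = (kap z - x) + (kap w - y)" by (simp add: kap_add)
  also have "\<dots> \<in> free_span ker" using z w by (intro F.span_add)
  finally have "tau (x + y) = (z + w) +o R" using z w by (intro tau_eqI ok_add)
  moreover have "R + R = R"
  proof
    show "R + R \<subseteq> R" using pm.subspace_add[OF subspace_R] by (auto simp: set_plus_def)
    show "R \<subseteq> R + R" using set_plus_intro[OF pm.subspace_0[OF subspace_R]] by fastforce
  qed
  ultimately show ?thesis
    unfolding z(3) w(3) by (simp add: div_tensor_def set_plus_rearrange)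
qed

lemma tau_scale:
  assumes "x \<in> free_span S"
  shows "tau (fscale a x) = a \<odot>\<^bsub>div_tensor U\<^esub> tau x"
proof -
  let ?h = "lin_extend (\<lambda>(b, u). basis_elt (a * b, u)) :: (('k divpow \<times> 'u) \<Rightarrow>\<^sub>0 'k) \<Rightarrow> _"
  obtain z where z: "ok z" "kap z - x \<in> free_span ker" "tau x = z +o R" by (rule tau_obtain[OF assms])
  have h0: "?h 0 = 0" by (simp add: lin_extend_def)
  have hdiff: "?h (x - y) = ?h x - ?h y" for x y by (rule lin_extend_diff)
  have "?h r \<in> R" if "r \<in> R" for r
    using that
  proof (induction rule: R_induct)
    case (add1 b c u)
    show ?case using R_add1[OF add1, of "a * b" "a * c"] by (simp add: hdiff distrib_left)
  next
    case (scale1 c b u)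
    show ?case using R_scale1[OF scale1, of c "a * b"] by (simp add: hdiff lin_extend_scale mult.left_commute)
  qed (auto simp: h0 hdiff lin_extend_add lin_extend_scale R_add2 R_scale2
        intro!: pm.subspace_0[OF subspace_R] pm.subspace_add[OF subspace_R] pm.subspace_scale[OF subspace_R])
  then have "a \<odot>\<^bsub>div_tensor U\<^esub> tau x = ?h z +o R"
    unfolding z(3) div_tensor_def
    by (simp, intro image_coset_plus) (auto simp: lin_extend_add pm.subspace_add[OF subspace_R] pm.subspace_0[OF subspace_R])
  moreover have "ok (?h z) \<and> kap (?h z) = fscale a (kap z)" using z(1)
  proof (induction rule: ok_induct)
    case zero
    show ?case by (simp only: h0 ok_0 kap_0 F.scale_zero_right simp_thms)
  next
    case (add x y)
    then show ?case by (simp add: lin_extend_add kap_add F.scale_right_distrib ok_add)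
  next
    case (basis c b u)
    then show ?case
      by (simp add: lin_extend_scale kap_scale kap_basis ok_scale ok_basis mult.left_commute[of a])
  qed
  moreover have "fscale a (kap z) - fscale a x \<in> free_span ker"
    using F.span_scale[OF z(2), of a] by (simp add: F.scale_right_diff_distrib)
  ultimately show ?thesis using tau_eqI[of "?h z" "fscale a x"] by simp
qed

lemma tau_gact:
  assumes "x \<in> free_span S" and g: "g \<in> GL"
  shows "tau (gact g x) = gl_act (div_tensor U) g (tau x)"
proof -
  let ?h = "lin_extend (\<lambda>(b, u). basis_elt (dp_act g b, gl_act U g u)) :: (('k divpow \<times> 'u) \<Rightarrow>\<^sub>0 'k) \<Rightarrow> _"
  obtain z where z: "ok z" "kap z - x \<in> free_span ker" "tau x = z +o R" by (rule tau_obtain[OF assms(1)])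
  have h0: "?h 0 = 0" by (simp add: lin_extend_def)
  have hdiff: "?h (x - y) = ?h x - ?h y" for x y by (rule lin_extend_diff)
  have "?h r \<in> R" if "r \<in> R" for r
    using that
    by (induction rule: R_induct)
       (auto simp: h0 hdiff lin_extend_add lin_extend_scale R_add1 R_add2 R_scale1 R_scale2 dp_act_add dp_act_mult
          dp_act_const U_act[OF g] U_act_add[OF g] U_act_scale[OF g]
        intro!: pm.subspace_0[OF subspace_R] pm.subspace_add[OF subspace_R] pm.subspace_scale[OF subspace_R])
  then have "gl_act (div_tensor U) g (tau x) = ?h z +o R"
    unfolding z(3) div_tensor_def
    by (simp, intro image_coset_plus) (auto simp: lin_extend_add pm.subspace_add[OF subspace_R] pm.subspace_0[OF subspace_R])
  moreover have "ok (?h z) \<and> kap (?h z) - gact g (kap z) \<in> free_span ker" using z(1)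
  proof (induction rule: ok_induct)
    case zero
    show ?case by (simp add: h0 ok_0 kap_0 F.span_zero)
  next
    case (add x y)
    have "kap (?h (x + y)) - gact g (kap (x + y)) = (kap (?h x) - gact g (kap x)) + (kap (?h y) - gact g (kap y))"
      by (simp add: lin_extend_add kap_add gact_add)
    then show ?case using add by (auto simp: lin_extend_add intro: ok_add F.span_add)
  next
    case (basis c a u)
    let ?s = "sec (gl_act U g u) - tact g (sec u)"
    have "?s \<in> ker"
      using basis g sec[OF basis] sec[OF U_act[OF g basis]] by (subst f_eq_iff[symmetric]) (auto simp: tact_S f_act)
    moreover have "kap (?h (pm_scale c (basis_elt (a, u)))) - gact g (kap (pm_scale c (basis_elt (a, u)))) =
        fscale (dp_const c * dp_act g a) (iota ?s)"
      by (simp add: lin_extend_scale kap_scale kap_basis gact_fscale gact_iota dp_act_const dp_act_mult iota_diff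
          F.scale_right_diff_distrib)
    ultimately show ?case
      using U_act[OF g basis] by (simp add: lin_extend_scale ok_scale ok_basis F.span_scale F.span_base)
  qed
  moreover have "kap (?h z) - gact g x = (kap (?h z) - gact g (kap z)) + gact g (kap z - x)"
    using gact_add[of g "kap z - x" x] by (simp add: algebra_simps)
  moreover have "gact g (kap z - x) \<in> free_span ker"
    by (rule free_span_gact[OF tact_ker[OF g] z(2)])
  ultimately show ?thesis using tau_eqI[of "?h z" "gact g x"] by (simp only: F.span_add simp_thms)
qed

end

section \<open>Resolutions by representations\<close>

lemma keys_free_span:
  assumes S: "tp_sub I d S" and y: "y \<in> free_span S" and k: "(i, js) \<in> keys y"
  shows "i \<in> I \<and> length js = d i"
proof -
  have "lookup y (i, js) \<noteq> 0" using k by (simp add: in_keys_iff)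
  then obtain A where "dp_coef (lookup y (i, js)) A \<noteq> 0"
    using dp_coef_eqI[of "lookup y (i, js)" 0] by auto
  then have "(i, js) \<in> keys (slice A y)" by (simp add: in_keys_iff)
  moreover have "slice A y \<in> S" using S y slice_span[of S y] by (simp add: tp_sub_def)
  ultimately show ?thesis using S by (auto simp: tp_sub_def)
qed

text \<open>Only constants act as scalars here. The typical instance \<open>flow q\<close> is closed
  in this sense, but multiplication by \<open>D\<close> in general leaves it.\<close>

definition rep_closed :: "((('v \<times> nat) \<times> nat list) \<Rightarrow>\<^sub>0 'k::field divpow) set \<Rightarrow> bool" where
  "rep_closed P \<longleftrightarrow> 0 \<in> P \<and> (\<forall>x\<in>P. \<forall>y\<in>P. x + y \<in> P) \<and> (\<forall>c. \<forall>x\<in>P. fscale (dp_const c) x \<in> P) \<and>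
     (\<forall>g\<in>GL. \<forall>x\<in>P. gact g x \<in> P)"

lemma rep_closed_subspace:
  "F.subspace P \<Longrightarrow> (\<And>g x. g \<in> GL \<Longrightarrow> x \<in> P \<Longrightarrow> gact g x \<in> P) \<Longrightarrow> rep_closed P"
  by (auto simp: rep_closed_def F.subspace_def)

lemma tensor_resolution:
  fixes G :: "((('v \<times> nat) \<times> nat list) \<Rightarrow>\<^sub>0 'k::field divpow) set"
  assumes G: "finite G" and len: "\<forall>y\<in>G. \<forall>i js. (i, js) \<in> keys y \<longrightarrow> length js = d i"
  shows "\<exists>(I' :: ('v \<times> nat) set) d' S nab. finite I' \<and> tp_sub I' d' S \<and>
    (\<forall>x y. nab (x + y) = nab x + nab y) \<and> (\<forall>c x. nab (pm_scale c x) = fscale (dp_const c) (nab x)) \<and>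
    (\<forall>g\<in>GL. \<forall>s\<in>S. nab (tact g s) = gact g (nab s)) \<and> G \<subseteq> nab ` S \<and>
    (\<forall>P. rep_closed P \<longrightarrow> G \<subseteq> P \<longrightarrow> nab ` S \<subseteq> P)"
proof -
  obtain nab :: "((('v \<times> nat) \<times> nat list) \<Rightarrow>\<^sub>0 'k) \<Rightarrow> ((('v \<times> nat) \<times> nat list) \<Rightarrow>\<^sub>0 'k divpow)"
    where nab': "\<forall>x y. nab (x + y) = nab x + nab y"
      "\<forall>c x. nab (pm_scale c x) = fscale (dp_const c) (nab x)" "\<forall>y. nab (delta y) = y"
    using delta_left_inverse by (elim exE conjE) (rule that; assumption)
  note nab = nab'[rule_format]
  define I' where "I' = fst ` (\<Union>y\<in>G. keys (delta y))"
  \<comment> \<open>The summand with code of \<open>(n, e)\<close> has \<open>e\<close> slots coming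
    from \<open>D\<close> in front of the \<open>d (v, n)\<close> old ones.\<close>
  define d' where "d' = (\<lambda>(v, m). case prod_decode m of (n, e) \<Rightarrow> e + d (v :: 'v, n))"
  define Y where "Y = (\<Union>g\<in>GL. tact g ` delta ` G)"
  define S where "S = pm.span Y"
  have carrier: "tp_sub I' d' (carrier (tensor_powers I' d' :: ('k, 'k, (('v \<times> nat) \<times> nat list) \<Rightarrow>\<^sub>0 'k) gl_module))"
    by (rule tp_sub_carrier)
  have delta_in: "delta y \<in> carrier (tensor_powers I' d')" if y: "y \<in> G" for y
  proof -
    have "(v, m) \<in> I' \<and> length ls = d' (v, m)" if k: "((v, m), ls) \<in> keys (delta y)" for v m ls
    proof
      show "(v, m) \<in> I'" unfolding I'_def using y k by force
      obtain n e where m: "prod_decode m = (n, e)" by force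
      have "e \<le> length ls" "lookup y ((v, n), drop e ls) \<noteq> 0"
        using k by (auto simp: in_keys_iff lookup_delta m split: if_splits)
      then show "length ls = d' (v, m)"
        using len[rule_format, OF y, of "(v, n)" "drop e ls"] by (simp add: d'_def m in_keys_iff)
    qed
    then show ?thesis by (fastforce simp: tensor_powers_simps)
  qed
  have SI: "S \<subseteq> carrier (tensor_powers I' d')"
    unfolding S_def
  proof (rule pm.span_minimal)
    show "Y \<subseteq> carrier (tensor_powers I' d')"
      using carrier delta_in unfolding Y_def tp_sub_def by blast
  qed (rule subspace_tensor_powers)
  have GLS: "tact g s \<in> S" if g: "g \<in> GL" and s: "s \<in> S" for g s
    using s unfolding S_def
  proof (induction rule: pm.span_induct_alt)
    case (step c x y)
    then obtain h z where hz: "h \<in> GL" "z \<in> G" "x = tact h (delta z)" by (auto simp: Y_def)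
    have "tact g x = tact (g \<circ> h) (delta z)"
      unfolding hz(3) by (rule tact_compose[OF g hz(1), symmetric])
    then have "tact g x \<in> Y" using GL_compose[OF g hz(1)] hz(2) unfolding Y_def by blast
    then show ?case using step(2) by (simp add: tact_add tact_scale pm.span_add pm.span_scale pm.span_base)
  qed (simp add: pm.span_zero)
  have tp: "tp_sub I' d' S"
    using SI GLS carrier unfolding tp_sub_def by (auto simp: S_def pm.subspace_span)
  have im: "S \<subseteq> delta ` P" if P: "rep_closed P" "G \<subseteq> P" for P
    unfolding S_def
  proof (rule pm.span_minimal)
    show "Y \<subseteq> delta ` P"
    proof
      fix x assume "x \<in> Y"
      then obtain g y where gy: "g \<in> GL" "y \<in> G" "x = tact g (delta y)" by (auto simp: Y_def)
      then have "x = delta (gact g y)" by (simp add: delta_gact)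
      moreover have "gact g y \<in> P" using P gy by (auto simp: rep_closed_def)
      ultimately show "x \<in> delta ` P" by blast
    qed
    show "pm.subspace (delta ` P)"
    proof (rule pm.subspaceI)
      have "delta 0 = 0" using delta_scale[of 0 0] by (simp add: dp_const.hom_0)
      then show "0 \<in> delta ` P" using P by (metis image_eqI rep_closed_def)
    next
      fix x y assume "x \<in> delta ` P" "y \<in> delta ` P"
      then show "x + y \<in> delta ` P" using P by (auto simp: rep_closed_def simp flip: delta_add)
    next
      fix c x assume "x \<in> delta ` P"
      then show "pm_scale c x \<in> delta ` P" using P by (auto simp: rep_closed_def simp flip: delta_scale)
    qed
  qed
  \<comment> \<open>Used to see that \<open>S\<close> lies in the image of \<open>delta\<close>,
    where \<open>nab\<close> is a genuine inverse and therefore equivariant.\<close>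
  have univ: "rep_closed UNIV" by (simp add: rep_closed_def)
  have equiv: "nab (tact g s) = gact g (nab s)" if g: "g \<in> GL" and s: "s \<in> S" for g s
  proof -
    obtain y where "s = delta y" using im[OF univ] s by blast
    then show ?thesis using delta_gact[OF g, of y, symmetric] by (simp add: nab(3))
  qed
  have gens: "G \<subseteq> nab ` S"
  proof
    fix y assume "y \<in> G"
    then have "tact id (delta y) \<in> Y" unfolding Y_def using GL_id by blast
    then have "delta y \<in> S" unfolding S_def by (simp add: tact_id pm.span_base)
    then show "y \<in> nab ` S" using nab(3)[of y] by (metis imageI)
  qed
  have "nab ` S \<subseteq> P" if P: "rep_closed P" "G \<subseteq> P" for P
  proof
    fix x assume "x \<in> nab ` S"
    then obtain y where "y \<in> P" "x = nab (delta y)" using im[OF P] by blast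
    then show "x \<in> P" by (simp add: nab(3))
  qed
  then have min: "\<forall>P. rep_closed P \<longrightarrow> G \<subseteq> P \<longrightarrow> nab ` S \<subseteq> P" by iprover
  have fin: "finite I'" unfolding I'_def using G by simp
  have act: "\<forall>g\<in>GL. \<forall>s\<in>S. nab (tact g s) = gact g (nab s)" by (intro ballI equiv)
  show ?thesis
    by (intro exI conjI) (rule fin tp nab'(1) nab'(2) act gens min)+
qed

locale resolved =
  fixes I :: "('v \<times> nat) set" and d S and nab :: "((('v \<times> nat) \<times> nat list) \<Rightarrow>\<^sub>0 'k::field) \<Rightarrow> ((('v \<times> nat) \<times> nat list) \<Rightarrow>\<^sub>0 'k divpow)"
  assumes S: "tp_sub I d S"
    and nab_add: "nab (x + y) = nab x + nab y" and nab_scale: "nab (pm_scale c x) = fscale (dp_const c) (nab x)"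
    and nab_act: "g \<in> GL \<Longrightarrow> s \<in> S \<Longrightarrow> nab (tact g s) = gact g (nab s)"
begin

text \<open>The \<open>D\<close>-linear extension of \<open>nab\<close> is defined on the whole free
  module; equivariance is available on \<open>free_span S\<close>, because \<open>nab\<close> is
  equivariant on \<open>S\<close>.\<close>

definition jhat where "jhat = dlin (\<lambda>b. nab (basis_elt b))"

lemma jhat_add: "jhat (x + y) = jhat x + jhat y"
  by (simp add: jhat_def dlin_add)

lemma jhat_fscale: "jhat (fscale a x) = fscale a (jhat x)"
  by (simp add: jhat_def dlin_fscale)

lemma jhat_0 [simp]: "jhat 0 = 0"
  by (simp add: jhat_def)

lemma jhat_iota: "jhat (iota s) = nab s"
  unfolding jhat_def by (rule dlin_iota) (rule nab_add, rule nab_scale)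

lemma tact_S: "g \<in> GL \<Longrightarrow> s \<in> S \<Longrightarrow> tact g s \<in> S"
  using S by (simp add: tp_sub_def)

lemma jhat_gact: "g \<in> GL \<Longrightarrow> y \<in> free_span S \<Longrightarrow> jhat (gact g y) = gact g (jhat y)"
proof -
  assume g: "g \<in> GL"
  show "y \<in> free_span S \<Longrightarrow> jhat (gact g y) = gact g (jhat y)"
  proof (induction rule: F.span_induct_alt)
    case (step a x y)
    then show ?case
      by (auto simp: gact_add gact_fscale gact_iota jhat_add jhat_fscale jhat_iota nab_act[OF g])
  qed simp
qed

lemma jhat_in:
  assumes "F.subspace P" "nab ` S \<subseteq> P" "y \<in> free_span S"
  shows "jhat y \<in> P"
  using assms(3)
proof (induction rule: F.span_induct_alt)
  case base
  then show ?case using assms(1) by (simp add: F.subspace_0)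
next
  case (step a x y)
  then obtain s where "x = iota s" "s \<in> S" by blast
  then show ?case
    using assms(1,2) step by (auto simp: jhat_add jhat_fscale jhat_iota intro!: F.subspace_add F.subspace_scale)
qed

lemma subspace_jhat_image: "F.subspace (jhat ` free_span S)"
proof (rule F.subspaceI)
  show "0 \<in> jhat ` free_span S" using F.span_zero jhat_0 by (metis image_eqI)
  show "x + y \<in> jhat ` free_span S" if "x \<in> jhat ` free_span S" "y \<in> jhat ` free_span S" for x y
    using that by (auto simp: F.span_add simp flip: jhat_add)
  show "fscale c x \<in> jhat ` free_span S" if "x \<in> jhat ` free_span S" for c x
    using that by (auto simp: F.span_scale simp flip: jhat_fscale)
qed

lemma jhat_image_gact: "g \<in> GL \<Longrightarrow> x \<in> jhat ` free_span S \<Longrightarrow> gact g x \<in> jhat ` free_span S"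
  using jhat_gact free_span_gact[OF tact_S] by (auto simp flip: jhat_gact)

lemma nab_in_image: "s \<in> S \<Longrightarrow> nab s \<in> jhat ` free_span S"
  using jhat_iota[of s] by (metis F.span_base imageI)

end

context tp_cover
begin

lemma free_span_gact_S: "g \<in> GL \<Longrightarrow> y \<in> free_span S \<Longrightarrow> gact g y \<in> free_span S"
  by (rule free_span_gact[OF tact_S])

lemma tau_in: "y \<in> free_span S \<Longrightarrow> tau y \<in> carrier (div_tensor U)"
  using tau_image by blast

text \<open>With trivial kernel \<open>tau\<close> is a bijection onto \<open>D \<otimes> U\<close>,
  so equivariant maps can be specified on \<open>D \<otimes> S\<close>, in coordinates.\<close>

lemma hom_through_tau:
  assumes ker: "ker = {0}"
    and chi: "\<And>y. y \<in> free_span S \<Longrightarrow> \<chi> y \<in> carrier Q"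
      "\<And>x y. x \<in> free_span S \<Longrightarrow> y \<in> free_span S \<Longrightarrow> \<chi> (x + y) = \<chi> x \<oplus>\<^bsub>Q\<^esub> \<chi> y"
      "\<And>a x. x \<in> free_span S \<Longrightarrow> \<chi> (fscale a x) = a \<odot>\<^bsub>Q\<^esub> \<chi> x"
      "\<And>g x. g \<in> GL \<Longrightarrow> x \<in> free_span S \<Longrightarrow> \<chi> (gact g x) = gl_act Q g (\<chi> x)"
  shows "\<exists>\<Phi>\<in>gl_hom (div_tensor U) Q. \<forall>y\<in>free_span S. \<Phi> (tau y) = \<chi> y"
proof -
  have "F.span (iota ` ker) = {0}" by (simp add: ker)
  then have inj: "inj_on tau (free_span S)"
    by (intro inj_onI) (simp add: tau_eq_iff)
  define \<Phi> where "\<Phi> Z = \<chi> (inv_into (free_span S) tau Z)" for Z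
  have P: "\<Phi> (tau y) = \<chi> y" if "y \<in> free_span S" for y
    using that inj by (simp add: \<Phi>_def)
  have "\<Phi> \<in> gl_hom (div_tensor U) Q"
    unfolding gl_hom_def tau_image[symmetric]
    by (auto simp: P chi F.span_add F.span_scale free_span_gact_S simp flip: tau_add tau_scale tau_gact)
  with P show ?thesis by blast
qed

end

section \<open>Coherence\<close>

locale presented_module =
  cU: tp_cover IU dU SU U fU + cW: tp_cover IW dW SW W fW
  for IU :: "('v \<times> nat) set" and dU SU and U :: "('k::field, 'k, 'u) gl_module" and fU
    and IW :: "('v \<times> nat) set" and dW SW and W :: "('k::field, 'k, 'w) gl_module" and fW +
  fixes M :: "('k divpow, 'k, 'm) gl_module" and \<phi> \<psi>
  assumes M: "is_gl_module dp_act M"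
    and phi: "\<phi> \<in> gl_hom (div_tensor W) (div_tensor U)" and psi: "\<psi> \<in> gl_hom (div_tensor U) M"
    and exact: "\<phi> ` carrier (div_tensor W) = {y \<in> carrier (div_tensor U). \<psi> y = \<zero>\<^bsub>M\<^esub>}"
    and onto: "\<psi> ` carrier (div_tensor U) = carrier M"
    and W: "finite_length W"
begin

sublocale M: Module.module ring_of_type_algebra M
  using M by (simp add: is_gl_module_def)

lemma M_scale: "x \<in> carrier M \<Longrightarrow> a \<odot>\<^bsub>M\<^esub> x \<in> carrier M"
  using M.smult_closed by simp

lemma M_scale_0: "x \<in> carrier M \<Longrightarrow> 0 \<odot>\<^bsub>M\<^esub> x = \<zero>\<^bsub>M\<^esub>"
  using M.smult_l_null by simp

lemma M_act_0: "g \<in> GL \<Longrightarrow> gl_act M g \<zero>\<^bsub>M\<^esub> = \<zero>\<^bsub>M\<^esub>"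
proof -
  assume g: "g \<in> GL"
  have z: "\<zero>\<^bsub>M\<^esub> \<in> carrier M" by simp
  have "gl_act M g (0 \<odot>\<^bsub>M\<^esub> \<zero>\<^bsub>M\<^esub>) = dp_act g 0 \<odot>\<^bsub>M\<^esub> gl_act M g \<zero>\<^bsub>M\<^esub>" "gl_act M g \<zero>\<^bsub>M\<^esub> \<in> carrier M"
    using M g z unfolding is_gl_module_def by blast+
  then show ?thesis using M_scale_0 z by simp
qed

definition Psi where "Psi y = \<psi> (cU.tau y)"

lemma Psi_in: "y \<in> free_span SU \<Longrightarrow> Psi y \<in> carrier M"
  using psi cU.tau_in by (auto simp: Psi_def gl_hom_def)

lemma Psi_add: "x \<in> free_span SU \<Longrightarrow> y \<in> free_span SU \<Longrightarrow> Psi (x + y) = Psi x \<oplus>\<^bsub>M\<^esub> Psi y"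
  using psi cU.tau_in by (auto simp: Psi_def gl_hom_def cU.tau_add)

lemma Psi_scale: "x \<in> free_span SU \<Longrightarrow> Psi (fscale a x) = a \<odot>\<^bsub>M\<^esub> Psi x"
  using psi cU.tau_in by (auto simp: Psi_def gl_hom_def cU.tau_scale)

lemma Psi_gact: "g \<in> GL \<Longrightarrow> x \<in> free_span SU \<Longrightarrow> Psi (gact g x) = gl_act M g (Psi x)"
  using psi cU.tau_in by (auto simp: Psi_def gl_hom_def cU.tau_gact)

lemma Psi_0: "Psi 0 = \<zero>\<^bsub>M\<^esub>"
  using Psi_scale[of 0 0] M_scale_0[OF Psi_in[of 0]] by (simp add: F.span_zero)

lemma Psi_image: "Psi ` free_span SU = carrier M"
  unfolding Psi_def onto[symmetric] cU.tau_image[symmetric] image_image ..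

definition kernel where "kernel = {y \<in> free_span SU. Psi y = \<zero>\<^bsub>M\<^esub>}"

lemma subspace_kernel: "F.subspace kernel"
  by (rule F.subspaceI)
     (auto simp: kernel_def Psi_0 Psi_add Psi_scale F.span_zero F.span_add F.span_scale)

lemma kernel_gact: "g \<in> GL \<Longrightarrow> y \<in> kernel \<Longrightarrow> gact g y \<in> kernel"
  by (simp add: kernel_def Psi_gact M_act_0 cU.free_span_gact_S)

text \<open>The kernel has two sources. The kernel of the cover of \<open>U\<close> contributes
  constant vectors, which lie in \<open>flow q\<close> for every \<open>q > 0\<close>, however many
  there are. The relations from \<open>W\<close> contribute finitely many orbits because
  \<open>W\<close> has finite length. So one large \<open>q\<close> serves all generators.\<close>

lemma kernel_generated:
  "\<exists>K. finite K \<and> kernel = F.span (iota ` cU.ker \<union> (\<Union>g\<in>GL. gact g ` K))"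
proof -
  obtain FW where FW: "finite FW" "FW \<subseteq> carrier W"
    "\<And>N. gl_submodule N W \<Longrightarrow> FW \<subseteq> N \<Longrightarrow> N = carrier W"
    using finite_length_generated[OF W cW.gl] by blast
  have phi_in: "\<phi> (cW.tau v) \<in> carrier (div_tensor U)" if "v \<in> free_span SW" for v
    using phi cW.tau_in[OF that] by (auto simp: gl_hom_def)
  have phi_add: "\<phi> (cW.tau (v + w)) = \<phi> (cW.tau v) \<oplus>\<^bsub>div_tensor U\<^esub> \<phi> (cW.tau w)"
    if "v \<in> free_span SW" "w \<in> free_span SW" for v w
    using phi cW.tau_in that by (auto simp: gl_hom_def cW.tau_add)
  have phi_scale: "\<phi> (cW.tau (fscale a v)) = a \<odot>\<^bsub>div_tensor U\<^esub> \<phi> (cW.tau v)" if "v \<in> free_span SW" for a v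
    using phi cW.tau_in that by (auto simp: gl_hom_def cW.tau_scale)
  have phi_act: "\<phi> (cW.tau (gact g v)) = gl_act (div_tensor U) g (\<phi> (cW.tau v))"
    if "v \<in> free_span SW" "g \<in> GL" for g v
    using phi cW.tau_in that by (auto simp: gl_hom_def cW.tau_gact)
  have "\<exists>k. k \<in> free_span SU \<and> cU.tau k = \<phi> (cW.tau v)" if "v \<in> free_span SW" for v
    using phi_in[OF that] cU.tau_image by (metis (no_types, lifting) imageE)
  then obtain lift where lift: "\<And>v. v \<in> free_span SW \<Longrightarrow> lift v \<in> free_span SU \<and> cU.tau (lift v) = \<phi> (cW.tau v)"
    by metis
  define K where "K = (\<lambda>w. lift (iota (cW.sec w))) ` FW"
  define Q where "Q = F.span (\<Union>g\<in>GL. gact g ` K)"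
  have secW: "iota (cW.sec w) \<in> free_span SW" if "w \<in> FW" for w
    using cW.sec(1) FW(2) that by (blast intro: F.span_base)
  have KS: "K \<subseteq> free_span SU" using lift secW by (auto simp: K_def)
  have QS: "Q \<subseteq> free_span SU"
    unfolding Q_def by (rule F.span_minimal) (use KS cU.free_span_gact_S in auto)
  have Qg: "gact g y \<in> Q" if "g \<in> GL" "y \<in> Q" for g y
    using that(2) unfolding Q_def
  proof (induction rule: F.span_induct_alt)
    case (step a x y)
    then obtain h k where hk: "h \<in> GL" "k \<in> K" "x = gact h k" by auto
    then have "gact g x = gact (g \<circ> h) k" using gact_compose[OF that(1) hk(1), of k] by simp
    then have "gact g x \<in> (\<Union>g\<in>GL. gact g ` K)" using GL_compose[OF that(1) hk(1)] hk(2) by blast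
    then show ?case using step(2) by (simp add: gact_add gact_fscale F.span_add F.span_scale F.span_base)
  qed (simp add: F.span_zero)
  \<comment> \<open>Elements whose image in \<open>D \<otimes> U\<close> is already reached from the
    submodule \<open>Q\<close> generated by \<open>K\<close>; the aim is that these are all.\<close>
  define V where "V = {v \<in> free_span SW. \<exists>y\<in>Q. cU.tau y = \<phi> (cW.tau v)}"
  have V_add: "v + w \<in> V" if vw': "v \<in> V" "w \<in> V" for v w
  proof -
    obtain y z where yz: "y \<in> Q" "cU.tau y = \<phi> (cW.tau v)" "z \<in> Q" "cU.tau z = \<phi> (cW.tau w)"
      and vw: "v \<in> free_span SW" "w \<in> free_span SW"
      using vw' unfolding V_def by (elim CollectE conjE bexE) (rule that; assumption)
    have "cU.tau (y + z) = \<phi> (cW.tau (v + w))"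
      using cU.tau_add[of y z] QS yz phi_add[OF vw] by auto
    moreover have "y + z \<in> Q" using yz unfolding Q_def by (intro F.span_add)
    ultimately show ?thesis using F.span_add[OF vw] unfolding V_def by blast
  qed
  have V_scale: "fscale a v \<in> V" if v': "v \<in> V" for a v
  proof -
    obtain y where y: "y \<in> Q" "cU.tau y = \<phi> (cW.tau v)" and v: "v \<in> free_span SW"
      using v' unfolding V_def by (elim CollectE conjE bexE) (rule that; assumption)
    have "cU.tau (fscale a y) = \<phi> (cW.tau (fscale a v))"
      using cU.tau_scale[of y a] QS y phi_scale[OF v] by auto
    moreover have "fscale a y \<in> Q" using y unfolding Q_def by (intro F.span_scale)
    ultimately show ?thesis using F.span_scale[OF v] unfolding V_def by blast
  qed
  have V_act: "gact g v \<in> V" if v': "v \<in> V" and g: "g \<in> GL" for g v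
  proof -
    obtain y where y: "y \<in> Q" "cU.tau y = \<phi> (cW.tau v)" and v: "v \<in> free_span SW"
      using v' unfolding V_def by (elim CollectE conjE bexE) (rule that; assumption)
    have "cU.tau (gact g y) = \<phi> (cW.tau (gact g v))"
      using cU.tau_gact[of y g] QS y g phi_act[OF v g] by auto
    moreover have "gact g y \<in> Q" by (rule Qg[OF g y(1)])
    ultimately show ?thesis using cW.free_span_gact_S[OF g v] unfolding V_def by blast
  qed
  have V_sec: "iota (cW.sec w) \<in> V" if "w \<in> FW" for w
  proof -
    have "lift (iota (cW.sec w)) \<in> K" using that by (auto simp: K_def)
    then have "gact id (lift (iota (cW.sec w))) \<in> (\<Union>g\<in>GL. gact g ` K)" using GL_id by blast
    then have "lift (iota (cW.sec w)) \<in> Q" unfolding Q_def gact_id by (rule F.span_base)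
    then show ?thesis using lift[OF secW[OF that]] secW[OF that] unfolding V_def by blast
  qed
  \<comment> \<open>The constant vectors in \<open>V\<close>. Their image in \<open>W\<close> is a
    subrepresentation containing the generators \<open>FW\<close>, hence everything.\<close>
  define V0 where "V0 = {s \<in> SW. iota s \<in> V}"
  have V_0: "0 \<in> V"
  proof -
    have "cU.tau 0 = \<phi> (cW.tau 0)"
      using cU.tau_scale[of 0 0] phi_scale[of 0 0] lift[of 0] cU.tau_scale[of "lift 0" 0]
      by (simp add: F.span_zero)
    then show ?thesis by (auto simp: V_def F.span_zero Q_def intro!: bexI[of _ 0])
  qed
  have "gl_submodule (fW ` V0) W"
    unfolding gl_submodule_def submodule_iff[OF cW.U.module_axioms]
  proof (intro conjI ballI allI)
    show "fW ` V0 \<subseteq> carrier W" using cW.f_carrier by (auto simp: V0_def)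
    have "(0 :: (('v \<times> nat) \<times> nat list) \<Rightarrow>\<^sub>0 'k) \<in> V0"
      using V_0 pm.subspace_0[OF cW.subspace_S] by (simp add: V0_def)
    then show "\<zero>\<^bsub>W\<^esub> \<in> fW ` V0" using cW.f_0 by (metis imageI)
  next
    fix x y assume "x \<in> fW ` V0" "y \<in> fW ` V0"
    then obtain s t where st: "s \<in> V0" "t \<in> V0" "x = fW s" "y = fW t" by blast
    then have "s + t \<in> V0" using V_add pm.subspace_add[OF cW.subspace_S] by (simp add: V0_def iota_add)
    moreover have "x \<oplus>\<^bsub>W\<^esub> y = fW (s + t)" using st by (simp add: V0_def cW.f_add)
    ultimately show "x \<oplus>\<^bsub>W\<^esub> y \<in> fW ` V0" by blast
  next
    fix c x assume "x \<in> fW ` V0"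
    then obtain s where s: "s \<in> V0" "x = fW s" by blast
    then have "pm_scale c s \<in> V0" using V_scale pm.subspace_scale[OF cW.subspace_S] by (simp add: V0_def iota_scale)
    moreover have "c \<odot>\<^bsub>W\<^esub> x = fW (pm_scale c s)" using s by (simp add: V0_def cW.f_scale)
    ultimately show "c \<odot>\<^bsub>W\<^esub> x \<in> fW ` V0" by blast
  next
    fix g :: "'k vec \<Rightarrow> 'k vec" and x assume g: "g \<in> GL" and "x \<in> fW ` V0"
    then obtain s where s: "s \<in> V0" "x = fW s" by blast
    then have "tact g s \<in> V0" using V_act[OF _ g, of "iota s"] cW.tact_S[OF g] by (simp add: V0_def gact_iota)
    moreover have "gl_act W g x = fW (tact g s)" using s g by (simp add: V0_def cW.f_act)
    ultimately show "gl_act W g x \<in> fW ` V0" by blast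
  qed
  moreover have "FW \<subseteq> fW ` V0"
  proof
    fix w assume w: "w \<in> FW"
    then have "cW.sec w \<in> V0" "fW (cW.sec w) = w"
      using V_sec cW.sec[of w] FW(2) by (auto simp: V0_def)
    then show "w \<in> fW ` V0" by (metis imageI)
  qed
  ultimately have V0: "fW ` V0 = carrier W" by (rule FW(3))
  have iota_V: "iota s \<in> V" if s: "s \<in> SW" for s
  proof -
    have "fW s \<in> fW ` V0" unfolding V0 by (rule cW.f_carrier[OF s])
    then obtain s' where s': "s' \<in> V0" "fW s = fW s'" by blast
    then have "s - s' \<in> cW.ker" using cW.f_eq_iff s by (simp add: V0_def)
    then have "iota s - iota s' \<in> free_span cW.ker" by (simp add: F.span_base flip: iota_diff)
    moreover have in_span: "iota s \<in> free_span SW" "iota s' \<in> free_span SW"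
      using s s' by (auto simp: V0_def intro: F.span_base)
    ultimately have "cW.tau (iota s) = cW.tau (iota s')" using cW.tau_eq_iff by blast
    then show ?thesis using s' in_span by (simp add: V0_def V_def)
  qed
  have all_V: "v \<in> V" if "v \<in> free_span SW" for v
    using that
  proof (induction rule: F.span_induct_alt)
    case (step a x y)
    then show ?case using iota_V by (auto intro!: V_add V_scale)
  qed (rule V_0)
  let ?Z = "iota ` cU.ker \<union> (\<Union>g\<in>GL. gact g ` K)"
  have "kernel = F.span ?Z"
  proof
    show "kernel \<subseteq> F.span ?Z"
    proof
      fix y assume y: "y \<in> kernel"
      then have yS: "y \<in> free_span SU" and "\<psi> (cU.tau y) = \<zero>\<^bsub>M\<^esub>" by (auto simp: kernel_def Psi_def)
      then have "cU.tau y \<in> \<phi> ` carrier (div_tensor W)" unfolding exact using cU.tau_in by blast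
      then obtain v where v: "v \<in> free_span SW" "cU.tau y = \<phi> (cW.tau v)"
        unfolding cW.tau_image[symmetric] by blast
      from all_V[OF v(1)] have "\<exists>y'\<in>Q. cU.tau y' = cU.tau y"
        unfolding V_def v(2) by (rule CollectE) (rule conjunct2)
      then obtain y' where y': "y' \<in> Q" "cU.tau y' = cU.tau y" by (rule bexE)
      have y'S: "y' \<in> free_span SU" using y' QS by blast
      have "y - y' \<in> free_span cU.ker" using cU.tau_eq_iff[OF yS y'S] y'(2) by simp
      then have "y - y' \<in> F.span ?Z" using F.span_mono[of "iota ` cU.ker" ?Z] by blast
      moreover have "y' \<in> F.span ?Z" using y'(1) F.span_mono[of "\<Union>g\<in>GL. gact g ` K" ?Z] unfolding Q_def by blast
      ultimately have "(y - y') + y' \<in> F.span ?Z" by (rule F.span_add)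
      then show "y \<in> F.span ?Z" by simp
    qed
    show "F.span ?Z \<subseteq> kernel"
    proof (rule F.span_minimal[OF _ subspace_kernel])
      have "iota s \<in> kernel" if s: "s \<in> cU.ker" for s
      proof -
        have sS: "iota s \<in> free_span SU" using s by (auto simp: cU.ker_def intro: F.span_base)
        have "iota s - 0 \<in> free_span cU.ker" using s by (simp add: F.span_base)
        then have "cU.tau (iota s) = cU.tau 0" using cU.tau_eq_iff[OF sS F.span_zero] by blast
        then show ?thesis using sS Psi_0 by (simp add: kernel_def Psi_def)
      qed
      moreover have "k \<in> kernel" if k: "k \<in> K" for k
      proof -
        obtain w where w: "w \<in> FW" "k = lift (iota (cW.sec w))" using k by (auto simp: K_def)
        have "cU.tau k \<in> \<phi> ` carrier (div_tensor W)"
          using lift[OF secW[OF w(1)]] cW.tau_in[OF secW[OF w(1)]] w(2) by simp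
        then show ?thesis using KS k unfolding exact by (auto simp: kernel_def Psi_def)
      qed
      ultimately show "?Z \<subseteq> kernel" using kernel_gact by blast
    qed
  qed
  moreover have "finite K" using FW(1) by (simp add: K_def)
  ultimately show ?thesis by blast
qed

end


lemma polynomial_rep_cover:
  fixes U :: "('k::field, 'k, 'm) gl_module"
  assumes "polynomial_rep U"
  obtains I :: "('m \<times> nat) set" and d S f where "tp_cover I d S U f"
proof -
  from assms obtain I :: "('m \<times> nat) set" and d S S' f where
    f: "f \<in> gl_hom ((tensor_powers I d)\<lparr>carrier := S\<rparr>) U" and S: "gl_submodule S (tensor_powers I d)"
    and surj: "f ` S = carrier U" and gl: "is_gl_module (\<lambda>g c. c) U"
    unfolding polynomial_rep_def by (elim conjE exE bexE) (rule that; assumption)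
  have "tp_cover I d S U f"
    using gl f surj S by (simp add: tp_cover_def gl_submodule_tensor_powers)
  then show thesis by (rule that)
qed

lemma polynomial_repI:
  fixes U :: "('k::field, 'k, 'm) gl_module" and I :: "('m \<times> nat) set"
  assumes S: "tp_sub I d S" and gl: "is_gl_module (\<lambda>g c. c) U"
    and f: "f \<in> gl_hom ((tensor_powers I d)\<lparr>carrier := S\<rparr>) U" "f ` S = carrier U"
    and ker: "{s \<in> S. f s = ring.zero U} = {0}"
  shows "polynomial_rep U"
proof -
  have "pm.subspace S" using S by (simp add: tp_sub_def)
  then have "tp_sub I d {0}"
    by (simp add: tp_sub_def pm.subspace_def)
  moreover have "{0} \<subseteq> S" using ker by blast
  ultimately show ?thesis
    unfolding polynomial_rep_def gl_submodule_tensor_powers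
    using S gl f ker by (intro conjI exI[of _ I] exI[of _ d] exI[of _ S] exI[of _ "{0}"] bexI[of _ f])
qed

lemma tp_cover_realize:
  fixes S :: "((('k vec \<times> nat) \<times> nat list) \<Rightarrow>\<^sub>0 'k::alg_closed_field) set"
  assumes S: "tp_sub I d S" and I: "finite I"
  obtains U :: "('k, 'k, 'k vec) gl_module" and f where "tp_cover I d S U f" "tp_cover.ker S U f = {0}"
    "polynomial_rep U" "finite_length U"
proof -
  obtain U :: "('k, 'k, 'k vec) gl_module" and f where U: "is_gl_module (\<lambda>g c. c) U" "finite_length U"
    "f \<in> gl_hom ((tensor_powers I d)\<lparr>carrier := S\<rparr>) U" "f ` S = carrier U"
    "{s \<in> S. f s = ring.zero U} = {0}"
    using realize_tp_sub[OF S I] by (elim exE conjE) (rule that; assumption)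
  have cov: "tp_cover I d S U f" using S U by (simp add: tp_cover_def)
  moreover have "tp_cover.ker S U f = {0}" using U(5) by (simp add: tp_cover.ker_def[OF cov])
  moreover have "polynomial_rep U" by (rule polynomial_repI[OF S U(1,3,4,5)])
  ultimately show thesis using U(2) by (rule that)
qed

theorem theorem2:
  fixes M :: "('k::alg_closed_field divpow, 'k, 'm) gl_module" and N :: "'m set"
  assumes "CHAR('k) > 0"
    and "div_module M" and "finitely_presented M"
    and "gl_submodule N M" and "finitely_generated (M\<lparr>carrier := N\<rparr>)"
  shows "finitely_presented (M\<lparr>carrier := N\<rparr>)"
proof -
  have M: "is_gl_module dp_act M" using assms(2) by (simp add: div_module_def)
  obtain W U :: "('k, 'k, 'k vec) gl_module" and \<phi> \<psi> where
    WU: "polynomial_rep W" "finite_length W" "polynomial_rep U"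
    and phi: "\<phi> \<in> gl_hom (div_tensor W) (div_tensor U)" and psi: "\<psi> \<in> gl_hom (div_tensor U) M"
    and exact: "\<phi> ` carrier (div_tensor W) = {y \<in> carrier (div_tensor U). \<psi> y = \<zero>\<^bsub>M\<^esub>}"
    and onto: "\<psi> ` carrier (div_tensor U) = carrier M"
    using assms(3) unfolding finitely_presented_def by (elim exE conjE bexE) (rule that; assumption)
  obtain IU :: "('k vec \<times> nat) set" and dU SU fU where cU: "tp_cover IU dU SU U fU"
    by (rule polynomial_rep_cover[OF WU(3)])
  obtain IW :: "('k vec \<times> nat) set" and dW SW fW where cW: "tp_cover IW dW SW W fW"
    by (rule polynomial_rep_cover[OF WU(1)])
  interpret presented_module IU dU SU U fU IW dW SW W fW M \<phi> \<psi>
    using cU cW M phi psi exact onto WU(2)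
    by (simp add: presented_module_def presented_module_axioms_def)
  have N: "N \<subseteq> carrier M" "\<zero>\<^bsub>M\<^esub> \<in> N" "\<And>x y. x \<in> N \<Longrightarrow> y \<in> N \<Longrightarrow> x \<oplus>\<^bsub>M\<^esub> y \<in> N"
    "\<And>a x. x \<in> N \<Longrightarrow> a \<odot>\<^bsub>M\<^esub> x \<in> N" "\<And>g x. g \<in> GL \<Longrightarrow> x \<in> N \<Longrightarrow> gl_act M g x \<in> N"
    using assms(4) unfolding gl_submodule_def submodule_iff[OF M.module_axioms] by blast+
  let ?N = "M\<lparr>carrier := N\<rparr>"
  have sub_N: "submodule N ring_of_type_algebra M" using assms(4) by (simp add: gl_submodule_def)
  have modN: "Module.module ring_of_type_algebra ?N"
    by (rule submodule.submodule_is_module[OF sub_N M.module_axioms])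
  obtain F where F: "finite F" "F \<subseteq> N"
    "(\<lambda>N'. submodule N' ring_of_type_algebra ?N) hull (\<Union>g\<in>GL. gl_act M g ` F) = N"
    using assms(5) unfolding finitely_generated_def by auto
  have "\<forall>n\<in>F. \<exists>t. t \<in> free_span SU \<and> Psi t = n"
    using Psi_image F(2) N(1) by (metis (no_types, lifting) imageE subsetD)
  then obtain t where t: "\<And>n. n \<in> F \<Longrightarrow> t n \<in> free_span SU \<and> Psi (t n) = n" by metis
  obtain K where K: "finite K" "kernel = F.span (iota ` cU.ker \<union> (\<Union>g\<in>GL. gact g ` K))"
    using kernel_generated by blast
  have "Factorial_Ring.prime CHAR('k)" using assms(1) by (rule prime_CHAR_semidom)
  then have "1 < CHAR('k)" by (rule prime_gt_1_nat)
  \<comment> \<open>One \<open>q\<close> for the relations of \<open>M\<close> and for the lifted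
    generators of \<open>N\<close> together.\<close>
  from flow_exists[OF _ this, of "K \<union> t ` F"] K(1) F(1)
  obtain r where r: "K \<union> t ` F \<subseteq> flow (CHAR('k) ^ r)" by blast
  define q where "q = CHAR('k) ^ r"
  interpret fr: frobenius_power q r "TYPE('k)"
    by unfold_locales (use assms(1) in \<open>simp_all add: q_def\<close>)
  have low: "K \<subseteq> flow q" "t ` F \<subseteq> flow q" using r by (simp_all add: q_def)
  have rep_flow: "rep_closed (flow q :: ((('k vec \<times> nat) \<times> nat list) \<Rightarrow>\<^sub>0 'k divpow) set)"
    by (auto simp: rep_closed_def flow_0 flow_add flow_const_scale fr.flow_gact)
  have keysU: "\<forall>y\<in>t ` F. \<forall>i js. (i, js) \<in> keys y \<longrightarrow> length js = dU i"
    using keys_free_span[OF cU.S] t by blast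
  \<comment> \<open>The lifts lie in \<open>D \<otimes> T\<close>, but the new presentation needs a
    cover \<open>D \<otimes> U1\<close> with \<open>U1\<close> of finite length. So the
    representation they generate is moved into finitely many tensor powers.\<close>
  obtain I1 :: "('k vec \<times> nat) set" and d1 S1 nab1 where S1: "finite I1" "tp_sub I1 d1 S1"
    "\<forall>x y. nab1 (x + y) = nab1 x + nab1 y" "\<forall>c x. nab1 (pm_scale c x) = fscale (dp_const c) (nab1 x)"
    "\<forall>g\<in>GL. \<forall>s\<in>S1. nab1 (tact g s) = gact g (nab1 s)" "t ` F \<subseteq> nab1 ` S1"
    "\<forall>P. rep_closed P \<longrightarrow> t ` F \<subseteq> P \<longrightarrow> nab1 ` S1 \<subseteq> P"
    using tensor_resolution[OF finite_imageI[OF F(1)] keysU]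
    by (elim exE conjE) (rule that; assumption)
  interpret r1: resolved I1 d1 S1 nab1
    using S1 by (simp add: resolved_def)
  have nab1_flow: "nab1 ` S1 \<subseteq> flow q" using S1(7) rep_flow low(2) by blast
  have "rep_closed (free_span SU)"
    by (rule rep_closed_subspace[OF F.subspace_span]) (rule cU.free_span_gact_S)
  then have nab1_SU: "nab1 ` S1 \<subseteq> free_span SU" using S1(7) t by blast
  have j1_in: "r1.jhat y \<in> free_span SU" if "y \<in> free_span S1" for y
    using that by (rule r1.jhat_in[OF F.subspace_span nab1_SU])
  define Theta where "Theta y = Psi (r1.jhat y)" for y
  have Theta_add: "Theta (x + y) = Theta x \<oplus>\<^bsub>M\<^esub> Theta y" if "x \<in> free_span S1" "y \<in> free_span S1" for x y
    unfolding Theta_def r1.jhat_add by (rule Psi_add[OF j1_in[OF that(1)] j1_in[OF that(2)]])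
  have Theta_scale: "Theta (fscale a x) = a \<odot>\<^bsub>M\<^esub> Theta x" if "x \<in> free_span S1" for a x
    unfolding Theta_def r1.jhat_fscale by (rule Psi_scale[OF j1_in[OF that]])
  have Theta_gact: "Theta (gact g x) = gl_act M g (Theta x)" if "g \<in> GL" "x \<in> free_span S1" for g x
    unfolding Theta_def r1.jhat_gact[OF that] by (rule Psi_gact[OF that(1) j1_in[OF that(2)]])
  let ?PN = "{y \<in> free_span SU. Psi y \<in> N}"
  have PN: "F.subspace ?PN"
    by (rule F.subspaceI) (auto simp: Psi_0 Psi_add Psi_scale F.span_zero F.span_add F.span_scale N)
  have "rep_closed ?PN"
    by (rule rep_closed_subspace[OF PN]) (auto simp: Psi_gact cU.free_span_gact_S N(5))
  moreover have "t ` F \<subseteq> ?PN" using t F(2) by auto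
  ultimately have "nab1 ` S1 \<subseteq> ?PN" using S1(7) by blast
  then have Theta_in: "Theta y \<in> N" if "y \<in> free_span S1" for y
    using r1.jhat_in[OF PN _ that] by (simp add: Theta_def)
  have "submodule (Theta ` free_span S1) ring_of_type_algebra ?N"
    unfolding submodule_iff[OF modN]
  proof (intro conjI ballI allI)
    show "Theta ` free_span S1 \<subseteq> carrier ?N" using Theta_in by auto
    have "Theta 0 = \<zero>\<^bsub>?N\<^esub>" by (simp add: Theta_def Psi_0)
    then show "\<zero>\<^bsub>?N\<^esub> \<in> Theta ` free_span S1" using F.span_zero by (metis imageI)
  next
    fix x y assume "x \<in> Theta ` free_span S1" "y \<in> Theta ` free_span S1"
    then show "x \<oplus>\<^bsub>?N\<^esub> y \<in> Theta ` free_span S1"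
      by (auto simp: F.span_add simp flip: Theta_add)
  next
    fix a x assume "x \<in> Theta ` free_span S1"
    then show "a \<odot>\<^bsub>?N\<^esub> x \<in> Theta ` free_span S1"
      by (auto simp: F.span_scale simp flip: Theta_scale)
  qed
  moreover have "(\<Union>g\<in>GL. gl_act M g ` F) \<subseteq> Theta ` free_span S1"
  proof
    fix x assume "x \<in> (\<Union>g\<in>GL. gl_act M g ` F)"
    then obtain g n where gn: "g \<in> GL" "n \<in> F" "x = gl_act M g n" by blast
    then obtain s where s: "s \<in> S1" "t n = nab1 s" using S1(6) by blast
    have sS: "iota s \<in> free_span S1" using s(1) by (simp add: F.span_base)
    have "Theta (iota s) = n" using t[OF gn(2)] s(2) by (simp add: Theta_def r1.jhat_iota)
    then have "x = Theta (gact g (iota s))" using Theta_gact[OF gn(1) sS] gn(3) by simp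
    then show "x \<in> Theta ` free_span S1"
      using free_span_gact[OF r1.tact_S[OF gn(1)] sS] by blast
  qed
  ultimately have "N \<subseteq> Theta ` free_span S1" using hull_minimal F(3) by metis
  then have Theta_image: "Theta ` free_span S1 = N" using Theta_in by blast
  define P where "P = {y \<in> free_span S1. r1.jhat y \<in> kernel}"
  have P_iff: "y \<in> P \<longleftrightarrow> Theta y = \<zero>\<^bsub>M\<^esub>" if "y \<in> free_span S1" for y
    using that j1_in[OF that] by (simp add: P_def kernel_def Theta_def)
  have P_sub: "F.subspace P"
    by (rule F.subspaceI)
       (use subspace_kernel in \<open>auto simp: P_def r1.jhat_add r1.jhat_fscale F.subspace_0 F.subspace_add F.subspace_scale
          F.span_zero F.span_add F.span_scale\<close>)
  have P_gact: "gact g y \<in> P" if "g \<in> GL" "y \<in> P" for g y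
    using that kernel_gact free_span_gact[OF r1.tact_S[OF that(1)]] by (auto simp: P_def r1.jhat_gact)
  have iota_flow: "iota ` S1 \<subseteq> flow q" using flow_iota[OF fr.q_pos] by blast
  \<comment> \<open>On \<open>a\<close> times a constant vector \<open>iota s\<close> both sides
    replace \<open>a\<close> by its projection: \<open>iota s\<close> and \<open>nab1 s\<close> have
    coefficients in \<open>D_q\<close>, the latter by minimality of \<open>S1\<close> among
    \<open>rep_closed\<close> sets.\<close>
  have proj_jhat: "r1.jhat (fproj q e y) = fproj q e (r1.jhat y)" if "y \<in> free_span S1" for e y
    using that
  proof (induction rule: F.span_induct_alt)
    case (step a x y)
    then obtain s where s: "s \<in> S1" "x = iota s" by blast
    have "nab1 s \<in> flow q" "iota s \<in> flow q" using nab1_flow iota_flow s(1) by blast+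
    then show ?case
      using step(2) by (simp add: s(2) fproj_add fr.fproj_fscale r1.jhat_add r1.jhat_fscale r1.jhat_iota)
  qed simp
  \<comment> \<open>Constant vectors lie in \<open>flow q\<close> anyway, and the orbits of
    \<open>K\<close> do since \<open>D_q\<close> is stable under \<open>GL\<close>. Hence
    \<open>kernel\<close>, and with it \<open>P\<close>, is stable under all projections.\<close>
  have gens_flow: "iota ` cU.ker \<union> (\<Union>g\<in>GL. gact g ` K) \<subseteq> flow q"
    using flow_iota[OF fr.q_pos] fr.flow_gact low(1) by blast
  have P_proj: "fproj q e y \<in> P" if "y \<in> P" for e y
  proof -
    have "y \<in> free_span S1" "r1.jhat y \<in> kernel" using that by (auto simp: P_def)
    moreover have "fproj q e y \<in> free_span S1" by (rule fr.fproj_span[OF iota_flow]) fact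
    moreover have "fproj q e (r1.jhat y) \<in> kernel"
      using fr.fproj_span[OF gens_flow] calculation(2) unfolding K(2) by blast
    ultimately show ?thesis by (simp add: P_def proj_jhat)
  qed
  have P_keys: "i \<in> I1 \<and> length js = d1 i" if "y \<in> P" "(i, js) \<in> keys y" for y i js
    by (rule keys_free_span[OF S1(2) _ that(2)]) (use that(1) in \<open>simp add: P_def\<close>)
  have "\<exists>G. finite G \<and> G \<subseteq> P \<and> P = F.span (\<Union>g\<in>GL. gact g ` G)"
    by (rule fr.finitely_generated_if_proj_closed[OF S1(1) _ P_sub]) (rule P_keys P_gact P_proj; assumption)+
  then obtain G where G: "finite G" "G \<subseteq> P" "P = F.span (\<Union>g\<in>GL. gact g ` G)"
    by (elim exE conjE) (rule that; assumption)
  have keysG: "\<forall>y\<in>G. \<forall>i js. (i, js) \<in> keys y \<longrightarrow> length js = d1 i"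
    using P_keys G(2) by blast
  \<comment> \<open>The generators \<open>G\<close> of the relations get the same treatment as the
    lifts, so that \<open>P\<close> becomes the image of \<open>D \<otimes> W1\<close>.\<close>
  obtain I2 :: "('k vec \<times> nat) set" and d2 S2 nab2 where S2: "finite I2" "tp_sub I2 d2 S2"
    "\<forall>x y. nab2 (x + y) = nab2 x + nab2 y" "\<forall>c x. nab2 (pm_scale c x) = fscale (dp_const c) (nab2 x)"
    "\<forall>g\<in>GL. \<forall>s\<in>S2. nab2 (tact g s) = gact g (nab2 s)" "G \<subseteq> nab2 ` S2"
    "\<forall>P. rep_closed P \<longrightarrow> G \<subseteq> P \<longrightarrow> nab2 ` S2 \<subseteq> P"
    using tensor_resolution[OF G(1) keysG] by (elim exE conjE) (rule that; assumption)
  interpret r2: resolved I2 d2 S2 nab2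
    using S2 by (simp add: resolved_def)
  have "rep_closed P" by (rule rep_closed_subspace[OF P_sub P_gact])
  then have "nab2 ` S2 \<subseteq> P" using S2(7) G(2) by blast
  then have j2_in: "r2.jhat y \<in> P" if "y \<in> free_span S2" for y
    using that by (rule r2.jhat_in[OF P_sub])
  have "P \<subseteq> r2.jhat ` free_span S2"
    unfolding G(3)
  proof (rule F.span_minimal[OF _ r2.subspace_jhat_image])
    have "G \<subseteq> r2.jhat ` free_span S2" using S2(6) r2.nab_in_image by blast
    then show "(\<Union>g\<in>GL. gact g ` G) \<subseteq> r2.jhat ` free_span S2" using r2.jhat_image_gact by blast
  qed
  then have j2_image: "r2.jhat ` free_span S2 = P" using j2_in by blast
  obtain U1 :: "('k, 'k, 'k vec) gl_module" and f1 where U1: "tp_cover I1 d1 S1 U1 f1"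
    "tp_cover.ker S1 U1 f1 = {0}" "polynomial_rep U1" "finite_length U1"
    by (rule tp_cover_realize[OF S1(2,1)])
  obtain W1 :: "('k, 'k, 'k vec) gl_module" and f2 where W1: "tp_cover I2 d2 S2 W1 f2"
    "tp_cover.ker S2 W1 f2 = {0}" "polynomial_rep W1" "finite_length W1"
    by (rule tp_cover_realize[OF S2(2,1)])
  interpret c1: tp_cover I1 d1 S1 U1 f1 by (rule U1(1))
  interpret c2: tp_cover I2 d2 S2 W1 f2 by (rule W1(1))
  have "\<exists>\<Phi>\<in>gl_hom (div_tensor U1) ?N. \<forall>y\<in>free_span S1. \<Phi> (c1.tau y) = Theta y"
    by (rule c1.hom_through_tau[OF U1(2)]) (simp_all add: Theta_in Theta_add Theta_scale Theta_gact)
  then obtain \<psi>1 where psi1: "\<psi>1 \<in> gl_hom (div_tensor U1) ?N" "\<And>y. y \<in> free_span S1 \<Longrightarrow> \<psi>1 (c1.tau y) = Theta y"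
    by blast
  have j2_S1: "r2.jhat y \<in> free_span S1" if "y \<in> free_span S2" for y
    using j2_in[OF that] by (simp add: P_def)
  have "\<exists>\<Phi>\<in>gl_hom (div_tensor W1) (div_tensor U1). \<forall>y\<in>free_span S2. \<Phi> (c2.tau y) = c1.tau (r2.jhat y)"
    by (rule c2.hom_through_tau[OF W1(2)])
       (simp_all add: c1.tau_in j2_S1 r2.jhat_add r2.jhat_fscale r2.jhat_gact c1.tau_add c1.tau_scale c1.tau_gact)
  then obtain \<phi>1 where phi1: "\<phi>1 \<in> gl_hom (div_tensor W1) (div_tensor U1)"
    "\<And>y. y \<in> free_span S2 \<Longrightarrow> \<phi>1 (c2.tau y) = c1.tau (r2.jhat y)" by blast
  have onto1: "\<psi>1 ` carrier (div_tensor U1) = carrier ?N"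
    unfolding c1.tau_image[symmetric] image_image using psi1(2) Theta_image by simp
  have "\<phi>1 ` carrier (div_tensor W1) = c1.tau ` P"
    unfolding c2.tau_image[symmetric] j2_image[symmetric] image_image using phi1(2) by simp
  also have "\<dots> = {y \<in> carrier (div_tensor U1). \<psi>1 y = \<zero>\<^bsub>?N\<^esub>}"
  proof (intro equalityI subsetI)
    fix Z assume "Z \<in> c1.tau ` P"
    then obtain y where y: "y \<in> P" "Z = c1.tau y" by blast
    have "y \<in> free_span S1" using y(1) by (simp add: P_def)
    then show "Z \<in> {y \<in> carrier (div_tensor U1). \<psi>1 y = \<zero>\<^bsub>?N\<^esub>}"
      using y P_iff psi1(2) c1.tau_in by simp
  next
    fix Z assume "Z \<in> {y \<in> carrier (div_tensor U1). \<psi>1 y = \<zero>\<^bsub>?N\<^esub>}"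
    then have Z: "Z \<in> c1.tau ` free_span S1" "\<psi>1 Z = \<zero>\<^bsub>M\<^esub>" by (simp_all add: c1.tau_image)
    then obtain y where y: "y \<in> free_span S1" "Z = c1.tau y" by blast
    then have "y \<in> P" using Z(2) P_iff psi1(2) by simp
    then show "Z \<in> c1.tau ` P" using y(2) by blast
  qed
  finally have exact1: "\<phi>1 ` carrier (div_tensor W1) = {y \<in> carrier (div_tensor U1). \<psi>1 y = \<zero>\<^bsub>?N\<^esub>}" .
  show ?thesis
    unfolding finitely_presented_def
    by (rule exI[of _ W1], rule exI[of _ U1], intro conjI W1(3,4) U1(3,4) bexI[OF _ phi1(1)] bexI[OF _ psi1(1)])
       (rule exact1, rule onto1)
qed

end
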